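(* Let $A$ be an associative algebra with unit over a ring $K$, let $B\subset A$ be a subalgebra with an augmentation $\varepsilon:B\to K$ (a homomorphism of $K$-algebras), let $X$ be a projective resolution of the left $B$-module $K$, and let $V$ be a left $A$-module. Consider the right action of the graded algebra $\mathrm{End}_A(A\otimes_BX)$ on $\mathrm{Hom}_A(A\otimes_BX,V)=\mathrm{Hom}_B(X,V)$ by composition, $$\mathrm{Hom}_A(A\otimes_BX,V)\times\mathrm{End}_A(A\otimes_BX)\to\mathrm{Hom}_A(A\otimes_BX,V),\qquad (\varphi,f)\mapsto\varphi\circ f .$$ This action gives rise to a (well-defined) right action $$H^*(V)\times Hk^*(A,B)\to H^*(V),\qquad H^n(V)\times Hk^m(A,B)\to H^{n+m}(V).$$
   Context: $K$ is a left $B$-module via $\varepsilon$. For a complex $Z=\{Z^p\}_{p\in\mathbb{Z}}$ of left $A$-modules with differential $d:Z^p\to Z^{p-1}$, the graded algebra $\mathrm{End}_A(Z)$ has degree-$n$ component $\prod_{p}\mathrm{Hom}_A(Z^p,Z^{p-n})$, product given by composition, and differential $\mathbf{d}f=d\circ f-(-1)^{\deg(f)}f\circ d$ of degree $+1$. Its cohomology is a graded associative algebra under the product induced by composition. The Hecke algebra of the triple $(A,B,\varepsilon)$ is $Hk^*(A,B)=H^*(\mathrm{End}_A(A\otimes_BX))$, where $X$ is a projective resolution of the left $B$-module $K$; it is independent of the choice of $X$. For a left $B$-module $V$, $H^*(V)=\mathrm{Ext}^*_B(K,V)=H^*(\mathrm{Hom}_B(X,V))$. For a left $A$-module $V$,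 regarded also as a left $B$-module, $\mathrm{Hom}_B(X,V)=\mathrm{Hom}_A(A\otimes_BX,V)$, with differential $d\varphi=\varphi\circ d$; its degree-$n$ component is $\mathrm{Hom}_A(A\otimes_BX_n,V)$. *)

theory Defs
  imports "HOL-Algebra.Module" "HOL-Algebra.Subrings" "HOL-Algebra.Free_Abelian_Groups"
begin

section \<open>Algebras, augmentations and left modules\<close>

text \<open>The library locales \<open>algebra\<close> and \<open>module\<close> ask for a commutative algebra and a
  commutative ring of scalars respectively, so the noncommutative notions are introduced here, on
  the library's record type. As in the library, the fields \<open>mult\<close> and \<open>one\<close> of a record used as a
  module carry no meaning; the constructions below leave them unspecified.\<close>

locale assoc_algebra = module K A + ring A
  for K :: "'k ring" and A :: "('k, 'a) module" +
  assumes smult_mult_left: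
      "\<lbrakk>k \<in> carrier K; x \<in> carrier A; y \<in> carrier A\<rbrakk>
        \<Longrightarrow> (k \<odot>\<^bsub>A\<^esub> x) \<otimes>\<^bsub>A\<^esub> y = k \<odot>\<^bsub>A\<^esub> (x \<otimes>\<^bsub>A\<^esub> y)"
    and smult_mult_right:
      "\<lbrakk>k \<in> carrier K; x \<in> carrier A; y \<in> carrier A\<rbrakk>
        \<Longrightarrow> x \<otimes>\<^bsub>A\<^esub> (k \<odot>\<^bsub>A\<^esub> y) = k \<odot>\<^bsub>A\<^esub> (x \<otimes>\<^bsub>A\<^esub> y)"

definition unital_subalgebra :: "'k ring \<Rightarrow> ('k, 'a) module \<Rightarrow> 'a set \<Rightarrow> bool"
  where "unital_subalgebra K A B \<longleftrightarrow>
    subring B A \<and> (\<forall>k\<in>carrier K. \<forall>b\<in>B. k \<odot>\<^bsub>A\<^esub> b \<in> B)"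

definition augmentation ::
    "'k ring \<Rightarrow> ('k, 'a) module \<Rightarrow> 'a set \<Rightarrow> ('a \<Rightarrow> 'k) \<Rightarrow> bool"
  where "augmentation K A B \<epsilon> \<longleftrightarrow>
    \<epsilon> \<in> ring_hom (A\<lparr>carrier := B\<rparr>) K \<and>
    (\<forall>k\<in>carrier K. \<forall>b\<in>B. \<epsilon> (k \<odot>\<^bsub>A\<^esub> b) = k \<otimes>\<^bsub>K\<^esub> \<epsilon> b)"

locale left_module = R?: ring R + M?: abelian_group M
  for R :: "('r, 's) ring_scheme" (structure) and M :: "('r, 'm) module" (structure) +
  assumes smult_closed:
      "\<lbrakk>r \<in> carrier R; x \<in> carrier M\<rbrakk> \<Longrightarrow> r \<odot>\<^bsub>M\<^esub> x \<in> carrier M"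
    and smult_l_distr:
      "\<lbrakk>r \<in> carrier R; s \<in> carrier R; x \<in> carrier M\<rbrakk>
        \<Longrightarrow> (r \<oplus>\<^bsub>R\<^esub> s) \<odot>\<^bsub>M\<^esub> x = r \<odot>\<^bsub>M\<^esub> x \<oplus>\<^bsub>M\<^esub> s \<odot>\<^bsub>M\<^esub> x"
    and smult_r_distr:
      "\<lbrakk>r \<in> carrier R; x \<in> carrier M; y \<in> carrier M\<rbrakk>
        \<Longrightarrow> r \<odot>\<^bsub>M\<^esub> (x \<oplus>\<^bsub>M\<^esub> y) = r \<odot>\<^bsub>M\<^esub> x \<oplus>\<^bsub>M\<^esub> r \<odot>\<^bsub>M\<^esub> y"
    and smult_assoc:
      "\<lbrakk>r \<in> carrier R; s \<in> carrier R; x \<in> carrier M\<rbrakk>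
        \<Longrightarrow> (r \<otimes>\<^bsub>R\<^esub> s) \<odot>\<^bsub>M\<^esub> x = r \<odot>\<^bsub>M\<^esub> (s \<odot>\<^bsub>M\<^esub> x)"
    and smult_one:
      "x \<in> carrier M \<Longrightarrow> \<one>\<^bsub>R\<^esub> \<odot>\<^bsub>M\<^esub> x = x"

definition augmentation_module :: "'k ring \<Rightarrow> ('a \<Rightarrow> 'k) \<Rightarrow> ('a, 'k) module"
  where "augmentation_module K \<epsilon> =
    \<lparr>carrier = carrier K, mult = monoid.mult K, one = one K, ring.zero = ring.zero K, add = add K,
     smult = (\<lambda>b k. \<epsilon> b \<otimes>\<^bsub>K\<^esub> k)\<rparr>"

definition lin_map ::
    "('r, 's) ring_scheme \<Rightarrow> ('r, 'm) module \<Rightarrow> ('r, 'n) module \<Rightarrow> ('m \<Rightarrow> 'n) \<Rightarrow> bool"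
  where "lin_map R M N f \<longleftrightarrow>
    f \<in> carrier M \<rightarrow> carrier N \<and>
    (\<forall>x\<in>carrier M. \<forall>y\<in>carrier M. f (x \<oplus>\<^bsub>M\<^esub> y) = f x \<oplus>\<^bsub>N\<^esub> f y) \<and>
    (\<forall>r\<in>carrier R. \<forall>x\<in>carrier M. f (r \<odot>\<^bsub>M\<^esub> x) = r \<odot>\<^bsub>N\<^esub> f x)"

text \<open>Elements of Hom-sets are extensional, so that each linear map has exactly one
  representative.\<close>

definition Lin ::
    "('r, 's) ring_scheme \<Rightarrow> ('r, 'm) module \<Rightarrow> ('r, 'n) module \<Rightarrow> ('m \<Rightarrow> 'n) set"
  where "Lin R M N = {f \<in> extensional (carrier M). lin_map R M N f}"


section \<open>Projective resolutions\<close>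

text \<open>Projectivity is the lifting property against epimorphisms. HOL does not allow quantification
  over all types inside a definition; the test modules range over the types
  \<open>'p \<Rightarrow> 'r\<close> (which accommodates the free module on \<open>carrier P\<close>) and \<open>'p\<close>.
  The lemma \<open>projective_module_lift\<close> below shows that lifting then holds against
  epimorphisms between modules over arbitrary types.\<close>

definition projective_module :: "('r, 's) ring_scheme \<Rightarrow> ('r, 'p) module \<Rightarrow> bool"
  where "projective_module R P \<longleftrightarrow> left_module R P \<and>
    (\<forall>(M :: ('r, 'p \<Rightarrow> 'r) module) (N :: ('r, 'p) module) g f.
      left_module R M \<and> left_module R N \<and>
      lin_map R M N g \<and> g ` carrier M = carrier N \<and> lin_map R P N f
      \<longrightarrow> (\<exists>h. lin_map R P M h \<and> (\<forall>x\<in>carrier P. g (h x) = f x)))"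

definition free_left_module :: "('r, 's) ring_scheme \<Rightarrow> 'p set \<Rightarrow> ('r, 'p \<Rightarrow> 'r) module"
  where "free_left_module R I =
    \<lparr>carrier = {v. (\<forall>x. v x \<in> carrier R) \<and> finite {x. v x \<noteq> \<zero>\<^bsub>R\<^esub>} \<and> {x. v x \<noteq> \<zero>\<^bsub>R\<^esub>} \<subseteq> I},
     monoid.mult = undefined, one = undefined,
     ring.zero = (\<lambda>x. \<zero>\<^bsub>R\<^esub>), add = (\<lambda>v w x. v x \<oplus>\<^bsub>R\<^esub> w x), smult = (\<lambda>r v x. r \<otimes>\<^bsub>R\<^esub> v x)\<rparr>"

definition free_eval :: "('r, 's) ring_scheme \<Rightarrow> ('r, 'm) module \<Rightarrow> ('p \<Rightarrow> 'm) \<Rightarrow> ('p \<Rightarrow> 'r) \<Rightarrow> 'm"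
  where "free_eval R M c v = (\<Oplus>\<^bsub>M\<^esub>x\<in>{x. v x \<noteq> \<zero>\<^bsub>R\<^esub>}. v x \<odot>\<^bsub>M\<^esub> c x)"

lemma left_module_free:
  fixes R :: "('r, 's) ring_scheme" and I :: "'p set"
  assumes "ring R"
  shows "left_module R (free_left_module R I)"
proof -
  interpret ring R by fact
  let ?F = "free_left_module R I"
  have supp_add: "{x. v x \<oplus>\<^bsub>R\<^esub> w x \<noteq> \<zero>\<^bsub>R\<^esub>} \<subseteq> {x. v x \<noteq> \<zero>\<^bsub>R\<^esub>} \<union> {x. w x \<noteq> \<zero>\<^bsub>R\<^esub>}" for v w :: "'p \<Rightarrow> 'r"
    by auto
  have supp_smult: "{x. r \<otimes>\<^bsub>R\<^esub> v x \<noteq> \<zero>\<^bsub>R\<^esub>} \<subseteq> {x. v x \<noteq> \<zero>\<^bsub>R\<^esub>}" if "r \<in> carrier R" for r and v :: "'p \<Rightarrow> 'r"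
    using that by auto
  have "abelian_group ?F"
  proof (rule abelian_groupI)
    show "x \<oplus>\<^bsub>?F\<^esub> y \<in> carrier ?F" if "x \<in> carrier ?F" "y \<in> carrier ?F" for x y
      using that supp_add[of x y]
      by (auto simp: free_left_module_def intro: finite_subset[of _ "{u. x u \<noteq> \<zero>\<^bsub>R\<^esub>} \<union> {u. y u \<noteq> \<zero>\<^bsub>R\<^esub>}"])
    show "\<exists>y\<in>carrier ?F. y \<oplus>\<^bsub>?F\<^esub> x = \<zero>\<^bsub>?F\<^esub>" if "x \<in> carrier ?F" for x
    proof (rule bexI[of _ "\<lambda>u. \<ominus>\<^bsub>R\<^esub> x u"])
      show "(\<lambda>u. \<ominus>\<^bsub>R\<^esub> x u) \<oplus>\<^bsub>?F\<^esub> x = \<zero>\<^bsub>?F\<^esub>"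
        using that by (auto simp: free_left_module_def l_neg)
      have "{u. \<ominus>\<^bsub>R\<^esub> x u \<noteq> \<zero>\<^bsub>R\<^esub>} \<subseteq> {u. x u \<noteq> \<zero>\<^bsub>R\<^esub>}" by auto
      then show "(\<lambda>u. \<ominus>\<^bsub>R\<^esub> x u) \<in> carrier ?F"
        using that by (auto simp: free_left_module_def intro: finite_subset)
    qed
  qed (auto simp: free_left_module_def a_ac)
  moreover have "left_module_axioms R ?F"
  proof
    show "r \<odot>\<^bsub>?F\<^esub> x \<in> carrier ?F" if "r \<in> carrier R" "x \<in> carrier ?F" for r x
      using that supp_smult[of r x]
      by (auto simp: free_left_module_def intro: finite_subset)
  qed (auto simp: free_left_module_def l_distr r_distr m_assoc)
  ultimately show ?thesis
    using assms by (simp add: left_module_def)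
qed

lemma (in left_module) smult_zero_left: "x \<in> carrier M \<Longrightarrow> \<zero> \<odot>\<^bsub>M\<^esub> x = \<zero>\<^bsub>M\<^esub>"
  using smult_l_distr[of \<zero> \<zero> x] smult_closed[of \<zero> x] M.add.r_cancel_one' by fastforce

lemma free_eval_superset:
  assumes "left_module R M" "finite S" "{x. v x \<noteq> \<zero>\<^bsub>R\<^esub>} \<subseteq> S"
    and "\<And>x. v x \<in> carrier R" "c \<in> S \<rightarrow> carrier M"
  shows "free_eval R M c v = (\<Oplus>\<^bsub>M\<^esub>x\<in>S. v x \<odot>\<^bsub>M\<^esub> c x)"
proof -
  interpret left_module R M by fact
  show ?thesis
    unfolding free_eval_def using assms(2-)
    by (intro M.add.finprod_mono_neutral_cong_left[simplified])
       (auto simp: smult_zero_left smult_closed Pi_iff)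
qed

lemma lin_map_free_eval:
  assumes "left_module R M" "c \<in> I \<rightarrow> carrier M"
  shows "lin_map R (free_left_module R I) M (free_eval R M c)"
proof -
  interpret left_module R M by fact
  let ?F = "free_left_module R I"
  have sup: "free_eval R M c v = (\<Oplus>\<^bsub>M\<^esub>x\<in>S. v x \<odot>\<^bsub>M\<^esub> c x)"
    if "\<And>x. v x \<in> carrier R" "finite S" "{x. v x \<noteq> \<zero>\<^bsub>R\<^esub>} \<subseteq> S" "S \<subseteq> I" for v S
    using that assms by (intro free_eval_superset) auto
  have cl: "(\<lambda>x. v x \<odot>\<^bsub>M\<^esub> c x) \<in> S \<rightarrow> carrier M"
    if "\<And>x. v x \<in> carrier R" "S \<subseteq> I" for v S
    using that assms(2) by (auto intro!: smult_closed)
  have closed: "free_eval R M c v \<in> carrier M" if "v \<in> carrier ?F" for v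
    unfolding free_eval_def using that
    by (intro M.finsum_closed cl) (auto simp: free_left_module_def)
  have add: "free_eval R M c (v \<oplus>\<^bsub>?F\<^esub> w) = free_eval R M c v \<oplus>\<^bsub>M\<^esub> free_eval R M c w"
    if v: "v \<in> carrier ?F" and w: "w \<in> carrier ?F" for v w
  proof -
    define S where "S = {x. v x \<noteq> \<zero>\<^bsub>R\<^esub>} \<union> {x. w x \<noteq> \<zero>\<^bsub>R\<^esub>}"
    have S: "finite S" "S \<subseteq> I" using v w by (auto simp: S_def free_left_module_def)
    have vw: "\<And>x. v x \<in> carrier R" "\<And>x. w x \<in> carrier R"
      using v w by (auto simp: free_left_module_def)
    have "free_eval R M c (v \<oplus>\<^bsub>?F\<^esub> w) = (\<Oplus>\<^bsub>M\<^esub>x\<in>S. (v x \<oplus>\<^bsub>R\<^esub> w x) \<odot>\<^bsub>M\<^esub> c x)"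
      using S vw by (subst sup[of _ S]) (auto simp: free_left_module_def S_def)
    also have "\<dots> = (\<Oplus>\<^bsub>M\<^esub>x\<in>S. v x \<odot>\<^bsub>M\<^esub> c x \<oplus>\<^bsub>M\<^esub> w x \<odot>\<^bsub>M\<^esub> c x)"
      using S vw assms(2)
      by (intro M.finsum_cong') (auto intro!: smult_l_distr smult_closed M.a_closed)
    also have "\<dots> = (\<Oplus>\<^bsub>M\<^esub>x\<in>S. v x \<odot>\<^bsub>M\<^esub> c x) \<oplus>\<^bsub>M\<^esub> (\<Oplus>\<^bsub>M\<^esub>x\<in>S. w x \<odot>\<^bsub>M\<^esub> c x)"
      using S vw by (intro M.finsum_addf cl) auto
    also have "(\<Oplus>\<^bsub>M\<^esub>x\<in>S. v x \<odot>\<^bsub>M\<^esub> c x) = free_eval R M c v"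
      using S vw by (subst sup[of _ S]) (auto simp: S_def)
    also have "(\<Oplus>\<^bsub>M\<^esub>x\<in>S. w x \<odot>\<^bsub>M\<^esub> c x) = free_eval R M c w"
      using S vw by (subst sup[of _ S]) (auto simp: S_def)
    finally show ?thesis .
  qed
  have smult: "free_eval R M c (r \<odot>\<^bsub>?F\<^esub> v) = r \<odot>\<^bsub>M\<^esub> free_eval R M c v"
    if r: "r \<in> carrier R" and v: "v \<in> carrier ?F" for r v
  proof -
    define S where "S = {x. v x \<noteq> \<zero>\<^bsub>R\<^esub>}"
    have S: "finite S" "S \<subseteq> I" using v by (auto simp: S_def free_left_module_def)
    have vR: "\<And>x. v x \<in> carrier R" using v by (auto simp: free_left_module_def)
    have r0: "r \<odot>\<^bsub>M\<^esub> \<zero>\<^bsub>M\<^esub> = \<zero>\<^bsub>M\<^esub>"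
      using smult_r_distr[OF r, of "\<zero>\<^bsub>M\<^esub>" "\<zero>\<^bsub>M\<^esub>"] smult_closed[OF r, of "\<zero>\<^bsub>M\<^esub>"]
        M.add.r_cancel_one' by fastforce
    have *: "r \<odot>\<^bsub>M\<^esub> (\<Oplus>\<^bsub>M\<^esub>x\<in>T. v x \<odot>\<^bsub>M\<^esub> c x) = (\<Oplus>\<^bsub>M\<^esub>x\<in>T. r \<odot>\<^bsub>M\<^esub> (v x \<odot>\<^bsub>M\<^esub> c x))"
      if "finite T" "T \<subseteq> I" for T
      using that
    proof (induction T)
      case (insert t T)
      have c: "c x \<in> carrier M" if "x \<in> insert t T" for x
        using that insert.prems assms(2) by auto
      show ?case
        using insert c vR r
        by (simp add: M.finsum_insert Pi_iff smult_closed smult_r_distr M.finsum_closed)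
    qed (simp add: r0)
    have "free_eval R M c (r \<odot>\<^bsub>?F\<^esub> v) = (\<Oplus>\<^bsub>M\<^esub>x\<in>S. (r \<otimes>\<^bsub>R\<^esub> v x) \<odot>\<^bsub>M\<^esub> c x)"
      using S vR r by (subst sup[of _ S]) (auto simp: free_left_module_def S_def)
    also have "\<dots> = (\<Oplus>\<^bsub>M\<^esub>x\<in>S. r \<odot>\<^bsub>M\<^esub> (v x \<odot>\<^bsub>M\<^esub> c x))"
      using S vR r assms(2)
      by (intro M.finsum_cong') (auto intro!: smult_assoc smult_closed)
    also have "\<dots> = r \<odot>\<^bsub>M\<^esub> free_eval R M c v"
      using S vR by (subst sup[of _ S]) (auto simp: S_def *)
    finally show ?thesis .
  qed
  show ?thesis
    unfolding lin_map_def using closed add smult by auto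
qed

lemma lin_map_of_free_eval:
  assumes "left_module R M" "left_module R N" "lin_map R M N g" "c \<in> I \<rightarrow> carrier M"
    and v: "v \<in> carrier (free_left_module R I)"
  shows "g (free_eval R M c v) = free_eval R N (\<lambda>x. g (c x)) v"
proof -
  interpret M: left_module R M by fact
  interpret N: left_module R N by fact
  have g: "g x \<in> carrier N" if "x \<in> carrier M" for x
    using that assms(3) by (auto simp: lin_map_def)
  have g0: "g \<zero>\<^bsub>M\<^esub> = \<zero>\<^bsub>N\<^esub>"
  proof -
    have "g \<zero>\<^bsub>M\<^esub> = g \<zero>\<^bsub>M\<^esub> \<oplus>\<^bsub>N\<^esub> g \<zero>\<^bsub>M\<^esub>"
      using assms(3) unfolding lin_map_def by (metis M.M.zero_closed M.M.l_zero)
    then show ?thesis using g[of "\<zero>\<^bsub>M\<^esub>"] N.M.add.r_cancel_one' by fastforce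
  qed
  have vR: "\<And>x. v x \<in> carrier R" using v by (auto simp: free_left_module_def)
  have "g (\<Oplus>\<^bsub>M\<^esub>x\<in>T. v x \<odot>\<^bsub>M\<^esub> c x) = (\<Oplus>\<^bsub>N\<^esub>x\<in>T. v x \<odot>\<^bsub>N\<^esub> g (c x))"
    if "finite T" "T \<subseteq> I" for T
    using that
  proof (induction T)
    case (insert t T)
    have c: "c x \<in> carrier M" if "x \<in> insert t T" for x
      using that insert.prems assms(4) by auto
    have "g (\<Oplus>\<^bsub>M\<^esub>x\<in>insert t T. v x \<odot>\<^bsub>M\<^esub> c x)
        = g (v t \<odot>\<^bsub>M\<^esub> c t \<oplus>\<^bsub>M\<^esub> (\<Oplus>\<^bsub>M\<^esub>x\<in>T. v x \<odot>\<^bsub>M\<^esub> c x))"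
      using insert c vR by (simp add: M.M.finsum_insert Pi_iff M.smult_closed)
    also have "\<dots> = g (v t \<odot>\<^bsub>M\<^esub> c t) \<oplus>\<^bsub>N\<^esub> g (\<Oplus>\<^bsub>M\<^esub>x\<in>T. v x \<odot>\<^bsub>M\<^esub> c x)"
    proof -
      have "v t \<odot>\<^bsub>M\<^esub> c t \<in> carrier M" using c vR by (simp add: M.smult_closed)
      moreover have "(\<Oplus>\<^bsub>M\<^esub>x\<in>T. v x \<odot>\<^bsub>M\<^esub> c x) \<in> carrier M"
        using c vR by (intro M.M.finsum_closed) (auto intro!: M.smult_closed)
      ultimately show ?thesis using assms(3) by (simp add: lin_map_def)
    qed
    also have "g (v t \<odot>\<^bsub>M\<^esub> c t) = v t \<odot>\<^bsub>N\<^esub> g (c t)"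
      using c vR assms(3) by (simp add: lin_map_def)
    also have "g (\<Oplus>\<^bsub>M\<^esub>x\<in>T. v x \<odot>\<^bsub>M\<^esub> c x) = (\<Oplus>\<^bsub>N\<^esub>x\<in>T. v x \<odot>\<^bsub>N\<^esub> g (c x))"
      using insert by simp
    finally show ?case
      using insert c vR g by (simp add: N.M.finsum_insert Pi_iff N.smult_closed)
  qed (simp add: g0)
  then show ?thesis
    using v by (simp add: free_eval_def free_left_module_def)
qed

lemma projective_module_lift:
  fixes P :: "('r, 'p) module" and M :: "('r, 'm) module" and N :: "('r, 'n) module"
  assumes P: "projective_module R P"
    and M: "left_module R M" and N: "left_module R N"
    and g: "lin_map R M N g" "g ` carrier M = carrier N" and f: "lin_map R P N f"
  shows "\<exists>h. lin_map R P M h \<and> (\<forall>x\<in>carrier P. g (h x) = f x)"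
proof -
  let ?F = "free_left_module R (carrier P)"
  have lP: "left_module R P" using P by (simp add: projective_module_def)
  interpret P: left_module R P by fact
  have e: "lin_map R ?F P (free_eval R P (\<lambda>x. x))"
    by (rule lin_map_free_eval[OF lP]) auto
  have "p \<in> free_eval R P (\<lambda>x. x) ` carrier ?F" if p: "p \<in> carrier P" for p
  proof
    let ?v = "\<lambda>x. if x = p then \<one>\<^bsub>R\<^esub> else \<zero>\<^bsub>R\<^esub>"
    have "{x. ?v x \<noteq> \<zero>\<^bsub>R\<^esub>} \<subseteq> {p}" by auto
    then show "?v \<in> carrier ?F"
      using p by (auto simp: free_left_module_def intro: finite_subset[of _ "{p}"])
    show "p = free_eval R P (\<lambda>x. x) ?v"
      using p by (subst free_eval_superset[OF lP, of "{p}"]) (auto simp: P.smult_one)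
  qed
  then have onto: "free_eval R P (\<lambda>x. x) ` carrier ?F = carrier P"
    using e by (auto simp: lin_map_def)
  have "lin_map R P P (\<lambda>x. x)" by (auto simp: lin_map_def)
  then obtain s where s: "lin_map R P ?F s" "\<And>x. x \<in> carrier P \<Longrightarrow> free_eval R P (\<lambda>x. x) (s x) = x"
    using P left_module_free[OF P.R.ring_axioms, of "carrier P"] e onto lP
    unfolding projective_module_def by meson
  have "\<forall>x\<in>carrier P. \<exists>m\<in>carrier M. g m = f x"
    using f g(2) unfolding lin_map_def by (metis (no_types, lifting) Pi_mem imageE)
  then obtain c where c: "\<And>x. x \<in> carrier P \<Longrightarrow> c x \<in> carrier M" "\<And>x. x \<in> carrier P \<Longrightarrow> g (c x) = f x"
    by metis
  let ?h = "\<lambda>x. free_eval R M c (s x)"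
  have k: "lin_map R ?F M (free_eval R M c)"
    using c by (intro lin_map_free_eval[OF M]) auto
  have sF: "s x \<in> carrier ?F" if "x \<in> carrier P" for x
    using that s(1) by (auto simp: lin_map_def)
  have "lin_map R P M ?h"
    using k s(1) sF by (auto simp: lin_map_def Pi_iff)
  moreover have "g (?h x) = f x" if x: "x \<in> carrier P" for x
  proof -
    have "g (?h x) = free_eval R N (\<lambda>y. g (c y)) (s x)"
      using c sF[OF x] by (intro lin_map_of_free_eval[OF M N g(1)]) auto
    also have "\<dots> = free_eval R N f (s x)"
    proof -
      interpret N: left_module R N by fact
      have "s x \<in> carrier ?F" by (rule sF[OF x])
      then show ?thesis unfolding free_eval_def
        using c(2) f
        by (intro N.M.finsum_cong')
           (auto simp: free_left_module_def lin_map_def intro!: N.smult_closed)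
    qed
    also have "\<dots> = f (free_eval R P (\<lambda>y. y) (s x))"
      using sF[OF x] by (intro lin_map_of_free_eval[OF lP N f, symmetric]) auto
    finally show ?thesis using s(2)[OF x] by simp
  qed
  ultimately show ?thesis by blast
qed

definition chain_complex ::
    "('r, 's) ring_scheme \<Rightarrow> (int \<Rightarrow> ('r, 'z) module) \<Rightarrow> (int \<Rightarrow> 'z \<Rightarrow> 'z) \<Rightarrow> bool"
  where "chain_complex R Z d \<longleftrightarrow>
    (\<forall>p. left_module R (Z p)) \<and>
    (\<forall>p. lin_map R (Z p) (Z (p - 1)) (d p)) \<and>
    (\<forall>p. \<forall>z\<in>carrier (Z p). d (p - 1) (d p z) = \<zero>\<^bsub>Z (p - 2)\<^esub>)"

text \<open>A resolution \<open>\<dots> \<rightarrow> X\<^sub>1 \<rightarrow> X\<^sub>0 \<rightarrow> M \<rightarrow> 0\<close> is regarded as a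
  complex indexed by all integers, zero in negative degrees.\<close>

definition projective_resolution ::
    "('r, 's) ring_scheme \<Rightarrow> ('r, 'm) module \<Rightarrow> (int \<Rightarrow> ('r, 'x) module) \<Rightarrow>
     (int \<Rightarrow> 'x \<Rightarrow> 'x) \<Rightarrow> ('x \<Rightarrow> 'm) \<Rightarrow> bool"
  where "projective_resolution R M X d \<pi> \<longleftrightarrow>
    chain_complex R X d \<and>
    (\<forall>n. projective_module R (X n)) \<and>
    (\<forall>n<0. carrier (X n) = {\<zero>\<^bsub>X n\<^esub>}) \<and>
    lin_map R (X 0) M \<pi> \<and>
    \<pi> ` carrier (X 0) = carrier M \<and>
    {x \<in> carrier (X 0). \<pi> x = \<zero>\<^bsub>M\<^esub>} = d 1 ` carrier (X 1) \<and>
    (\<forall>n\<ge>1. {x \<in> carrier (X n). d n x = \<zero>\<^bsub>X (n - 1)\<^esub>} = d (n + 1) ` carrier (X (n + 1)))"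


section \<open>The induced module \<open>A \<otimes>\<^sub>B X\<close>\<close>

text \<open>The tensor product is the free abelian group on \<open>A \<times> X\<close> modulo the subgroup generated by
  the biadditivity and balancing relations.\<close>

definition tensor_rels ::
    "('k, 'a) module \<Rightarrow> 'a set \<Rightarrow> ('a, 'x) module \<Rightarrow> ('a \<times> 'x \<Rightarrow>\<^sub>0 int) set"
  where "tensor_rels A B M = generate (free_Abelian_group (carrier A \<times> carrier M))
    ({frag_of (a \<oplus>\<^bsub>A\<^esub> a', x) - frag_of (a, x) - frag_of (a', x) | a a' x.
        a \<in> carrier A \<and> a' \<in> carrier A \<and> x \<in> carrier M} \<union>
     {frag_of (a, x \<oplus>\<^bsub>M\<^esub> x') - frag_of (a, x) - frag_of (a, x') | a x x'.
        a \<in> carrier A \<and> x \<in> carrier M \<and> x' \<in> carrier M} \<union>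
     {frag_of (a \<otimes>\<^bsub>A\<^esub> b, x) - frag_of (a, b \<odot>\<^bsub>M\<^esub> x) | a b x.
        a \<in> carrier A \<and> b \<in> B \<and> x \<in> carrier M})"

definition tensor_class ::
    "('k, 'a) module \<Rightarrow> 'a set \<Rightarrow> ('a, 'x) module \<Rightarrow> ('a \<times> 'x \<Rightarrow>\<^sub>0 int) \<Rightarrow> ('a \<times> 'x \<Rightarrow>\<^sub>0 int) set"
  where "tensor_class A B M v =
    tensor_rels A B M #>\<^bsub>free_Abelian_group (carrier A \<times> carrier M)\<^esub> v"

abbreviation pure_tensor ::
    "('k, 'a) module \<Rightarrow> 'a set \<Rightarrow> ('a, 'x) module \<Rightarrow> 'a \<Rightarrow> 'x \<Rightarrow> ('a \<times> 'x \<Rightarrow>\<^sub>0 int) set"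
  where "pure_tensor A B M a x \<equiv> tensor_class A B M (frag_of (a, x))"

text \<open>\<open>A\<close> acts by \<open>a (a' \<otimes> x) = (a a') \<otimes> x\<close>. Operations on cosets are defined, as is
  usual for quotients in the library, by the union over all representatives.\<close>

definition induced_module ::
    "('k, 'a) module \<Rightarrow> 'a set \<Rightarrow> ('a, 'x) module \<Rightarrow> ('a, ('a \<times> 'x \<Rightarrow>\<^sub>0 int) set) module"
  where "induced_module A B M =
    (let T = free_Abelian_group (carrier A \<times> carrier M) Mod tensor_rels A B M in
      \<lparr>carrier = carrier T, monoid.mult = undefined, one = undefined, ring.zero = one T, add = monoid.mult T,
       smult = (\<lambda>a C. \<Union>v\<in>C.
          tensor_class A B M (frag_extend (\<lambda>(a', x). frag_of (a \<otimes>\<^bsub>A\<^esub> a', x)) v))\<rparr>)"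

text \<open>\<open>id \<otimes> h : A \<otimes>\<^sub>B M \<rightarrow> A \<otimes>\<^sub>B N\<close>\<close>

definition induced_map ::
    "('k, 'a) module \<Rightarrow> 'a set \<Rightarrow> ('a, 'x) module \<Rightarrow> ('a, 'y) module \<Rightarrow> ('x \<Rightarrow> 'y) \<Rightarrow>
     ('a \<times> 'x \<Rightarrow>\<^sub>0 int) set \<Rightarrow> ('a \<times> 'y \<Rightarrow>\<^sub>0 int) set"
  where "induced_map A B M N h =
    (\<lambda>C\<in>carrier (induced_module A B M).
      \<Union>v\<in>C. tensor_class A B N (frag_extend (\<lambda>(a, x). frag_of (a, h x)) v))"

abbreviation induced_complex ::
    "('k, 'a) module \<Rightarrow> 'a set \<Rightarrow> (int \<Rightarrow> ('a, 'x) module) \<Rightarrow>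
     int \<Rightarrow> ('a, ('a \<times> 'x \<Rightarrow>\<^sub>0 int) set) module"
  where "induced_complex A B X n \<equiv> induced_module A B (X n)"

abbreviation induced_diff ::
    "('k, 'a) module \<Rightarrow> 'a set \<Rightarrow> (int \<Rightarrow> ('a, 'x) module) \<Rightarrow> (int \<Rightarrow> 'x \<Rightarrow> 'x) \<Rightarrow>
     int \<Rightarrow> ('a \<times> 'x \<Rightarrow>\<^sub>0 int) set \<Rightarrow> ('a \<times> 'x \<Rightarrow>\<^sub>0 int) set"
  where "induced_diff A B X d n \<equiv> induced_map A B (X n) (X (n - 1)) (d n)"


section \<open>Cochain complexes of \<open>K\<close>-modules and their cohomology\<close>

definition cocycles ::
    "(int \<Rightarrow> ('k, 'c) module) \<Rightarrow> (int \<Rightarrow> 'c \<Rightarrow> 'c) \<Rightarrow> int \<Rightarrow> 'c set"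
  where "cocycles C \<delta> n = {c \<in> carrier (C n). \<delta> n c = \<zero>\<^bsub>C (n + 1)\<^esub>}"

definition coboundaries ::
    "(int \<Rightarrow> ('k, 'c) module) \<Rightarrow> (int \<Rightarrow> 'c \<Rightarrow> 'c) \<Rightarrow> int \<Rightarrow> 'c set"
  where "coboundaries C \<delta> n = \<delta> (n - 1) ` carrier (C (n - 1))"

definition cohom_class ::
    "(int \<Rightarrow> ('k, 'c) module) \<Rightarrow> (int \<Rightarrow> 'c \<Rightarrow> 'c) \<Rightarrow> int \<Rightarrow> 'c \<Rightarrow> 'c set"
  where "cohom_class C \<delta> n c = coboundaries C \<delta> n +>\<^bsub>C n\<^esub> c"

definition cohomology ::
    "(int \<Rightarrow> ('k, 'c) module) \<Rightarrow> (int \<Rightarrow> 'c \<Rightarrow> 'c) \<Rightarrow> int \<Rightarrow> ('k, 'c set) module"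
  where "cohomology C \<delta> n =
    \<lparr>carrier = cohom_class C \<delta> n ` cocycles C \<delta> n,
     monoid.mult = undefined, one = undefined,
     ring.zero = coboundaries C \<delta> n,
     add = (\<lambda>S T. S <+>\<^bsub>C n\<^esub> T),
     smult = (\<lambda>k S. \<Union>c\<in>S. cohom_class C \<delta> n (k \<odot>\<^bsub>C n\<^esub> c))\<rparr>"

definition cochain_iso ::
    "'k ring \<Rightarrow> (int \<Rightarrow> ('k, 'c) module) \<Rightarrow> (int \<Rightarrow> 'c \<Rightarrow> 'c) \<Rightarrow>
     (int \<Rightarrow> ('k, 'e) module) \<Rightarrow> (int \<Rightarrow> 'e \<Rightarrow> 'e) \<Rightarrow> (int \<Rightarrow> 'c \<Rightarrow> 'e) \<Rightarrow> bool"
  where "cochain_iso K C \<delta> C' \<delta>' r \<longleftrightarrow>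
    (\<forall>n. lin_map K (C n) (C' n) (r n) \<and>
         bij_betw (r n) (carrier (C n)) (carrier (C' n)) \<and>
         (\<forall>c\<in>carrier (C n). r (n + 1) (\<delta> n c) = \<delta>' n (r n c)))"


section \<open>The complexes \<open>End\<^sub>A(Z)\<close> and \<open>Hom(Z, V)\<close>\<close>

text \<open>Throughout, \<open>k \<in> K\<close> acts on a module over a \<open>K\<close>-algebra as \<open>k 1\<^sub>A\<close>.\<close>

definition End_deg ::
    "('k, 'a) module \<Rightarrow> (int \<Rightarrow> ('a, 'z) module) \<Rightarrow> int \<Rightarrow> ('k, int \<Rightarrow> 'z \<Rightarrow> 'z) module"
  where "End_deg A Z n =
    \<lparr>carrier = {f. \<forall>p. f p \<in> Lin A (Z p) (Z (p - n))},
     monoid.mult = undefined, one = undefined,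
     ring.zero = (\<lambda>p. \<lambda>z\<in>carrier (Z p). \<zero>\<^bsub>Z (p - n)\<^esub>),
     add = (\<lambda>f g p. \<lambda>z\<in>carrier (Z p). f p z \<oplus>\<^bsub>Z (p - n)\<^esub> g p z),
     smult = (\<lambda>k f p. \<lambda>z\<in>carrier (Z p). (k \<odot>\<^bsub>A\<^esub> \<one>\<^bsub>A\<^esub>) \<odot>\<^bsub>Z (p - n)\<^esub> f p z)\<rparr>"

text \<open>\<open>d f = d \<circ> f - (-1)\<^sup>n f \<circ> d\<close> for \<open>f\<close> of degree \<open>n\<close>\<close>

definition End_diff ::
    "(int \<Rightarrow> ('a, 'z) module) \<Rightarrow> (int \<Rightarrow> 'z \<Rightarrow> 'z) \<Rightarrow> int \<Rightarrow> (int \<Rightarrow> 'z \<Rightarrow> 'z) \<Rightarrow> int \<Rightarrow> 'z \<Rightarrow> 'z"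
  where "End_diff Z d n f = (\<lambda>p. \<lambda>z\<in>carrier (Z p).
    if even n then d (p - n) (f p z) \<ominus>\<^bsub>Z (p - n - 1)\<^esub> f (p - 1) (d p z)
    else d (p - n) (f p z) \<oplus>\<^bsub>Z (p - n - 1)\<^esub> f (p - 1) (d p z))"

text \<open>\<open>f \<circ> g\<close> for \<open>g\<close> of degree \<open>m\<close>\<close>

definition End_comp ::
    "(int \<Rightarrow> ('a, 'z) module) \<Rightarrow> int \<Rightarrow> (int \<Rightarrow> 'z \<Rightarrow> 'z) \<Rightarrow> (int \<Rightarrow> 'z \<Rightarrow> 'z) \<Rightarrow> int \<Rightarrow> 'z \<Rightarrow> 'z"
  where "End_comp Z m f g = (\<lambda>p. \<lambda>z\<in>carrier (Z p). f (p - m) (g p z))"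

definition End_id :: "(int \<Rightarrow> ('a, 'z) module) \<Rightarrow> int \<Rightarrow> 'z \<Rightarrow> 'z"
  where "End_id Z = (\<lambda>p. \<lambda>z\<in>carrier (Z p). z)"

text \<open>\<open>Hom\<^sub>S(Z\<^sub>n, V)\<close> for \<open>S \<subseteq> A\<close>; it is used with \<open>S = A\<close> and \<open>S = B\<close>.\<close>

definition Hom_deg ::
    "('k, 'a) module \<Rightarrow> 'a set \<Rightarrow> (int \<Rightarrow> ('a, 'z) module) \<Rightarrow> ('a, 'v) module \<Rightarrow>
     int \<Rightarrow> ('k, 'z \<Rightarrow> 'v) module"
  where "Hom_deg A S Z V n =
    \<lparr>carrier = Lin (A\<lparr>carrier := S\<rparr>) (Z n) V,
     monoid.mult = undefined, one = undefined,
     ring.zero = (\<lambda>z\<in>carrier (Z n). \<zero>\<^bsub>V\<^esub>),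
     add = (\<lambda>\<phi> \<psi>. \<lambda>z\<in>carrier (Z n). \<phi> z \<oplus>\<^bsub>V\<^esub> \<psi> z),
     smult = (\<lambda>k \<phi>. \<lambda>z\<in>carrier (Z n). (k \<odot>\<^bsub>A\<^esub> \<one>\<^bsub>A\<^esub>) \<odot>\<^bsub>V\<^esub> \<phi> z)\<rparr>"

definition Hom_diff ::
    "(int \<Rightarrow> ('a, 'z) module) \<Rightarrow> (int \<Rightarrow> 'z \<Rightarrow> 'z) \<Rightarrow> int \<Rightarrow> ('z \<Rightarrow> 'v) \<Rightarrow> 'z \<Rightarrow> 'v"
  where "Hom_diff Z d n \<phi> = (\<lambda>z\<in>carrier (Z (n + 1)). \<phi> (d (n + 1) z))"

text \<open>\<open>\<phi> \<circ> f\<close> for \<open>\<phi>\<close> of degree \<open>n\<close> and \<open>f\<close> of degree \<open>m\<close>\<close>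

definition Hom_comp ::
    "(int \<Rightarrow> ('a, 'z) module) \<Rightarrow> int \<Rightarrow> int \<Rightarrow> ('z \<Rightarrow> 'v) \<Rightarrow> (int \<Rightarrow> 'z \<Rightarrow> 'z) \<Rightarrow> 'z \<Rightarrow> 'v"
  where "Hom_comp Z n m \<phi> f = (\<lambda>z\<in>carrier (Z (n + m)). \<phi> (f (n + m) z))"


section \<open>The Hecke algebra and its action\<close>

text \<open>\<open>Hk\<^sup>*(A, B)\<close>, computed with the resolution \<open>(X, d)\<close>\<close>

abbreviation hecke_cochains ::
    "('k, 'a) module \<Rightarrow> 'a set \<Rightarrow> (int \<Rightarrow> ('a, 'x) module) \<Rightarrow>
     int \<Rightarrow> ('k, int \<Rightarrow> ('a \<times> 'x \<Rightarrow>\<^sub>0 int) set \<Rightarrow> ('a \<times> 'x \<Rightarrow>\<^sub>0 int) set) module"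
  where "hecke_cochains A B X \<equiv> End_deg A (induced_complex A B X)"

abbreviation hecke_diff ::
    "('k, 'a) module \<Rightarrow> 'a set \<Rightarrow> (int \<Rightarrow> ('a, 'x) module) \<Rightarrow> (int \<Rightarrow> 'x \<Rightarrow> 'x) \<Rightarrow>
     int \<Rightarrow> (int \<Rightarrow> ('a \<times> 'x \<Rightarrow>\<^sub>0 int) set \<Rightarrow> ('a \<times> 'x \<Rightarrow>\<^sub>0 int) set) \<Rightarrow>
     int \<Rightarrow> ('a \<times> 'x \<Rightarrow>\<^sub>0 int) set \<Rightarrow> ('a \<times> 'x \<Rightarrow>\<^sub>0 int) set"
  where "hecke_diff A B X d \<equiv> End_diff (induced_complex A B X) (induced_diff A B X d)"

abbreviation hecke_class where
  "hecke_class A B X d \<equiv> cohom_class (hecke_cochains A B X) (hecke_diff A B X d)"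

abbreviation hecke where
  "hecke A B X d \<equiv> cohomology (hecke_cochains A B X) (hecke_diff A B X d)"

definition hecke_mult where
  "hecke_mult A B X d n m S T =
    (\<Union>f\<in>S. \<Union>g\<in>T. hecke_class A B X d (n + m) (End_comp (induced_complex A B X) m f g))"

definition hecke_one where
  "hecke_one A B X d = hecke_class A B X d 0 (End_id (induced_complex A B X))"

text \<open>\<open>H\<^sup>*(V) = H\<^sup>*(Hom\<^sub>B(X, V))\<close>\<close>

abbreviation ext_class where
  "ext_class A B X d V \<equiv> cohom_class (Hom_deg A B X V) (Hom_diff X d)"

abbreviation ext_module where
  "ext_module A B X d V \<equiv> cohomology (Hom_deg A B X V) (Hom_diff X d)"

text \<open>The complex \<open>Hom\<^sub>A(A \<otimes>\<^sub>B X, V)\<close> and its identification with \<open>Hom\<^sub>B(X, V)\<close>, sending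
  \<open>\<phi>\<close> to \<open>x \<mapsto> \<phi> (1 \<otimes> x)\<close>\<close>

abbreviation ind_Hom where
  "ind_Hom A B X V \<equiv> Hom_deg A (carrier A) (induced_complex A B X) V"

abbreviation ind_Hom_diff where
  "ind_Hom_diff A B X d \<equiv> Hom_diff (induced_complex A B X) (induced_diff A B X d)"

definition restr ::
    "('k, 'a) module \<Rightarrow> 'a set \<Rightarrow> (int \<Rightarrow> ('a, 'x) module) \<Rightarrow> int \<Rightarrow>
     (('a \<times> 'x \<Rightarrow>\<^sub>0 int) set \<Rightarrow> 'v) \<Rightarrow> 'x \<Rightarrow> 'v"
  where "restr A B X n \<phi> = (\<lambda>x\<in>carrier (X n). \<phi> (pure_tensor A B (X n) \<one>\<^bsub>A\<^esub> x))"

definition hecke_act where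
  "hecke_act A B X d V n m S T =
    (\<Union>\<phi>\<in>{\<phi> \<in> carrier (ind_Hom A B X V n). restr A B X n \<phi> \<in> S}. \<Union>f\<in>T.
      ext_class A B X d V (n + m)
        (restr A B X (n + m) (Hom_comp (induced_complex A B X) n m \<phi> f)))"


section \<open>Graded algebras and graded right modules\<close>

locale graded_algebra =
  fixes K :: "'k ring" and G :: "int \<Rightarrow> ('k, 'g) module"
    and mul :: "int \<Rightarrow> int \<Rightarrow> 'g \<Rightarrow> 'g \<Rightarrow> 'g" and u :: 'g
  assumes G_module: "module K (G n)"
    and mul_closed: "\<lbrakk>x \<in> carrier (G n); y \<in> carrier (G m)\<rbrakk> \<Longrightarrow> mul n m x y \<in> carrier (G (n + m))"
    and mul_add_left: "\<lbrakk>x \<in> carrier (G n); x' \<in> carrier (G n); y \<in> carrier (G m)\<rbrakk>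
      \<Longrightarrow> mul n m (x \<oplus>\<^bsub>G n\<^esub> x') y = mul n m x y \<oplus>\<^bsub>G (n + m)\<^esub> mul n m x' y"
    and mul_add_right: "\<lbrakk>x \<in> carrier (G n); y \<in> carrier (G m); y' \<in> carrier (G m)\<rbrakk>
      \<Longrightarrow> mul n m x (y \<oplus>\<^bsub>G m\<^esub> y') = mul n m x y \<oplus>\<^bsub>G (n + m)\<^esub> mul n m x y'"
    and mul_smult_left: "\<lbrakk>k \<in> carrier K; x \<in> carrier (G n); y \<in> carrier (G m)\<rbrakk>
      \<Longrightarrow> mul n m (k \<odot>\<^bsub>G n\<^esub> x) y = k \<odot>\<^bsub>G (n + m)\<^esub> mul n m x y"
    and mul_smult_right: "\<lbrakk>k \<in> carrier K; x \<in> carrier (G n); y \<in> carrier (G m)\<rbrakk>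
      \<Longrightarrow> mul n m x (k \<odot>\<^bsub>G m\<^esub> y) = k \<odot>\<^bsub>G (n + m)\<^esub> mul n m x y"
    and mul_assoc: "\<lbrakk>x \<in> carrier (G n); y \<in> carrier (G m); z \<in> carrier (G l)\<rbrakk>
      \<Longrightarrow> mul (n + m) l (mul n m x y) z = mul n (m + l) x (mul m l y z)"
    and unit_closed: "u \<in> carrier (G 0)"
    and unit_left: "x \<in> carrier (G n) \<Longrightarrow> mul 0 n u x = x"
    and unit_right: "x \<in> carrier (G n) \<Longrightarrow> mul n 0 x u = x"

locale graded_right_module = graded_algebra K G mul u
  for K :: "'k ring" and G :: "int \<Rightarrow> ('k, 'g) module"
    and mul :: "int \<Rightarrow> int \<Rightarrow> 'g \<Rightarrow> 'g \<Rightarrow> 'g" and u :: 'g +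
  fixes H :: "int \<Rightarrow> ('k, 'h) module" and act :: "int \<Rightarrow> int \<Rightarrow> 'h \<Rightarrow> 'g \<Rightarrow> 'h"
  assumes H_module: "module K (H n)"
    and act_closed: "\<lbrakk>c \<in> carrier (H n); x \<in> carrier (G m)\<rbrakk> \<Longrightarrow> act n m c x \<in> carrier (H (n + m))"
    and act_add_left: "\<lbrakk>c \<in> carrier (H n); c' \<in> carrier (H n); x \<in> carrier (G m)\<rbrakk>
      \<Longrightarrow> act n m (c \<oplus>\<^bsub>H n\<^esub> c') x = act n m c x \<oplus>\<^bsub>H (n + m)\<^esub> act n m c' x"
    and act_add_right: "\<lbrakk>c \<in> carrier (H n); x \<in> carrier (G m); x' \<in> carrier (G m)\<rbrakk>
      \<Longrightarrow> act n m c (x \<oplus>\<^bsub>G m\<^esub> x') = act n m c x \<oplus>\<^bsub>H (n + m)\<^esub> act n m c x'"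
    and act_smult_left: "\<lbrakk>k \<in> carrier K; c \<in> carrier (H n); x \<in> carrier (G m)\<rbrakk>
      \<Longrightarrow> act n m (k \<odot>\<^bsub>H n\<^esub> c) x = k \<odot>\<^bsub>H (n + m)\<^esub> act n m c x"
    and act_smult_right: "\<lbrakk>k \<in> carrier K; c \<in> carrier (H n); x \<in> carrier (G m)\<rbrakk>
      \<Longrightarrow> act n m c (k \<odot>\<^bsub>G m\<^esub> x) = k \<odot>\<^bsub>H (n + m)\<^esub> act n m c x"
    and act_act: "\<lbrakk>c \<in> carrier (H n); x \<in> carrier (G m); y \<in> carrier (G l)\<rbrakk>
      \<Longrightarrow> act (n + m) l (act n m c x) y = act n (m + l) c (mul m l x y)"
    and act_unit: "c \<in> carrier (H n) \<Longrightarrow> act n 0 c u = c"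

end

theory Submission
  imports Defs
begin

text \<open>
  Write \<open>Z = A \<otimes>\<^sub>B X\<close>. The differential of \<open>End\<^sub>A(Z)\<close> is the graded commutator with \<open>d\<close>, and
  the differential of \<open>Hom\<^sub>A(Z, V)\<close> is precomposition with \<open>d\<close>. Expanding the definitions, the
  middle terms in which \<open>d\<close> stands between the two factors cancel, and two Leibniz rules remain:
  \<open>d(f g) = (d f) g + (-1)\<^sup>n f (d g)\<close> for \<open>f\<close> of degree \<open>n\<close>, and
  \<open>d(\<phi> f) = (-1)\<^sup>m ((d \<phi>) f - \<phi> (d f))\<close> for \<open>f\<close> of degree \<open>m\<close>
  (\<open>End_dg_algebra\<close>, \<open>Hom_dg_right_module\<close>). A bilinear product obeying a Leibniz rule, with
  whatever signs, sends two cocycles to a cocycle, and sends a cocycle and a coboundary, in either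
  order, to a coboundary. So it descends to cohomology (\<open>induced_product_class\<close>), and associativity,
  unit laws and bilinearity descend with it, since they hold for representatives
  (\<open>graded_right_module_cohomology\<close>).

  Cohomology of \<open>V\<close> is defined by \<open>Hom\<^sub>B(X, V)\<close>, so the action is carried over along the restriction
  \<open>\<phi> \<mapsto> (x \<mapsto> \<phi> (1 \<otimes> x))\<close>. Its bijectivity is the adjunction between extension and
  restriction of scalars (\<open>restriction_bij\<close>), which comes from the universal property of the tensor
  product: a biadditive \<open>B\<close>-balanced map factors through \<open>A \<otimes>\<^sub>B M\<close> (\<open>universal_property\<close>), and
  additive maps are determined by their values on pure tensors (\<open>additive_eq_on_pure\<close>). The same two
  facts, applied to the formulas for the \<open>A\<close>-action and for \<open>id \<otimes> d\<close>, make \<open>A \<otimes>\<^sub>B X\<close> a complex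
  of left \<open>A\<close>-modules (\<open>induced_chain_complex\<close>).
\<close>

section \<open>Linear maps\<close>

lemma lin_map_closed: "lin_map R M N f \<Longrightarrow> x \<in> carrier M \<Longrightarrow> f x \<in> carrier N"
  by (auto simp: lin_map_def)

lemma lin_map_add:
  "lin_map R M N f \<Longrightarrow> x \<in> carrier M \<Longrightarrow> y \<in> carrier M \<Longrightarrow> f (x \<oplus>\<^bsub>M\<^esub> y) = f x \<oplus>\<^bsub>N\<^esub> f y"
  by (auto simp: lin_map_def)

lemma lin_map_smult:
  "lin_map R M N f \<Longrightarrow> r \<in> carrier R \<Longrightarrow> x \<in> carrier M \<Longrightarrow> f (r \<odot>\<^bsub>M\<^esub> x) = r \<odot>\<^bsub>N\<^esub> f x"
  by (auto simp: lin_map_def)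

lemma additive_zero:
  assumes "abelian_group M" "abelian_group N" "f \<in> carrier M \<rightarrow> carrier N"
    and "\<And>x y. x \<in> carrier M \<Longrightarrow> y \<in> carrier M \<Longrightarrow> f (x \<oplus>\<^bsub>M\<^esub> y) = f x \<oplus>\<^bsub>N\<^esub> f y"
  shows "f \<zero>\<^bsub>M\<^esub> = \<zero>\<^bsub>N\<^esub>"
proof -
  interpret M: abelian_group M by fact
  interpret N: abelian_group N by fact
  have "f \<zero>\<^bsub>M\<^esub> \<oplus>\<^bsub>N\<^esub> f \<zero>\<^bsub>M\<^esub> = f \<zero>\<^bsub>M\<^esub>"
    using assms(4)[of "\<zero>\<^bsub>M\<^esub>" "\<zero>\<^bsub>M\<^esub>"] by simp
  moreover have "f \<zero>\<^bsub>M\<^esub> \<in> carrier N" using assms(3) by auto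
  ultimately show ?thesis by (simp add: N.add.l_cancel_one)
qed

lemma additive_minus:
  assumes "abelian_group M" "abelian_group N" "f \<in> carrier M \<rightarrow> carrier N"
    and "\<And>x y. x \<in> carrier M \<Longrightarrow> y \<in> carrier M \<Longrightarrow> f (x \<oplus>\<^bsub>M\<^esub> y) = f x \<oplus>\<^bsub>N\<^esub> f y"
    and x: "x \<in> carrier M"
  shows "f (\<ominus>\<^bsub>M\<^esub> x) = \<ominus>\<^bsub>N\<^esub> f x"
proof -
  interpret M: abelian_group M by fact
  interpret N: abelian_group N by fact
  have "f (\<ominus>\<^bsub>M\<^esub> x) \<oplus>\<^bsub>N\<^esub> f x = \<zero>\<^bsub>N\<^esub>"
    using assms(4)[of "\<ominus>\<^bsub>M\<^esub> x" x] x additive_zero[OF assms(1-4)] by (simp add: M.l_neg)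
  moreover have "f x \<in> carrier N" "f (\<ominus>\<^bsub>M\<^esub> x) \<in> carrier N" using assms(3) x by auto
  ultimately show ?thesis using N.minus_equality by metis
qed

lemma lin_map_zero:
  assumes "lin_map R M N f" "abelian_group M" "abelian_group N"
  shows "f \<zero>\<^bsub>M\<^esub> = \<zero>\<^bsub>N\<^esub>"
  by (rule additive_zero[OF assms(2,3)]) (use assms in \<open>auto simp: lin_map_def\<close>)

lemma lin_map_minus:
  assumes "lin_map R M N f" "abelian_group M" "abelian_group N" "x \<in> carrier M"
  shows "f (\<ominus>\<^bsub>M\<^esub> x) = \<ominus>\<^bsub>N\<^esub> f x"
  by (rule additive_minus[OF assms(2,3) _ _ assms(4)]) (use assms in \<open>auto simp: lin_map_def\<close>)

text \<open>The sign \<open>(-1)\<^sup>n\<close> acts through negation in the additive group itself, so that signs make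
  sense in modules over any ring and commute with all additive maps.\<close>

definition signed :: "('a, 'b) ring_scheme \<Rightarrow> int \<Rightarrow> 'a \<Rightarrow> 'a"
  where "signed M n x = (if even n then x else \<ominus>\<^bsub>M\<^esub> x)"

lemma (in abelian_group) signed_closed [simp]: "x \<in> carrier G \<Longrightarrow> signed G n x \<in> carrier G"
  by (simp add: signed_def)

lemma (in abelian_group) signed_signed [simp]:
  "x \<in> carrier G \<Longrightarrow> signed G n (signed G m x) = signed G (n + m) x"
  by (auto simp: signed_def)

lemma (in abelian_group) signed_zero [simp]: "signed G n \<zero> = \<zero>"
  by (simp add: signed_def)

lemma signed_even [simp]: "even n \<Longrightarrow> signed M n x = x"
  by (simp add: signed_def)

lemma (in abelian_group) signed_add:
  "x \<in> carrier G \<Longrightarrow> y \<in> carrier G \<Longrightarrow> signed G n (x \<oplus> y) = signed G n x \<oplus> signed G n y"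
  by (simp add: signed_def minus_add)

lemma (in abelian_group) signed_succ_cancel:
  "x \<in> carrier G \<Longrightarrow> signed G (n + 1) x \<oplus> signed G n x = \<zero>"
  "x \<in> carrier G \<Longrightarrow> signed G n x \<oplus> signed G (n + 1) x = \<zero>"
  by (auto simp: signed_def l_neg r_neg)

lemma lin_map_signed:
  assumes "lin_map R M N f" "abelian_group M" "abelian_group N" "x \<in> carrier M"
  shows "f (signed M n x) = signed N n (f x)"
  using lin_map_minus[OF assms] by (simp add: signed_def)


section \<open>Cohomology of a complex of modules\<close>

lemma UN_eq_const: "a \<in> S \<Longrightarrow> (\<And>x. x \<in> S \<Longrightarrow> f x = c) \<Longrightarrow> (\<Union>x\<in>S. f x) = c"
  by auto

text \<open>The complexes \<open>End\<^sub>A(Z)\<close>, \<open>Hom\<^sub>A(Z, V)\<close> and \<open>Hom\<^sub>B(X, V)\<close> all satisfy these axioms, so that their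
  cohomology is treated once.\<close>

locale cochain_complex =
  fixes K :: "'k ring" and C :: "int \<Rightarrow> ('k, 'c) module" and \<delta> :: "int \<Rightarrow> 'c \<Rightarrow> 'c"
  assumes C_module: "module K (C n)"
    and \<delta>_lin: "lin_map K (C n) (C (n + 1)) (\<delta> n)"
    and \<delta>_\<delta>: "c \<in> carrier (C n) \<Longrightarrow> \<delta> (n + 1) (\<delta> n c) = \<zero>\<^bsub>C (n + 1 + 1)\<^esub>"
begin

lemma abelian: "abelian_group (C n)"
  using C_module[of n] by (simp add: module_def)

lemma \<delta>_closed: "c \<in> carrier (C n) \<Longrightarrow> \<delta> n c \<in> carrier (C (n + 1))"
  using lin_map_closed[OF \<delta>_lin] .

lemmas \<delta>_add = lin_map_add[OF \<delta>_lin]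
lemmas \<delta>_smult = lin_map_smult[OF \<delta>_lin]
lemmas \<delta>_zero = lin_map_zero[OF \<delta>_lin abelian abelian]
lemmas \<delta>_minus = lin_map_minus[OF \<delta>_lin abelian abelian]
lemmas \<delta>_signed = lin_map_signed[OF \<delta>_lin abelian abelian]

lemma cocycle_closed: "c \<in> cocycles C \<delta> n \<Longrightarrow> c \<in> carrier (C n)"
  by (simp add: cocycles_def)

lemma cocycle_\<delta>: "c \<in> cocycles C \<delta> n \<Longrightarrow> \<delta> n c = \<zero>\<^bsub>C (n + 1)\<^esub>"
  by (simp add: cocycles_def)

lemma cocycle_add:
  assumes "c \<in> cocycles C \<delta> n" "c' \<in> cocycles C \<delta> n"
  shows "c \<oplus>\<^bsub>C n\<^esub> c' \<in> cocycles C \<delta> n"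
proof -
  interpret N: abelian_group "C n" by (rule abelian)
  interpret N1: abelian_group "C (n + 1)" by (rule abelian)
  show ?thesis using assms by (simp add: cocycles_def \<delta>_add)
qed

lemma cocycle_smult:
  assumes "c \<in> cocycles C \<delta> n" "k \<in> carrier K"
  shows "k \<odot>\<^bsub>C n\<^esub> c \<in> cocycles C \<delta> n"
proof -
  interpret N: module K "C n" by (rule C_module)
  interpret N1: module K "C (n + 1)" by (rule C_module)
  show ?thesis using assms by (simp add: cocycles_def \<delta>_smult)
qed

lemma cocycle_zero: "\<zero>\<^bsub>C n\<^esub> \<in> cocycles C \<delta> n"
proof -
  interpret N: abelian_group "C n" by (rule abelian)
  show ?thesis by (simp add: cocycles_def \<delta>_zero)
qed

lemma cocycle_minus: "c \<in> cocycles C \<delta> n \<Longrightarrow> \<ominus>\<^bsub>C n\<^esub> c \<in> cocycles C \<delta> n"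
proof -
  interpret N: abelian_group "C n" by (rule abelian)
  interpret N1: abelian_group "C (n + 1)" by (rule abelian)
  show "c \<in> cocycles C \<delta> n \<Longrightarrow> \<ominus>\<^bsub>C n\<^esub> c \<in> cocycles C \<delta> n"
    by (simp add: cocycles_def \<delta>_minus)
qed

lemma coboundaryI: "c \<in> carrier (C n) \<Longrightarrow> b = \<delta> n c \<Longrightarrow> n + 1 = m \<Longrightarrow> b \<in> coboundaries C \<delta> m"
  by (auto simp: coboundaries_def)

lemma coboundaryE:
  assumes "b \<in> coboundaries C \<delta> n"
  obtains c where "c \<in> carrier (C (n - 1))" "b = \<delta> (n - 1) c"
  using assms by (auto simp: coboundaries_def)

lemma coboundary_cocycle: "b \<in> coboundaries C \<delta> n \<Longrightarrow> b \<in> cocycles C \<delta> n"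
  using \<delta>_closed[of _ "n - 1"] \<delta>_\<delta>[of _ "n - 1"] by (auto simp: coboundaries_def cocycles_def)

lemma coboundary_closed: "b \<in> coboundaries C \<delta> n \<Longrightarrow> b \<in> carrier (C n)"
  by (intro cocycle_closed coboundary_cocycle)

lemma coboundary_add:
  assumes "b \<in> coboundaries C \<delta> n" "b' \<in> coboundaries C \<delta> n"
  shows "b \<oplus>\<^bsub>C n\<^esub> b' \<in> coboundaries C \<delta> n"
proof -
  interpret abelian_group "C (n - 1)" by (rule abelian)
  obtain c c' where c: "c \<in> carrier (C (n - 1))" "b = \<delta> (n - 1) c"
    "c' \<in> carrier (C (n - 1))" "b' = \<delta> (n - 1) c'"
    using assms by (metis coboundaryE)
  show ?thesis
    by (rule coboundaryI[of "c \<oplus>\<^bsub>C (n - 1)\<^esub> c'" "n - 1"]) (use c \<delta>_add[of c "n - 1" c'] in auto)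
qed

lemma coboundary_smult:
  assumes "b \<in> coboundaries C \<delta> n" "k \<in> carrier K"
  shows "k \<odot>\<^bsub>C n\<^esub> b \<in> coboundaries C \<delta> n"
proof -
  interpret module K "C (n - 1)" by (rule C_module)
  obtain c where c: "c \<in> carrier (C (n - 1))" "b = \<delta> (n - 1) c"
    using assms by (metis coboundaryE)
  show ?thesis
    by (rule coboundaryI[of "k \<odot>\<^bsub>C (n - 1)\<^esub> c" "n - 1"]) (use assms c \<delta>_smult[of k c "n - 1"] in auto)
qed

lemma coboundary_minus:
  assumes "b \<in> coboundaries C \<delta> n"
  shows "\<ominus>\<^bsub>C n\<^esub> b \<in> coboundaries C \<delta> n"
proof -
  interpret abelian_group "C (n - 1)" by (rule abelian)
  obtain c where c: "c \<in> carrier (C (n - 1))" "b = \<delta> (n - 1) c"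
    using assms by (metis coboundaryE)
  show ?thesis
    by (rule coboundaryI[of "\<ominus>\<^bsub>C (n - 1)\<^esub> c" "n - 1"]) (use assms c \<delta>_minus[of c "n - 1"] in auto)
qed

lemma coboundary_zero: "\<zero>\<^bsub>C n\<^esub> \<in> coboundaries C \<delta> n"
proof -
  interpret abelian_group "C (n - 1)" by (rule abelian)
  show ?thesis
    by (rule coboundaryI[of "\<zero>\<^bsub>C (n - 1)\<^esub>" "n - 1"]) (use \<delta>_zero[of "n - 1"] in auto)
qed

lemma coboundaries_subgroup: "abelian_subgroup (coboundaries C \<delta> n) (C n)"
proof (rule abelian_subgroupI3)
  interpret abelian_group "C n" by (rule abelian)
  have "coboundaries C \<delta> n \<noteq> {}" using coboundary_zero by blast
  then show "additive_subgroup (coboundaries C \<delta> n) (C n)"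
    by (intro additive_subgroupI add.subgroupI)
      (auto simp: coboundary_closed coboundary_minus coboundary_add)
qed (rule abelian)

lemma mem_class_iff:
  assumes "c \<in> carrier (C n)"
  shows "x \<in> cohom_class C \<delta> n c \<longleftrightarrow> (\<exists>b\<in>coboundaries C \<delta> n. x = b \<oplus>\<^bsub>C n\<^esub> c)"
  by (auto simp: cohom_class_def a_r_coset_def')

lemma class_self:
  assumes "c \<in> carrier (C n)"
  shows "c \<in> cohom_class C \<delta> n c"
proof -
  interpret abelian_group "C n" by (rule abelian)
  show ?thesis using assms coboundary_zero by (force simp: mem_class_iff)
qed

lemma class_add_coboundary:
  assumes "c \<in> carrier (C n)" "b \<in> coboundaries C \<delta> n"
  shows "cohom_class C \<delta> n (b \<oplus>\<^bsub>C n\<^esub> c) = cohom_class C \<delta> n c"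
proof -
  interpret abelian_subgroup "coboundaries C \<delta> n" "C n" by (rule coboundaries_subgroup)
  have "b \<oplus>\<^bsub>C n\<^esub> c \<in> coboundaries C \<delta> n +>\<^bsub>C n\<^esub> c"
    using assms by (auto simp: a_r_coset_def')
  then show ?thesis
    using a_repr_independence[OF _ assms(1) a_subgroup] by (simp add: cohom_class_def)
qed

lemma class_subset_cocycles:
  assumes "c \<in> cocycles C \<delta> n"
  shows "cohom_class C \<delta> n c \<subseteq> cocycles C \<delta> n"
  using assms cocycle_add coboundary_cocycle by (auto simp: mem_class_iff[OF cocycle_closed])

lemma class_add:
  assumes "c \<in> carrier (C n)" "c' \<in> carrier (C n)"
  shows "cohom_class C \<delta> n c <+>\<^bsub>C n\<^esub> cohom_class C \<delta> n c' = cohom_class C \<delta> n (c \<oplus>\<^bsub>C n\<^esub> c')"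
proof -
  interpret abelian_subgroup "coboundaries C \<delta> n" "C n" by (rule coboundaries_subgroup)
  show ?thesis using assms by (simp add: cohom_class_def a_rcos_sum)
qed

lemma class_zero: "cohom_class C \<delta> n \<zero>\<^bsub>C n\<^esub> = coboundaries C \<delta> n"
proof -
  interpret abelian_subgroup "coboundaries C \<delta> n" "C n" by (rule coboundaries_subgroup)
  show ?thesis by (simp add: cohom_class_def a_subset)
qed

text \<open>Scalar multiplication of a class is a union over all representatives; the union collapses
  because multiples of coboundaries are coboundaries.\<close>

lemma class_smult:
  assumes "c \<in> cocycles C \<delta> n" "k \<in> carrier K"
  shows "k \<odot>\<^bsub>cohomology C \<delta> n\<^esub> cohom_class C \<delta> n c = cohom_class C \<delta> n (k \<odot>\<^bsub>C n\<^esub> c)"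
proof -
  interpret module K "C n" by (rule C_module)
  note c = cocycle_closed[OF assms(1)]
  have indep: "cohom_class C \<delta> n (k \<odot>\<^bsub>C n\<^esub> x) = cohom_class C \<delta> n (k \<odot>\<^bsub>C n\<^esub> c)"
    if x: "x \<in> cohom_class C \<delta> n c" for x
  proof -
    obtain b where b: "b \<in> coboundaries C \<delta> n" "x = b \<oplus>\<^bsub>C n\<^esub> c"
      using x c by (auto simp: mem_class_iff)
    have "k \<odot>\<^bsub>C n\<^esub> x = k \<odot>\<^bsub>C n\<^esub> b \<oplus>\<^bsub>C n\<^esub> k \<odot>\<^bsub>C n\<^esub> c"
      using b c assms coboundary_closed by (simp add: smult_r_distr)
    then show ?thesis using b c assms by (simp add: class_add_coboundary coboundary_smult)
  qed
  have "(\<Union>x\<in>cohom_class C \<delta> n c. cohom_class C \<delta> n (k \<odot>\<^bsub>C n\<^esub> x))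
    = cohom_class C \<delta> n (k \<odot>\<^bsub>C n\<^esub> c)"
    by (rule UN_eq_const[OF class_self[OF c] indep])
  then show ?thesis by (simp add: cohomology_def)
qed

lemma cohomology_add:
  assumes "c \<in> carrier (C n)" "c' \<in> carrier (C n)"
  shows "cohom_class C \<delta> n c \<oplus>\<^bsub>cohomology C \<delta> n\<^esub> cohom_class C \<delta> n c'
    = cohom_class C \<delta> n (c \<oplus>\<^bsub>C n\<^esub> c')"
  using class_add[OF assms] by (simp add: cohomology_def)

lemma class_in_cohomology:
  "c \<in> cocycles C \<delta> n \<Longrightarrow> cohom_class C \<delta> n c \<in> carrier (cohomology C \<delta> n)"
  by (simp add: cohomology_def)

lemma cohomology_cases:
  assumes "S \<in> carrier (cohomology C \<delta> n)"
  obtains c where "c \<in> cocycles C \<delta> n" "S = cohom_class C \<delta> n c"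
  using assms by (auto simp: cohomology_def)

lemma cohomology_module: "module K (cohomology C \<delta> n)"
proof -
  interpret module K "C n" by (rule C_module)
  let ?H = "cohomology C \<delta> n" and ?cl = "cohom_class C \<delta> n"
  have zero: "\<zero>\<^bsub>?H\<^esub> = ?cl \<zero>\<^bsub>C n\<^esub>" by (simp add: class_zero) (simp add: cohomology_def)
  note [simp] = cohomology_add class_smult class_in_cohomology cocycle_closed
    cocycle_add cocycle_smult cocycle_zero cocycle_minus
  show ?thesis
  proof (rule moduleI)
    show "abelian_group ?H"
    proof (rule abelian_groupI)
      show "\<zero>\<^bsub>?H\<^esub> \<in> carrier ?H" by (simp add: zero)
      show "\<exists>y\<in>carrier ?H. y \<oplus>\<^bsub>?H\<^esub> x = \<zero>\<^bsub>?H\<^esub>" if "x \<in> carrier ?H" for x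
        using that
      proof (rule cohomology_cases)
        fix c assume c: "c \<in> cocycles C \<delta> n" "x = ?cl c"
        then show ?thesis
          by (intro bexI[of _ "?cl (\<ominus>\<^bsub>C n\<^esub> c)"]) (simp_all add: zero M.l_neg)
      qed
    qed (auto elim!: cohomology_cases simp: zero M.a_ac)
  qed (use R.is_cring in \<open>auto elim!: cohomology_cases simp: smult_l_distr smult_r_distr smult_assoc1\<close>)
qed

end


section \<open>Products on cohomology\<close>

text \<open>The signs in the Leibniz rule are left open. Composition in \<open>End\<^sub>A(Z)\<close> obeys the usual rule
  \<open>d(f g) = (d f) g + (-1)\<^sup>n f (d g)\<close>, whereas the action on \<open>Hom\<^sub>A(Z, V)\<close>, whose differential is
  \<open>\<phi> \<mapsto> \<phi> \<circ> d\<close> with no sign, satisfies the rule with signs \<open>(-1)\<^sup>m\<close> and \<open>(-1)\<^bsup>m+1\<^esup>\<close> depending on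
  the second factor. Compatibility with cohomology holds for any choice of signs.\<close>

locale dg_pairing =
  C: cochain_complex K C \<delta>C + D: cochain_complex K D \<delta>D + E: cochain_complex K E \<delta>E
  for K :: "'k ring"
    and C :: "int \<Rightarrow> ('k, 'c) module" and \<delta>C
    and D :: "int \<Rightarrow> ('k, 'd) module" and \<delta>D
    and E :: "int \<Rightarrow> ('k, 'e) module" and \<delta>E +
  fixes mul :: "int \<Rightarrow> int \<Rightarrow> 'c \<Rightarrow> 'd \<Rightarrow> 'e" and s t :: "int \<Rightarrow> int \<Rightarrow> int"
  assumes mul_closed: "\<lbrakk>x \<in> carrier (C n); y \<in> carrier (D m)\<rbrakk> \<Longrightarrow> mul n m x y \<in> carrier (E (n + m))"
    and mul_add_left: "\<lbrakk>x \<in> carrier (C n); x' \<in> carrier (C n); y \<in> carrier (D m)\<rbrakk>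
      \<Longrightarrow> mul n m (x \<oplus>\<^bsub>C n\<^esub> x') y = mul n m x y \<oplus>\<^bsub>E (n + m)\<^esub> mul n m x' y"
    and mul_add_right: "\<lbrakk>x \<in> carrier (C n); y \<in> carrier (D m); y' \<in> carrier (D m)\<rbrakk>
      \<Longrightarrow> mul n m x (y \<oplus>\<^bsub>D m\<^esub> y') = mul n m x y \<oplus>\<^bsub>E (n + m)\<^esub> mul n m x y'"
    and leibniz: "\<lbrakk>x \<in> carrier (C n); y \<in> carrier (D m)\<rbrakk>
      \<Longrightarrow> \<delta>E (n + m) (mul n m x y)
        = signed (E (n + m + 1)) (s n m) (mul (n + 1) m (\<delta>C n x) y)
          \<oplus>\<^bsub>E (n + m + 1)\<^esub> signed (E (n + m + 1)) (t n m) (mul n (m + 1) x (\<delta>D m y))"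
begin

lemma mul_zero_left: 
  assumes "y \<in> carrier (D m)" shows "mul n m \<zero>\<^bsub>C n\<^esub> y = \<zero>\<^bsub>E (n + m)\<^esub>"
  by (rule additive_zero[OF C.abelian E.abelian, of "\<lambda>x. mul n m x y"])
    (use assms in \<open>auto simp: mul_closed mul_add_left\<close>)

lemma mul_zero_right: 
  assumes "x \<in> carrier (C n)" shows "mul n m x \<zero>\<^bsub>D m\<^esub> = \<zero>\<^bsub>E (n + m)\<^esub>"
  by (rule additive_zero[OF D.abelian E.abelian, of "\<lambda>y. mul n m x y"])
    (use assms in \<open>auto simp: mul_closed mul_add_right\<close>)

lemma cocycle_mul:
  assumes "x \<in> cocycles C \<delta>C n" "y \<in> cocycles D \<delta>D m"
  shows "mul n m x y \<in> cocycles E \<delta>E (n + m)"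
proof -
  interpret E': abelian_group "E (n + m + 1)" by (rule E.abelian)
  have x: "x \<in> carrier (C n)" "\<delta>C n x = \<zero>\<^bsub>C (n + 1)\<^esub>"
    and y: "y \<in> carrier (D m)" "\<delta>D m y = \<zero>\<^bsub>D (m + 1)\<^esub>"
    using assms by (auto simp: cocycles_def)
  have "mul (n + 1) m \<zero>\<^bsub>C (n + 1)\<^esub> y = \<zero>\<^bsub>E (n + m + 1)\<^esub>"
    "mul n (m + 1) x \<zero>\<^bsub>D (m + 1)\<^esub> = \<zero>\<^bsub>E (n + m + 1)\<^esub>"
    using mul_zero_left[OF y(1), of "n + 1"] mul_zero_right[OF x(1), of "m + 1"]
    by (simp_all add: algebra_simps)
  then show ?thesis
    using x y by (simp add: cocycles_def leibniz mul_closed)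
qed

text \<open>If \<open>x = d w\<close> and \<open>d y = 0\<close>, the Leibniz rule for \<open>w y\<close> reduces to \<open>d(w y) = \<plusminus> x y\<close>, so
  \<open>x y\<close> is the coboundary of \<open>\<plusminus> w y\<close>.\<close>

lemma coboundary_mul_left:
  assumes "x \<in> coboundaries C \<delta>C n" "y \<in> cocycles D \<delta>D m"
  shows "mul n m x y \<in> coboundaries E \<delta>E (n + m)"
proof -
  obtain w where w: "w \<in> carrier (C (n - 1))" "x = \<delta>C (n - 1) w"
    using assms(1) by (rule C.coboundaryE)
  have y: "y \<in> carrier (D m)" "\<delta>D m y = \<zero>\<^bsub>D (m + 1)\<^esub>"
    using assms(2) by (auto simp: cocycles_def)
  have x: "x \<in> carrier (C n)" using assms(1) by (rule C.coboundary_closed)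
  interpret E0: abelian_group "E (n - 1 + m)" by (rule E.abelian)
  interpret E1: abelian_group "E (n + m)" by (rule E.abelian)
  let ?e = "s (n - 1) m"
  have idx: "n - 1 + m + 1 = n + m" by simp
  have 0: "mul (n - 1) (m + 1) w \<zero>\<^bsub>D (m + 1)\<^esub> = \<zero>\<^bsub>E (n + m)\<^esub>"
    using mul_zero_right[OF w(1), of "m + 1"] by (simp add: algebra_simps)
  have wy: "mul (n - 1) m w y \<in> carrier (E (n - 1 + m))" by (rule mul_closed[OF w(1) y(1)])
  have xy: "mul n m x y \<in> carrier (E (n + m))" by (rule mul_closed[OF x y(1)])
  have "\<delta>E (n - 1 + m) (mul (n - 1) m w y) = signed (E (n + m)) ?e (mul n m x y)"
    using leibniz[OF w(1) y(1)] y xy w(2) by (simp add: idx 0)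
  then have "\<delta>E (n - 1 + m) (signed (E (n - 1 + m)) ?e (mul (n - 1) m w y)) = mul n m x y"
    using E.\<delta>_signed[OF wy, of ?e] xy by (simp add: idx)
  then show ?thesis using wy
    by (intro E.coboundaryI[of "signed (E (n - 1 + m)) ?e (mul (n - 1) m w y)" "n - 1 + m"]) auto
qed

lemma coboundary_mul_right:
  assumes "x \<in> cocycles C \<delta>C n" "y \<in> coboundaries D \<delta>D m"
  shows "mul n m x y \<in> coboundaries E \<delta>E (n + m)"
proof -
  obtain w where w: "w \<in> carrier (D (m - 1))" "y = \<delta>D (m - 1) w"
    using assms(2) by (rule D.coboundaryE)
  have x: "x \<in> carrier (C n)" "\<delta>C n x = \<zero>\<^bsub>C (n + 1)\<^esub>"
    using assms(1) by (auto simp: cocycles_def)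
  have y: "y \<in> carrier (D m)" using assms(2) by (rule D.coboundary_closed)
  interpret E0: abelian_group "E (n + (m - 1))" by (rule E.abelian)
  interpret E1: abelian_group "E (n + m)" by (rule E.abelian)
  let ?e = "t n (m - 1)"
  have idx: "n + (m - 1) + 1 = n + m" by simp
  have 0: "mul (n + 1) (m - 1) \<zero>\<^bsub>C (n + 1)\<^esub> w = \<zero>\<^bsub>E (n + m)\<^esub>"
    using mul_zero_left[OF w(1), of "n + 1"] by (simp add: algebra_simps)
  have xw: "mul n (m - 1) x w \<in> carrier (E (n + (m - 1)))" by (rule mul_closed[OF x(1) w(1)])
  have xy: "mul n m x y \<in> carrier (E (n + m))" by (rule mul_closed[OF x(1) y])
  have "\<delta>E (n + (m - 1)) (mul n (m - 1) x w) = signed (E (n + m)) ?e (mul n m x y)"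
    using leibniz[OF x(1) w(1)] x xy w(2) unfolding idx by (simp add: 0)
  then have "\<delta>E (n + (m - 1)) (signed (E (n + (m - 1))) ?e (mul n (m - 1) x w)) = mul n m x y"
    using E.\<delta>_signed[OF xw, of ?e] xy unfolding idx by simp
  then show ?thesis using xw
    by (intro E.coboundaryI[of "signed (E (n + (m - 1))) ?e (mul n (m - 1) x w)" "n + (m - 1)"]) auto
qed

end

text \<open>Union over all representatives, so that the multiplication of the Hecke algebra is
  literally an instance.\<close>

definition induced_product ::
    "(int \<Rightarrow> ('k, 'e) module) \<Rightarrow> (int \<Rightarrow> 'e \<Rightarrow> 'e) \<Rightarrow> (int \<Rightarrow> int \<Rightarrow> 'c \<Rightarrow> 'd \<Rightarrow> 'e) \<Rightarrow>
     int \<Rightarrow> int \<Rightarrow> 'c set \<Rightarrow> 'd set \<Rightarrow> 'e set"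
  where "induced_product E \<delta>E mul n m S T = (\<Union>x\<in>S. \<Union>y\<in>T. cohom_class E \<delta>E (n + m) (mul n m x y))"

text \<open>Replace the representatives one at a time: \<open>(b + x) y' = b y' + x y'\<close> and
  \<open>x (b' + y) = x b' + x y\<close> change the product only by coboundaries. This is the well-definedness of
  the product on cohomology.\<close>

lemma (in dg_pairing) induced_product_class:
  assumes x: "x \<in> cocycles C \<delta>C n" and y: "y \<in> cocycles D \<delta>D m"
  shows "induced_product E \<delta>E mul n m (cohom_class C \<delta>C n x) (cohom_class D \<delta>D m y)
    = cohom_class E \<delta>E (n + m) (mul n m x y)"
proof -
  interpret E': abelian_group "E (n + m)" by (rule E.abelian)
  have indep: "cohom_class E \<delta>E (n + m) (mul n m x' y') = cohom_class E \<delta>E (n + m) (mul n m x y)"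
    if x': "x' \<in> cohom_class C \<delta>C n x" and y'_class: "y' \<in> cohom_class D \<delta>D m y" for x' y'
  proof -
    have y': "y' \<in> cocycles D \<delta>D m" using y'_class y D.class_subset_cocycles by blast
    obtain b b' where b: "b \<in> coboundaries C \<delta>C n" "x' = b \<oplus>\<^bsub>C n\<^esub> x"
      and b': "b' \<in> coboundaries D \<delta>D m" "y' = b' \<oplus>\<^bsub>D m\<^esub> y"
      using x' y'_class x y by (auto simp: C.mem_class_iff[OF C.cocycle_closed] D.mem_class_iff[OF D.cocycle_closed])
    have "mul n m x' y' = mul n m b y' \<oplus>\<^bsub>E (n + m)\<^esub> mul n m x y'"
      using b x y' by (simp add: mul_add_left C.coboundary_closed C.cocycle_closed D.cocycle_closed)
    moreover have "mul n m x y' = mul n m x b' \<oplus>\<^bsub>E (n + m)\<^esub> mul n m x y"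
      using b' x y by (simp add: mul_add_right D.coboundary_closed C.cocycle_closed D.cocycle_closed)
    ultimately show ?thesis
      using coboundary_mul_left[OF b(1) y'] coboundary_mul_right[OF x b'(1)] cocycle_mul[OF x y]
        cocycle_mul[OF x y']
      by (simp add: E.class_add_coboundary E.cocycle_closed)
  qed
  have "x \<in> cohom_class C \<delta>C n x" "y \<in> cohom_class D \<delta>D m y"
    using x y by (auto intro: C.class_self D.class_self C.cocycle_closed D.cocycle_closed)
  then show ?thesis
    unfolding induced_product_def using indep by (intro UN_eq_const[of x] UN_eq_const[of y])
qed

text \<open>Every class has a cocycle representative and every operation on classes is computed on
  representatives, so each identity is inherited from the cochains.\<close>

theorem graded_algebra_cohomology:
  assumes "graded_algebra K G mul u" "dg_pairing K G \<delta> G \<delta> G \<delta> mul s t" "u \<in> cocycles G \<delta> 0"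
  shows "graded_algebra K (cohomology G \<delta>) (induced_product G \<delta> mul) (cohom_class G \<delta> 0 u)"
proof -
  interpret graded_algebra K G mul u by fact
  interpret P: dg_pairing K G \<delta> G \<delta> G \<delta> mul s t by fact
  note [simp] = P.induced_product_class P.cocycle_mul P.C.cocycle_closed P.C.class_smult
    P.C.cohomology_add P.C.cocycle_add P.C.cocycle_smult P.C.class_in_cohomology
    mul_add_left mul_add_right mul_smult_left mul_smult_right mul_closed
  note [elim!] = P.C.cohomology_cases
  show ?thesis
  proof (rule graded_algebra.intro)
    show "induced_product G \<delta> mul (n + m) l (induced_product G \<delta> mul n m x y) z
        = induced_product G \<delta> mul n (m + l) x (induced_product G \<delta> mul m l y z)"
      if "x \<in> carrier (cohomology G \<delta> n)" "y \<in> carrier (cohomology G \<delta> m)"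
        "z \<in> carrier (cohomology G \<delta> l)" for x y z n m l
      using that by (auto simp: mul_assoc add.assoc)
    show "induced_product G \<delta> mul 0 n (cohom_class G \<delta> 0 u) x = x"
      if "x \<in> carrier (cohomology G \<delta> n)" for x n
      using that P.induced_product_class[OF assms(3)] by (auto simp: unit_left)
    show "induced_product G \<delta> mul n 0 x (cohom_class G \<delta> 0 u) = x"
      if "x \<in> carrier (cohomology G \<delta> n)" for x n
      using that P.induced_product_class[OF _ assms(3)] by (auto simp: unit_right)
  qed (use assms(3) in \<open>auto simp: P.C.cohomology_module\<close>)
qed

theorem graded_right_module_cohomology:
  assumes "graded_right_module K G mul u H act" "dg_pairing K G \<delta> G \<delta> G \<delta> mul s t"
    and "u \<in> cocycles G \<delta> 0" "dg_pairing K H \<delta>H G \<delta> H \<delta>H act s' t'"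
  shows "graded_right_module K (cohomology G \<delta>) (induced_product G \<delta> mul) (cohom_class G \<delta> 0 u)
    (cohomology H \<delta>H) (induced_product H \<delta>H act)"
proof -
  interpret graded_right_module K G mul u H act by fact
  interpret A: dg_pairing K G \<delta> G \<delta> G \<delta> mul s t by fact
  interpret P: dg_pairing K H \<delta>H G \<delta> H \<delta>H act s' t' by fact
  interpret HG: graded_algebra K "cohomology G \<delta>" "induced_product G \<delta> mul" "cohom_class G \<delta> 0 u"
    by (rule graded_algebra_cohomology[OF graded_algebra_axioms assms(2,3)])
  note [simp] = P.induced_product_class A.induced_product_class P.cocycle_mul A.cocycle_mul
    P.C.cocycle_closed A.C.cocycle_closed P.C.class_smult A.C.class_smult
    P.C.cohomology_add P.C.cocycle_add P.C.cocycle_smult P.C.class_in_cohomology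
    A.C.cohomology_add A.C.cocycle_add A.C.cocycle_smult A.C.class_in_cohomology
    act_add_left act_add_right act_smult_left act_smult_right act_closed
  note [elim!] = P.C.cohomology_cases A.C.cohomology_cases
  show ?thesis
  proof (rule graded_right_module.intro[OF HG.graded_algebra_axioms graded_right_module_axioms.intro])
    show "induced_product H \<delta>H act (n + m) l (induced_product H \<delta>H act n m c x) y
        = induced_product H \<delta>H act n (m + l) c (induced_product G \<delta> mul m l x y)"
      if "c \<in> carrier (cohomology H \<delta>H n)" "x \<in> carrier (cohomology G \<delta> m)"
        "y \<in> carrier (cohomology G \<delta> l)" for c x y n m l
      using that by (auto simp: act_act add.assoc)
    show "induced_product H \<delta>H act n 0 c (cohom_class G \<delta> 0 u) = c"
      if "c \<in> carrier (cohomology H \<delta>H n)" for c n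
      using that P.induced_product_class[OF _ assms(3)] by (auto simp: act_unit)
  qed (auto simp: P.C.cohomology_module)
qed


section \<open>The universal property of the induced module\<close>

text \<open>The substitute for bilinear maps over a noncommutative ring: additive maps out of
  \<open>A \<otimes>\<^sub>B M\<close> correspond to these.\<close>

definition balanced_map ::
    "('k, 'a) module \<Rightarrow> 'a set \<Rightarrow> ('a, 'x) module \<Rightarrow> ('r, 'n) module \<Rightarrow> ('a \<Rightarrow> 'x \<Rightarrow> 'n) \<Rightarrow> bool"
  where "balanced_map A B M N \<beta> \<longleftrightarrow>
    (\<forall>a\<in>carrier A. \<forall>x\<in>carrier M. \<beta> a x \<in> carrier N) \<and>
    (\<forall>a\<in>carrier A. \<forall>a'\<in>carrier A. \<forall>x\<in>carrier M. \<beta> (a \<oplus>\<^bsub>A\<^esub> a') x = \<beta> a x \<oplus>\<^bsub>N\<^esub> \<beta> a' x) \<and>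
    (\<forall>a\<in>carrier A. \<forall>x\<in>carrier M. \<forall>x'\<in>carrier M. \<beta> a (x \<oplus>\<^bsub>M\<^esub> x') = \<beta> a x \<oplus>\<^bsub>N\<^esub> \<beta> a x') \<and>
    (\<forall>a\<in>carrier A. \<forall>b\<in>B. \<forall>x\<in>carrier M. \<beta> (a \<otimes>\<^bsub>A\<^esub> b) x = \<beta> a (b \<odot>\<^bsub>M\<^esub> x))"

locale induction_data =
  fixes A :: "('k, 'a) module" and B :: "'a set" and M :: "('a, 'x) module"
  assumes A_ring: "ring A" and B_subring: "subring B A"
    and M_module: "left_module (A\<lparr>carrier := B\<rparr>) M"
begin

sublocale A: ring A by (rule A_ring)
sublocale M: left_module "A\<lparr>carrier := B\<rparr>" M by (rule M_module)

abbreviation F where "F \<equiv> free_Abelian_group (carrier A \<times> carrier M)"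
abbreviation I where "I \<equiv> induced_module A B M"
abbreviation cl where "cl \<equiv> tensor_class A B M"

sublocale F: comm_group F by (rule abelian_free_Abelian_group)

lemma B_subset: "B \<subseteq> carrier A"
  using subringE(1)[OF B_subring] .

lemma diff_in_F: "v \<in> carrier F \<Longrightarrow> w \<in> carrier F \<Longrightarrow> v - w \<in> carrier F"
  using keys_diff[of v w] by auto

lemma rels_subgroup: "subgroup (tensor_rels A B M) F"
  unfolding tensor_rels_def
  by (rule F.generate_is_subgroup)
    (use B_subset M.smult_closed in \<open>auto simp del: carrier_free_Abelian_group_iff
      intro!: diff_in_F frag_of_in_free_Abelian_group[THEN iffD2] A.a_closed A.m_closed\<close>)

lemma hom_diff:
  assumes "abelian_group N" "h \<in> hom F (add_monoid N)" "v \<in> carrier F" "w \<in> carrier F"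
  shows "h (v - w) = h v \<ominus>\<^bsub>N\<^esub> h w"
proof -
  interpret N: abelian_group N by fact
  interpret h: group_hom F "add_monoid N" h
    by unfold_locales (use assms in auto)
  have "h (v - w) = h (v \<otimes>\<^bsub>F\<^esub> inv\<^bsub>F\<^esub> w)" using assms by simp
  also have "\<dots> = h v \<ominus>\<^bsub>N\<^esub> h w"
    using h.hom_mult[OF assms(3) F.inv_closed[OF assms(4)]] h.hom_inv[OF assms(4)]
    by (simp add: a_minus_def a_inv_def)
  finally show ?thesis .
qed

text \<open>The kernel of \<open>h\<close> is a subgroup, and balancedness says exactly that it contains the generators of
  the tensor relations.\<close>

lemma balanced_hom_vanishes:
  assumes "abelian_group N" "h \<in> hom F (add_monoid N)"
    and \<beta>: "balanced_map A B M N (\<lambda>a x. h (frag_of (a, x)))"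
    and v: "v \<in> tensor_rels A B M"
  shows "h v = \<zero>\<^bsub>N\<^esub>"
proof -
  interpret N: abelian_group N by fact
  interpret h: group_hom F "add_monoid N" h
    by unfold_locales (use assms in auto)
  note d = hom_diff[OF assms(1,2)]
  have "tensor_rels A B M \<subseteq> kernel F (add_monoid N) h"
    unfolding tensor_rels_def
  proof (rule F.generate_subgroup_incl[OF _ h.subgroup_kernel], safe)
    fix a a' x assume "a \<in> carrier A" "a' \<in> carrier A" "x \<in> carrier M"
    then show "frag_of (a \<oplus>\<^bsub>A\<^esub> a', x) - frag_of (a, x) - frag_of (a', x) \<in> kernel F (add_monoid N) h"
      using \<beta> by (simp add: kernel_def diff_in_F d del: carrier_free_Abelian_group_iff)
        (simp add: balanced_map_def a_minus_def N.a_ac N.minus_add N.r_neg N.r_neg1)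
  next
    fix a x x' assume "a \<in> carrier A" "x \<in> carrier M" "x' \<in> carrier M"
    then show "frag_of (a, x \<oplus>\<^bsub>M\<^esub> x') - frag_of (a, x) - frag_of (a, x') \<in> kernel F (add_monoid N) h"
      using \<beta> by (simp add: kernel_def diff_in_F d del: carrier_free_Abelian_group_iff)
        (simp add: balanced_map_def a_minus_def N.a_ac N.minus_add N.r_neg N.r_neg1)
  next
    fix a b x assume "a \<in> carrier A" "b \<in> B" "x \<in> carrier M"
    then show "frag_of (a \<otimes>\<^bsub>A\<^esub> b, x) - frag_of (a, b \<odot>\<^bsub>M\<^esub> x) \<in> kernel F (add_monoid N) h"
      using \<beta> M.smult_closed[of b x] subsetD[OF B_subset]
      by (simp add: kernel_def diff_in_F d del: carrier_free_Abelian_group_iff)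
        (simp add: balanced_map_def a_minus_def N.r_neg)
  qed
  then show ?thesis using v by (auto simp: kernel_def)
qed

lemma balanced_hom_const:
  assumes "abelian_group N" "h \<in> hom F (add_monoid N)"
    and "balanced_map A B M N (\<lambda>a x. h (frag_of (a, x)))"
    and v: "v \<in> carrier F" and w: "w \<in> cl v"
  shows "h w = h v"
proof -
  interpret N: abelian_group N by fact
  obtain r where r: "r \<in> tensor_rels A B M" "w = r + v"
    using w by (auto simp: tensor_class_def r_coset_def)
  have "r \<in> carrier F" using r rels_subgroup by (meson subgroup.mem_carrier)
  then have "h w = h r \<oplus>\<^bsub>N\<^esub> h v" "h v \<in> carrier N"
    using r v assms(2) by (auto simp: hom_def)
  then show ?thesis using balanced_hom_vanishes[OF assms(1-3) r(1)] by simp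
qed

lemma class_self: "v \<in> carrier F \<Longrightarrow> v \<in> cl v"
  unfolding tensor_class_def by (rule F.rcos_self[OF _ rels_subgroup])

lemma normal: "tensor_rels A B M \<lhd> F"
  by (rule F.subgroup_imp_normal[OF rels_subgroup])

lemma induced_carrier: "carrier I = cl ` carrier F"
  by (auto simp: induced_module_def Let_def FactGroup_def RCOSETS_def tensor_class_def)

lemma class_closed: "v \<in> carrier F \<Longrightarrow> cl v \<in> carrier I"
  by (simp add: induced_carrier)

lemma class_add:
  assumes "v \<in> carrier F" "w \<in> carrier F"
  shows "cl (v + w) = cl v \<oplus>\<^bsub>I\<^esub> cl w"
  using normal.rcos_sum[OF normal assms] by (simp add: induced_module_def Let_def tensor_class_def)

lemma class_hom: "cl \<in> hom F (add_monoid I)"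
  by (auto simp: hom_def class_add class_closed)

lemma induced_abelian: "abelian_group I"
proof -
  let ?Q = "F Mod tensor_rels A B M"
  interpret Q: comm_group ?Q by (rule F.abelian_FactGroup[OF rels_subgroup])
  have "carrier I = carrier ?Q" "add I = monoid.mult ?Q" "\<zero>\<^bsub>I\<^esub> = \<one>\<^bsub>?Q\<^esub>"
    by (simp_all add: induced_module_def Let_def)
  then show ?thesis
    by (intro abelian_groupI) (auto simp: Q.m_ac simp del: mult_FactGroup one_FactGroup
        intro: Q.l_inv_ex)
qed

sublocale I: abelian_group I by (rule induced_abelian)

lemma class_of_relation:
  assumes "v \<in> tensor_rels A B M"
  shows "cl v = \<zero>\<^bsub>I\<^esub>"
  using F.coset_join2[OF subgroup.mem_carrier[OF rels_subgroup assms] rels_subgroup assms]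
  by (simp add: induced_module_def Let_def FactGroup_def tensor_class_def)

lemma pure_closed: "a \<in> carrier A \<Longrightarrow> x \<in> carrier M \<Longrightarrow> pure_tensor A B M a x \<in> carrier I"
  by (simp add: class_closed)

lemma pure_balanced: "balanced_map A B M I (pure_tensor A B M)"
proof -
  note d = hom_diff[OF induced_abelian class_hom]
  have gen: "frag_of (a \<oplus>\<^bsub>A\<^esub> a', x) - frag_of (a, x) - frag_of (a', x) \<in> tensor_rels A B M"
    if "a \<in> carrier A" "a' \<in> carrier A" "x \<in> carrier M" for a a' x
    unfolding tensor_rels_def by (rule generate.incl) (use that in blast)
  have gen': "frag_of (a, x \<oplus>\<^bsub>M\<^esub> x') - frag_of (a, x) - frag_of (a, x') \<in> tensor_rels A B M"
    if "a \<in> carrier A" "x \<in> carrier M" "x' \<in> carrier M" for a x x'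
    unfolding tensor_rels_def by (rule generate.incl) (use that in blast)
  have gen'': "frag_of (a \<otimes>\<^bsub>A\<^esub> b, x) - frag_of (a, b \<odot>\<^bsub>M\<^esub> x) \<in> tensor_rels A B M"
    if "a \<in> carrier A" "b \<in> B" "x \<in> carrier M" for a b x
    unfolding tensor_rels_def by (rule generate.incl) (use that in blast)
  have eq1: "p = q" if "p \<ominus>\<^bsub>I\<^esub> q = \<zero>\<^bsub>I\<^esub>" "p \<in> carrier I" "q \<in> carrier I" for p q
    using that I.minus_equality[of p "\<ominus>\<^bsub>I\<^esub> q"] by (simp add: a_minus_def)
  have eq2: "p = q \<oplus>\<^bsub>I\<^esub> r" if "p \<ominus>\<^bsub>I\<^esub> q \<ominus>\<^bsub>I\<^esub> r = \<zero>\<^bsub>I\<^esub>" "p \<in> carrier I" "q \<in> carrier I" "r \<in> carrier I" for p q r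
  proof -
    have "p \<ominus>\<^bsub>I\<^esub> (q \<oplus>\<^bsub>I\<^esub> r) = \<zero>\<^bsub>I\<^esub>"
      using that by (simp add: a_minus_def I.minus_add I.a_assoc)
    then show ?thesis using that by (metis eq1 I.a_closed)
  qed
  note [simp del] = carrier_free_Abelian_group_iff
  note [simp] = frag_of_in_free_Abelian_group
  show ?thesis
    unfolding balanced_map_def
  proof (intro conjI ballI)
    fix a a' x assume *: "a \<in> carrier A" "a' \<in> carrier A" "x \<in> carrier M"
    show "pure_tensor A B M (a \<oplus>\<^bsub>A\<^esub> a') x = pure_tensor A B M a x \<oplus>\<^bsub>I\<^esub> pure_tensor A B M a' x"
      using * class_of_relation[OF gen[OF *]] by (intro eq2) (simp_all add: d diff_in_F pure_closed)
  next
    fix a x x' assume *: "a \<in> carrier A" "x \<in> carrier M" "x' \<in> carrier M"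
    show "pure_tensor A B M a (x \<oplus>\<^bsub>M\<^esub> x') = pure_tensor A B M a x \<oplus>\<^bsub>I\<^esub> pure_tensor A B M a x'"
      using * class_of_relation[OF gen'[OF *]] by (intro eq2) (simp_all add: d diff_in_F pure_closed)
  next
    fix a b x assume *: "a \<in> carrier A" "b \<in> B" "x \<in> carrier M"
    then have "b \<in> carrier A" "b \<odot>\<^bsub>M\<^esub> x \<in> carrier M"
      using B_subset M.smult_closed[of b x] by auto
    then show "pure_tensor A B M (a \<otimes>\<^bsub>A\<^esub> b) x = pure_tensor A B M a (b \<odot>\<^bsub>M\<^esub> x)"
      using * class_of_relation[OF gen''[OF *]] eq1 by (simp add: d pure_closed)
  qed (simp add: pure_closed)
qed

lemma pure_add_left: "\<lbrakk>a \<in> carrier A; a' \<in> carrier A; x \<in> carrier M\<rbrakk>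
    \<Longrightarrow> pure_tensor A B M (a \<oplus>\<^bsub>A\<^esub> a') x = pure_tensor A B M a x \<oplus>\<^bsub>I\<^esub> pure_tensor A B M a' x"
  using pure_balanced by (simp add: balanced_map_def)

lemma pure_add_right: "\<lbrakk>a \<in> carrier A; x \<in> carrier M; x' \<in> carrier M\<rbrakk>
    \<Longrightarrow> pure_tensor A B M a (x \<oplus>\<^bsub>M\<^esub> x') = pure_tensor A B M a x \<oplus>\<^bsub>I\<^esub> pure_tensor A B M a x'"
  using pure_balanced by (simp add: balanced_map_def)

lemma pure_shift: "\<lbrakk>a \<in> carrier A; b \<in> B; x \<in> carrier M\<rbrakk>
    \<Longrightarrow> pure_tensor A B M (a \<otimes>\<^bsub>A\<^esub> b) x = pure_tensor A B M a (b \<odot>\<^bsub>M\<^esub> x)"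
  using pure_balanced by (simp add: balanced_map_def)

text \<open>Pure tensors generate \<open>A \<otimes>\<^sub>B M\<close> as a group. All identities between maps out of \<open>A \<otimes>\<^sub>B M\<close>
  below are checked on pure tensors by means of this lemma.\<close>

lemma additive_eq_on_pure:
  assumes N: "abelian_group N"
    and f: "f \<in> carrier I \<rightarrow> carrier N"
      "\<And>C D. C \<in> carrier I \<Longrightarrow> D \<in> carrier I \<Longrightarrow> f (C \<oplus>\<^bsub>I\<^esub> D) = f C \<oplus>\<^bsub>N\<^esub> f D"
    and g: "g \<in> carrier I \<rightarrow> carrier N"
      "\<And>C D. C \<in> carrier I \<Longrightarrow> D \<in> carrier I \<Longrightarrow> g (C \<oplus>\<^bsub>I\<^esub> D) = g C \<oplus>\<^bsub>N\<^esub> g D"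
    and eq: "\<And>a x. a \<in> carrier A \<Longrightarrow> x \<in> carrier M \<Longrightarrow> f (pure_tensor A B M a x) = g (pure_tensor A B M a x)"
    and C: "C \<in> carrier I"
  shows "f C = g C"
proof -
  have hom: "(\<lambda>v. k (cl v)) \<in> hom F (add_monoid N)"
    if "k \<in> carrier I \<rightarrow> carrier N"
      "\<And>C D. C \<in> carrier I \<Longrightarrow> D \<in> carrier I \<Longrightarrow> k (C \<oplus>\<^bsub>I\<^esub> D) = k C \<oplus>\<^bsub>N\<^esub> k D" for k
    using that by (auto simp: hom_def class_add class_closed Pi_iff)
  obtain v where v: "Poly_Mapping.keys v \<subseteq> carrier A \<times> carrier M" "C = cl v"
    using C by (auto simp: induced_carrier)
  have z: "cl 0 = \<zero>\<^bsub>I\<^esub>"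
    using subgroup.one_closed[OF rels_subgroup] by (intro class_of_relation) simp
  from v(1) have "f (cl v) = g (cl v)"
  proof (rule free_Abelian_group_induct[where P = "\<lambda>v. f (cl v) = g (cl v)"])
    show "f (cl 0) = g (cl 0)"
      using additive_zero[OF induced_abelian N f] additive_zero[OF induced_abelian N g] by (simp add: z)
  next
    fix v w
    assume "Poly_Mapping.keys v \<subseteq> carrier A \<times> carrier M" "Poly_Mapping.keys w \<subseteq> carrier A \<times> carrier M"
      "f (cl v) = g (cl v)" "f (cl w) = g (cl w)"
    then show "f (cl (v - w)) = g (cl (v - w))"
      using hom_diff[OF N hom[OF f], of v w] hom_diff[OF N hom[OF g], of v w] by simp
  next
    fix p assume "p \<in> carrier A \<times> carrier M"
    then show "f (cl (frag_of p)) = g (cl (frag_of p))" using eq by auto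
  qed
  then show ?thesis by (simp add: v)
qed

lemma frag_extend_closed:
  assumes "\<phi> \<in> carrier A \<times> carrier M \<rightarrow> carrier (free_Abelian_group S)" "v \<in> carrier F"
  shows "frag_extend \<phi> v \<in> carrier (free_Abelian_group S)"
  using keys_frag_extend[of \<phi> v] assms by fastforce

text \<open>The \<open>A\<close>-action on \<open>A \<otimes>\<^sub>B M\<close> and the map \<open>id \<otimes> h\<close> are defined by applying a substitution
  \<open>\<phi>\<close> of generators to all representatives of a coset. The result is independent of the
  representative as soon as it is balanced on generators.\<close>

lemma frag_extend_descends:
  fixes J :: "('a, 'j) module"
  assumes J: "abelian_group J"
    and q: "q \<in> hom (free_Abelian_group S) (add_monoid J)"
    and \<phi>: "\<phi> \<in> carrier A \<times> carrier M \<rightarrow> carrier (free_Abelian_group S)"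
    and bal: "balanced_map A B M J (\<lambda>a x. q (\<phi> (a, x)))"
    and v: "v \<in> carrier F" and w: "w \<in> cl v"
  shows "q (frag_extend \<phi> w) = q (frag_extend \<phi> v)"
proof (rule balanced_hom_const[OF J _ _ v w, where h = "\<lambda>v. q (frag_extend \<phi> v)"])
  show "(\<lambda>v. q (frag_extend \<phi> v)) \<in> hom F (add_monoid J)"
    using q frag_extend_closed[OF \<phi>]
    by (auto simp: hom_def frag_extend_add Pi_iff simp del: carrier_free_Abelian_group_iff)
  show "balanced_map A B M J (\<lambda>a x. q (frag_extend \<phi> (frag_of (a, x))))"
    using bal by simp
qed

text \<open>The free abelian group on pairs extends \<open>\<beta>\<close> to a homomorphism, which is constant on cosets of the
  tensor relations; any choice of representatives then defines the factorisation.\<close>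

lemma universal_property:
  assumes N: "abelian_group N" and \<beta>: "balanced_map A B M N \<beta>"
  obtains g where "g \<in> carrier I \<rightarrow> carrier N"
    "\<And>C D. C \<in> carrier I \<Longrightarrow> D \<in> carrier I \<Longrightarrow> g (C \<oplus>\<^bsub>I\<^esub> D) = g C \<oplus>\<^bsub>N\<^esub> g D"
    "\<And>a x. a \<in> carrier A \<Longrightarrow> x \<in> carrier M \<Longrightarrow> g (pure_tensor A B M a x) = \<beta> a x"
proof -
  interpret N: abelian_group N by fact
  have "case_prod \<beta> ` (carrier A \<times> carrier M) \<subseteq> carrier (add_monoid N)"
    using \<beta> by (auto simp: balanced_map_def)
  then obtain h where h: "h \<in> hom F (add_monoid N)"
    "\<And>p. p \<in> carrier A \<times> carrier M \<Longrightarrow> h (frag_of p) = case_prod \<beta> p"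
    using comm_group.free_Abelian_group_universal[OF N.a_comm_group] by metis
  have bal: "balanced_map A B M N (\<lambda>a x. h (frag_of (a, x)))"
    using \<beta> h(2) subsetD[OF B_subset] M.smult_closed by (simp add: balanced_map_def)
  define g where "g = (\<lambda>C. h (SOME v. v \<in> C))"
  have g: "g (cl v) = h v" if "v \<in> carrier F" for v
  proof -
    have "(SOME w. w \<in> cl v) \<in> cl v"
      using class_self[OF that] by (rule someI)
    then show ?thesis unfolding g_def by (rule balanced_hom_const[OF N h(1) bal that])
  qed
  show ?thesis
  proof
    show "g \<in> carrier I \<rightarrow> carrier N"
      using h(1) by (auto simp: induced_carrier g hom_def Pi_iff simp del: carrier_free_Abelian_group_iff)
    show "g (C \<oplus>\<^bsub>I\<^esub> D) = g C \<oplus>\<^bsub>N\<^esub> g D" if CD: "C \<in> carrier I" "D \<in> carrier I" for C D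
    proof -
      obtain v w where vw: "v \<in> carrier F" "w \<in> carrier F" "C = cl v" "D = cl w"
        using CD by (auto simp: induced_carrier simp del: carrier_free_Abelian_group_iff)
      have "v + w \<in> carrier F" using F.m_closed[OF vw(1,2)] by simp
      then show ?thesis
        using vw h(1) hom_mult[OF h(1) vw(1,2)]
        by (simp add: g flip: class_add del: carrier_free_Abelian_group_iff)
    qed
    show "g (pure_tensor A B M a x) = \<beta> a x" if "a \<in> carrier A" "x \<in> carrier M" for a x
      using that h(2) by (simp add: g)
  qed
qed

section \<open>The action of the algebra on the induced module\<close>

lemma smult_class:
  assumes a: "a \<in> carrier A" and v: "v \<in> carrier F"
  shows "a \<odot>\<^bsub>I\<^esub> cl v = cl (frag_extend (\<lambda>(a', x). frag_of (a \<otimes>\<^bsub>A\<^esub> a', x)) v)"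
proof -
  let ?\<phi> = "\<lambda>(a', x). frag_of (a \<otimes>\<^bsub>A\<^esub> a', x)"
  have "balanced_map A B M I (\<lambda>a' x. pure_tensor A B M (a \<otimes>\<^bsub>A\<^esub> a') x)"
    using a subsetD[OF B_subset]
    by (simp add: balanced_map_def pure_closed A.r_distr pure_add_left pure_add_right
        flip: A.m_assoc pure_shift)
  then have indep: "cl (frag_extend ?\<phi> w) = cl (frag_extend ?\<phi> v)" if "w \<in> cl v" for w
    using a by (intro frag_extend_descends[OF induced_abelian class_hom _ _ v that]) auto
  moreover have "a \<odot>\<^bsub>I\<^esub> cl v = (\<Union>w\<in>cl v. cl (frag_extend ?\<phi> w))"
    by (simp add: induced_module_def Let_def)
  ultimately show ?thesis using UN_eq_const[OF class_self[OF v] indep] by simp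
qed

lemma smult_pure:
  "\<lbrakk>a \<in> carrier A; a' \<in> carrier A; x \<in> carrier M\<rbrakk>
    \<Longrightarrow> a \<odot>\<^bsub>I\<^esub> pure_tensor A B M a' x = pure_tensor A B M (a \<otimes>\<^bsub>A\<^esub> a') x"
  by (simp add: smult_class)

lemma induced_smult_closed:
  assumes "a \<in> carrier A" "C \<in> carrier I"
  shows "a \<odot>\<^bsub>I\<^esub> C \<in> carrier I"
  using assms by (auto simp: induced_carrier smult_class simp del: carrier_free_Abelian_group_iff
      intro!: imageI frag_extend_closed)

lemma induced_smult_r_distr:
  assumes a: "a \<in> carrier A" and "C \<in> carrier I" "D \<in> carrier I"
  shows "a \<odot>\<^bsub>I\<^esub> (C \<oplus>\<^bsub>I\<^esub> D) = a \<odot>\<^bsub>I\<^esub> C \<oplus>\<^bsub>I\<^esub> a \<odot>\<^bsub>I\<^esub> D"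
proof -
  let ?\<phi> = "\<lambda>(a', x). frag_of (a \<otimes>\<^bsub>A\<^esub> a', x)"
  obtain v w where vw: "v \<in> carrier F" "w \<in> carrier F" "C = cl v" "D = cl w"
    using assms by (auto simp: induced_carrier simp del: carrier_free_Abelian_group_iff)
  have cl: "frag_extend ?\<phi> u \<in> carrier F" if "u \<in> carrier F" for u
    using a by (intro frag_extend_closed that) auto
  have "v + w \<in> carrier F" using F.m_closed[OF vw(1,2)] by simp
  then show ?thesis
    using vw a cl
    by (simp add: smult_class frag_extend_add flip: class_add del: carrier_free_Abelian_group_iff)
qed

text \<open>Both sides of each module law are additive in the tensor, and on pure tensors the law becomes
  a law of the ring \<open>A\<close>.\<close>

theorem induced_left_module: "left_module A I"
proof (rule left_module.intro[OF A_ring induced_abelian left_module_axioms.intro])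
  note [simp] = induced_smult_closed induced_smult_r_distr smult_pure I.a_ac
  fix a b C assume a: "a \<in> carrier A" and b: "b \<in> carrier A" and C: "C \<in> carrier I"
  show "(a \<oplus>\<^bsub>A\<^esub> b) \<odot>\<^bsub>I\<^esub> C = a \<odot>\<^bsub>I\<^esub> C \<oplus>\<^bsub>I\<^esub> b \<odot>\<^bsub>I\<^esub> C"
    using a b by (intro additive_eq_on_pure[OF induced_abelian _ _ _ _ _ C, where f = "\<lambda>C. (a \<oplus>\<^bsub>A\<^esub> b) \<odot>\<^bsub>I\<^esub> C"])
      (auto simp: A.l_distr pure_add_left)
  show "(a \<otimes>\<^bsub>A\<^esub> b) \<odot>\<^bsub>I\<^esub> C = a \<odot>\<^bsub>I\<^esub> (b \<odot>\<^bsub>I\<^esub> C)"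
    using a b by (intro additive_eq_on_pure[OF induced_abelian _ _ _ _ _ C, where f = "\<lambda>C. (a \<otimes>\<^bsub>A\<^esub> b) \<odot>\<^bsub>I\<^esub> C"])
      (auto simp: A.m_assoc)
next
  fix C assume C: "C \<in> carrier I"
  show "\<one>\<^bsub>A\<^esub> \<odot>\<^bsub>I\<^esub> C = C"
    by (intro additive_eq_on_pure[OF induced_abelian _ _ _ _ _ C, where f = "\<lambda>C. \<one>\<^bsub>A\<^esub> \<odot>\<^bsub>I\<^esub> C"])
      (auto simp: induced_smult_closed induced_smult_r_distr smult_pure)
qed (simp_all add: induced_smult_closed induced_smult_r_distr)

end


section \<open>Extension of scalars for maps\<close>

locale induction_map =
  M: induction_data A B M + N: induction_data A B N
  for A :: "('k, 'a) module" and B and M :: "('a, 'x) module" and N :: "('a, 'y) module" +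
  fixes h :: "'x \<Rightarrow> 'y"
  assumes h: "lin_map (A\<lparr>carrier := B\<rparr>) M N h"
begin

lemma h_closed: "x \<in> carrier M \<Longrightarrow> h x \<in> carrier N"
  using h by (rule lin_map_closed)

abbreviation ind where "ind \<equiv> induced_map A B M N h"

lemma frag_map_closed:
  "v \<in> carrier M.F \<Longrightarrow> frag_extend (\<lambda>(a, x). frag_of (a, h x)) v \<in> carrier N.F"
  by (rule M.frag_extend_closed) (auto simp: h_closed)

lemma induced_map_class:
  assumes v: "v \<in> carrier M.F"
  shows "ind (M.cl v) = N.cl (frag_extend (\<lambda>(a, x). frag_of (a, h x)) v)"
proof -
  let ?\<phi> = "\<lambda>(a, x). frag_of (a, h x)"
  have "balanced_map A B M N.I (\<lambda>a x. pure_tensor A B N a (h x))"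
    using lin_map_add[OF h] lin_map_smult[OF h]
    by (simp add: balanced_map_def N.pure_closed h_closed N.pure_add_left N.pure_add_right N.pure_shift)
  then have indep: "N.cl (frag_extend ?\<phi> w) = N.cl (frag_extend ?\<phi> v)" if "w \<in> M.cl v" for w
    by (intro M.frag_extend_descends[OF N.induced_abelian N.class_hom _ _ v that]) (auto simp: h_closed)
  have "(\<Union>w\<in>M.cl v. N.cl (frag_extend ?\<phi> w)) = N.cl (frag_extend ?\<phi> v)"
    by (rule UN_eq_const[OF M.class_self[OF v] indep])
  then show ?thesis
    using M.class_closed[OF v] by (simp add: induced_map_def)
qed

lemma induced_map_pure:
  "\<lbrakk>a \<in> carrier A; x \<in> carrier M\<rbrakk> \<Longrightarrow> ind (pure_tensor A B M a x) = pure_tensor A B N a (h x)"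
  by (simp add: induced_map_class)

theorem induced_map_lin: "lin_map A M.I N.I ind"
proof -
  have closed: "ind \<in> carrier M.I \<rightarrow> carrier N.I"
    by (auto simp: M.induced_carrier induced_map_class simp del: carrier_free_Abelian_group_iff
        intro!: N.class_closed frag_map_closed)
  have add: "ind (C \<oplus>\<^bsub>M.I\<^esub> D) = ind C \<oplus>\<^bsub>N.I\<^esub> ind D" if CD: "C \<in> carrier M.I" "D \<in> carrier M.I" for C D
  proof -
    obtain v w where vw: "v \<in> carrier M.F" "w \<in> carrier M.F" "C = M.cl v" "D = M.cl w"
      using CD by (auto simp: M.induced_carrier simp del: carrier_free_Abelian_group_iff)
    have "v + w \<in> carrier M.F" using M.F.m_closed[OF vw(1,2)] by simp
    then show ?thesis
      using vw frag_map_closed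
      by (simp add: induced_map_class frag_extend_add flip: M.class_add N.class_add
          del: carrier_free_Abelian_group_iff)
  qed
  have "ind (a \<odot>\<^bsub>M.I\<^esub> C) = a \<odot>\<^bsub>N.I\<^esub> ind C" if a: "a \<in> carrier A" and C: "C \<in> carrier M.I" for a C
    using a closed
    by (intro M.additive_eq_on_pure[OF N.induced_abelian _ _ _ _ _ C, where f = "\<lambda>C. ind (a \<odot>\<^bsub>M.I\<^esub> C)"])
      (auto simp: add M.induced_smult_closed M.induced_smult_r_distr N.induced_smult_closed
        N.induced_smult_r_distr M.smult_pure N.smult_pure induced_map_pure h_closed Pi_iff)
  then show ?thesis using closed add by (simp add: lin_map_def)
qed

end

theorem induced_chain_complex:
  assumes "ring A" "subring B A" "chain_complex (A\<lparr>carrier := B\<rparr>) X d"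
  shows "chain_complex A (induced_complex A B X) (induced_diff A B X d)"
proof -
  have I: "induction_data A B (X p)" for p
    using assms by (simp add: induction_data_def chain_complex_def)
  have D: "induction_map A B (X p) (X (p - 1)) (d p)" for p
    using I assms by (simp add: induction_map_def induction_map_axioms_def chain_complex_def)
  have dd: "induced_diff A B X d (p - 1) (induced_diff A B X d p C) = \<zero>\<^bsub>induced_complex A B X (p - 2)\<^esub>"
    if C: "C \<in> carrier (induced_complex A B X p)" for p C
  proof -
    interpret P: induction_data A B "X p" by (rule I)
    interpret P1: induction_data A B "X (p - 1)" by (rule I)
    interpret P2: induction_data A B "X (p - 2)" by (rule I)
    interpret D: induction_map A B "X p" "X (p - 1)" "d p" by (rule D)
    interpret D1: induction_map A B "X (p - 1)" "X (p - 2)" "d (p - 1)"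
      using D[of "p - 1"] by simp
    let ?dd = "\<lambda>C. D1.ind (D.ind C)"
    note l = lin_map_closed[OF D.induced_map_lin] lin_map_closed[OF D1.induced_map_lin]
      lin_map_add[OF D.induced_map_lin] lin_map_add[OF D1.induced_map_lin]
    have z: "pure_tensor A B (X (p - 2)) a \<zero>\<^bsub>X (p - 2)\<^esub> = \<zero>\<^bsub>P2.I\<^esub>" if "a \<in> carrier A" for a
      using P2.pure_add_right[OF that P2.M.M.zero_closed P2.M.M.zero_closed]
        P2.pure_closed[OF that P2.M.M.zero_closed]
      by (simp add: P2.I.add.l_cancel_one)
    have "d (p - 1) (d p x) = \<zero>\<^bsub>X (p - 2)\<^esub>" if "x \<in> carrier (X p)" for x
      using assms(3) that by (simp add: chain_complex_def)
    then have "?dd C = \<zero>\<^bsub>P2.I\<^esub>"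
      by (intro P.additive_eq_on_pure[OF P2.induced_abelian _ _ _ _ _ C, where f = ?dd and g = "\<lambda>_. \<zero>\<^bsub>P2.I\<^esub>"])
        (auto simp: l D.induced_map_pure D1.induced_map_pure D.h_closed z)
    then show ?thesis by simp
  qed
  show ?thesis
    unfolding chain_complex_def
    using induction_data.induced_left_module[OF I] induction_map.induced_map_lin[OF D] dd by blast
qed

text \<open>Frobenius reciprocity. The restriction determines \<open>\<phi>\<close> because \<open>a \<otimes> x = a (1 \<otimes> x)\<close>, and a
  \<open>B\<close>-linear \<open>\<psi>\<close> is the restriction of the map \<open>a \<otimes> x \<mapsto> a \<psi>(x)\<close>, whose existence is the
  universal property.\<close>

theorem restriction_bij:
  assumes "ring A" "subring B A" "left_module (A\<lparr>carrier := B\<rparr>) M" "left_module A V"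
  shows "bij_betw (\<lambda>\<phi>. \<lambda>x\<in>carrier M. \<phi> (pure_tensor A B M \<one>\<^bsub>A\<^esub> x))
    (Lin A (induced_module A B M) V) (Lin (A\<lparr>carrier := B\<rparr>) M V)"
proof -
  interpret induction_data A B M using assms(1-3) by (rule induction_data.intro)
  interpret V: left_module A V by fact
  let ?r = "\<lambda>\<phi>. \<lambda>x\<in>carrier M. \<phi> (pure_tensor A B M \<one>\<^bsub>A\<^esub> x)"
  have one_B: "\<one>\<^bsub>A\<^esub> \<in> B" using subringE(3)[OF B_subring] .
  have pure_eq: "pure_tensor A B M a x = a \<odot>\<^bsub>I\<^esub> pure_tensor A B M \<one>\<^bsub>A\<^esub> x"
    if "a \<in> carrier A" "x \<in> carrier M" for a x
    using that by (simp add: smult_pure)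
  show ?thesis
  proof (rule bij_betw_imageI)
    show "inj_on ?r (Lin A I V)"
    proof (rule inj_onI)
      fix \<phi> \<psi> assume \<phi>: "\<phi> \<in> Lin A I V" and \<psi>: "\<psi> \<in> Lin A I V" and eq: "?r \<phi> = ?r \<psi>"
      have l: "lin_map A I V \<phi>" "lin_map A I V \<psi>" using \<phi> \<psi> by (auto simp: Lin_def)
      have eq1: "\<phi> (pure_tensor A B M \<one>\<^bsub>A\<^esub> x) = \<psi> (pure_tensor A B M \<one>\<^bsub>A\<^esub> x)" if "x \<in> carrier M" for x
        using fun_cong[OF eq, of x] that by simp
      have eq2: "\<phi> (pure_tensor A B M a x) = \<psi> (pure_tensor A B M a x)"
        if "a \<in> carrier A" "x \<in> carrier M" for a x
        unfolding pure_eq[OF that] using that eq1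
        by (simp add: lin_map_smult[OF l(1)] lin_map_smult[OF l(2)] pure_closed)
      have "\<phi> C = \<psi> C" if C: "C \<in> carrier I" for C
        by (rule additive_eq_on_pure[OF V.M.abelian_group_axioms _ lin_map_add[OF l(1)] _ lin_map_add[OF l(2)] eq2 C])
          (use l in \<open>auto intro: lin_map_closed\<close>)
      then show "\<phi> = \<psi>"
        using \<phi> \<psi> by (intro extensionalityI[of _ "carrier I"]) (auto simp: Lin_def)
    qed
    show "?r ` Lin A I V = Lin (A\<lparr>carrier := B\<rparr>) M V"
    proof safe
      fix \<phi> assume "\<phi> \<in> Lin A I V"
      then have l: "lin_map A I V \<phi>" by (auto simp: Lin_def)
      have "\<phi> (pure_tensor A B M \<one>\<^bsub>A\<^esub> (b \<odot>\<^bsub>M\<^esub> x)) = b \<odot>\<^bsub>V\<^esub> \<phi> (pure_tensor A B M \<one>\<^bsub>A\<^esub> x)"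
        if "b \<in> B" "x \<in> carrier M" for b x
      proof -
        have b: "b \<in> carrier A" using that B_subset by auto
        have "pure_tensor A B M \<one>\<^bsub>A\<^esub> (b \<odot>\<^bsub>M\<^esub> x) = b \<odot>\<^bsub>I\<^esub> pure_tensor A B M \<one>\<^bsub>A\<^esub> x"
          using b that pure_shift[of "\<one>\<^bsub>A\<^esub>" b x] by (simp add: smult_pure)
        then show ?thesis using b that by (simp add: lin_map_smult[OF l] pure_closed)
      qed
      then show "?r \<phi> \<in> Lin (A\<lparr>carrier := B\<rparr>) M V"
        using M.smult_closed
        by (auto simp: Lin_def lin_map_def pure_add_right lin_map_add[OF l] pure_closed lin_map_closed[OF l])
    next
      fix \<psi> assume \<psi>: "\<psi> \<in> Lin (A\<lparr>carrier := B\<rparr>) M V"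
      then have l: "lin_map (A\<lparr>carrier := B\<rparr>) M V \<psi>" by (auto simp: Lin_def)
      have "balanced_map A B M V (\<lambda>a x. a \<odot>\<^bsub>V\<^esub> \<psi> x)"
        using subsetD[OF B_subset] lin_map_smult[OF l]
        by (simp add: balanced_map_def lin_map_closed[OF l] lin_map_add[OF l] V.smult_closed
            V.smult_l_distr V.smult_r_distr V.smult_assoc)
      from universal_property[OF V.M.abelian_group_axioms this]
      obtain g where g: "g \<in> carrier I \<rightarrow> carrier V"
        "\<And>C D. C \<in> carrier I \<Longrightarrow> D \<in> carrier I \<Longrightarrow> g (C \<oplus>\<^bsub>I\<^esub> D) = g C \<oplus>\<^bsub>V\<^esub> g D"
        "\<And>a x. a \<in> carrier A \<Longrightarrow> x \<in> carrier M \<Longrightarrow> g (pure_tensor A B M a x) = a \<odot>\<^bsub>V\<^esub> \<psi> x"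
        by blast
      have "g (a \<odot>\<^bsub>I\<^esub> C) = a \<odot>\<^bsub>V\<^esub> g C" if a: "a \<in> carrier A" and C: "C \<in> carrier I" for a C
        using a g lin_map_closed[OF l]
        by (intro additive_eq_on_pure[OF V.M.abelian_group_axioms _ _ _ _ _ C, where f = "\<lambda>C. g (a \<odot>\<^bsub>I\<^esub> C)"])
          (auto simp: induced_smult_closed induced_smult_r_distr smult_pure V.smult_closed
            V.smult_r_distr V.smult_assoc Pi_iff)
      then have "restrict g (carrier I) \<in> Lin A I V"
        using g by (auto simp: Lin_def lin_map_def induced_smult_closed)
      moreover have "\<psi> = ?r (restrict g (carrier I))"
        using \<psi> g(3) lin_map_closed[OF l]
        by (intro extensionalityI[of _ "carrier M"]) (auto simp: Lin_def pure_closed V.smult_one)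
      ultimately show "\<psi> \<in> ?r ` Lin A I V" by blast
    qed
  qed
qed


section \<open>Modules of linear maps\<close>

lemma lin_map_comp: "lin_map R M N f \<Longrightarrow> lin_map R N P g \<Longrightarrow> lin_map R M P (\<lambda>x. g (f x))"
  by (auto simp: lin_map_def Pi_iff)

lemma lin_map_plus:
  assumes "left_module R N" "lin_map R M N f" "lin_map R M N g"
  shows "lin_map R M N (\<lambda>x. f x \<oplus>\<^bsub>N\<^esub> g x)"
proof -
  interpret N: left_module R N by fact
  show ?thesis
    using assms(2,3) unfolding lin_map_def by (simp add: Pi_iff N.M.a_ac N.smult_r_distr)
qed

lemma (in left_module) smult_zero_right: "r \<in> carrier R \<Longrightarrow> r \<odot>\<^bsub>M\<^esub> \<zero>\<^bsub>M\<^esub> = \<zero>\<^bsub>M\<^esub>"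
  using additive_zero[OF M.abelian_group_axioms M.abelian_group_axioms, of "\<lambda>x. r \<odot>\<^bsub>M\<^esub> x"]
  by (simp add: smult_closed smult_r_distr)

lemma (in left_module) smult_minus_right:
  "r \<in> carrier R \<Longrightarrow> x \<in> carrier M \<Longrightarrow> r \<odot>\<^bsub>M\<^esub> (\<ominus>\<^bsub>M\<^esub> x) = \<ominus>\<^bsub>M\<^esub> (r \<odot>\<^bsub>M\<^esub> x)"
  using additive_minus[OF M.abelian_group_axioms M.abelian_group_axioms, of "\<lambda>x. r \<odot>\<^bsub>M\<^esub> x"]
  by (simp add: smult_closed smult_r_distr)

lemma lin_map_zero_map:
  assumes "left_module R N"
  shows "lin_map R M N (\<lambda>x. \<zero>\<^bsub>N\<^esub>)"
proof -
  interpret N: left_module R N by fact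
  show ?thesis by (simp add: lin_map_def N.smult_zero_right)
qed

lemma lin_map_uminus:
  assumes "left_module R N" "lin_map R M N f"
  shows "lin_map R M N (\<lambda>x. \<ominus>\<^bsub>N\<^esub> f x)"
proof -
  interpret N: left_module R N by fact
  show ?thesis
    using assms(2) unfolding lin_map_def by (simp add: Pi_iff N.M.minus_add N.smult_minus_right)
qed

lemma lin_map_signed_map:
  assumes "left_module R N" "lin_map R M N f"
  shows "lin_map R M N (\<lambda>x. signed N n (f x))"
  using assms lin_map_uminus[OF assms] by (cases "even n") (simp_all add: signed_def)

text \<open>Over a noncommutative ring only central scalars act by linear maps; the scalars from \<open>K\<close> are
  central, which makes Hom-sets \<open>K\<close>-modules.\<close>

lemma lin_map_central:
  assumes "left_module R N" "lin_map R M N f" "c \<in> carrier R"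
    and "\<And>r. r \<in> carrier R \<Longrightarrow> c \<otimes>\<^bsub>R\<^esub> r = r \<otimes>\<^bsub>R\<^esub> c"
  shows "lin_map R M N (\<lambda>x. c \<odot>\<^bsub>N\<^esub> f x)"
proof -
  interpret N: left_module R N by fact
  show ?thesis
    using assms(2-) unfolding lin_map_def
    by (simp add: Pi_iff N.smult_closed N.smult_r_distr flip: N.smult_assoc)
qed

lemma Lin_restrict:
  assumes "left_module R M" "lin_map R M N f"
  shows "(\<lambda>x\<in>carrier M. f x) \<in> Lin R M N"
proof -
  interpret M: left_module R M by fact
  show ?thesis using assms(2) by (auto simp: Lin_def lin_map_def M.smult_closed)
qed

lemma Lin_lin_map: "f \<in> Lin R M N \<Longrightarrow> lin_map R M N f"
  by (simp add: Lin_def)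

lemma Lin_eqI:
  "\<lbrakk>f \<in> Lin R M N; g \<in> Lin R M N'; \<And>x. x \<in> carrier M \<Longrightarrow> f x = g x\<rbrakk> \<Longrightarrow> f = g"
  by (auto simp: Lin_def intro: extensionalityI)

lemma left_module_restrict:
  assumes "left_module A V" "subring S A"
  shows "left_module (A\<lparr>carrier := S\<rparr>) V"
proof -
  interpret left_module A V by fact
  show ?thesis
    using subringE(1)[OF assms(2)] smult_closed smult_l_distr smult_r_distr smult_assoc smult_one
    by (intro left_module.intro left_module_axioms.intro R.subring_is_ring[OF assms(2)]
        M.abelian_group_axioms) (auto simp: subset_iff)
qed

context assoc_algebra
begin

abbreviation scalar where "scalar k \<equiv> k \<odot>\<^bsub>A\<^esub> \<one>\<^bsub>A\<^esub>"

lemma scalar_closed: "k \<in> carrier K \<Longrightarrow> scalar k \<in> carrier A"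
  by (simp add: smult_closed)

lemma scalar_add: "\<lbrakk>k \<in> carrier K; l \<in> carrier K\<rbrakk> \<Longrightarrow> scalar (k \<oplus>\<^bsub>K\<^esub> l) = scalar k \<oplus>\<^bsub>A\<^esub> scalar l"
  by (simp add: smult_l_distr)

lemma scalar_mult: "\<lbrakk>k \<in> carrier K; l \<in> carrier K\<rbrakk> \<Longrightarrow> scalar (k \<otimes>\<^bsub>K\<^esub> l) = scalar k \<otimes>\<^bsub>A\<^esub> scalar l"
  by (simp add: smult_mult_left smult_assoc1 smult_closed)

lemma scalar_central: "\<lbrakk>k \<in> carrier K; a \<in> carrier A\<rbrakk> \<Longrightarrow> scalar k \<otimes>\<^bsub>A\<^esub> a = a \<otimes>\<^bsub>A\<^esub> scalar k"
  by (simp add: smult_mult_left smult_mult_right)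

lemma unital_subalgebra_carrier: "unital_subalgebra K A (carrier A)"
  by (simp add: unital_subalgebra_def carrier_is_subring smult_closed)

lemma scalar_in_subalgebra: "unital_subalgebra K A S \<Longrightarrow> k \<in> carrier K \<Longrightarrow> scalar k \<in> S"
  using subringE(3)[of S A] by (auto simp: unital_subalgebra_def)

text \<open>The operations are pointwise, so each axiom is the corresponding property of \<open>V\<close>; the content is
  closure under scalars, where \<open>k 1\<close> must be central and lie in \<open>S\<close>.\<close>

theorem Hom_module:
  assumes S: "unital_subalgebra K A S" and Z: "left_module (A\<lparr>carrier := S\<rparr>) (Z n)"
    and V: "left_module A V"
  shows "module K (Hom_deg A S Z V n)"
proof -
  interpret V: left_module A V by fact
  let ?R = "A\<lparr>carrier := S\<rparr>" and ?H = "Hom_deg A S Z V n"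
  have sub: "subring S A" using S by (simp add: unital_subalgebra_def)
  note S_sub = subringE(1)[OF sub]
  note VS = left_module_restrict[OF V sub]
  have carrier: "carrier ?H = Lin ?R (Z n) V" by (simp add: Hom_deg_def)
  have cl: "\<phi> z \<in> carrier V" if "\<phi> \<in> carrier ?H" "z \<in> carrier (Z n)" for \<phi> z
    using that by (auto simp: Hom_deg_def Lin_def lin_map_def)
  have ext: "\<phi> = \<psi>" if "\<phi> \<in> carrier ?H" "\<psi> \<in> carrier ?H" "\<And>z. z \<in> carrier (Z n) \<Longrightarrow> \<phi> z = \<psi> z" for \<phi> \<psi>
    using that unfolding carrier by (rule Lin_eqI)
  have add: "\<phi> \<oplus>\<^bsub>?H\<^esub> \<psi> \<in> carrier ?H" if "\<phi> \<in> carrier ?H" "\<psi> \<in> carrier ?H" for \<phi> \<psi>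
    using that unfolding carrier
    by (simp add: Hom_deg_def Lin_restrict[OF Z] lin_map_plus[OF VS] Lin_lin_map)
  have zero: "\<zero>\<^bsub>?H\<^esub> \<in> carrier ?H"
    unfolding carrier by (simp add: Hom_deg_def Lin_restrict[OF Z] lin_map_zero_map[OF VS])
  have minus: "(\<lambda>z\<in>carrier (Z n). \<ominus>\<^bsub>V\<^esub> \<phi> z) \<in> carrier ?H" if "\<phi> \<in> carrier ?H" for \<phi>
    using that unfolding carrier by (simp add: Lin_restrict[OF Z] lin_map_uminus[OF VS] Lin_lin_map)
  have smult: "k \<odot>\<^bsub>?H\<^esub> \<phi> \<in> carrier ?H" if "k \<in> carrier K" "\<phi> \<in> carrier ?H" for k \<phi>
  proof -
    have "lin_map ?R (Z n) V (\<lambda>z. scalar k \<odot>\<^bsub>V\<^esub> \<phi> z)"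
      using that S_sub scalar_in_subalgebra[OF S]
      by (intro lin_map_central[OF VS]) (auto simp: carrier Lin_lin_map scalar_central)
    then show ?thesis
      unfolding carrier by (simp add: Hom_deg_def Lin_restrict[OF Z])
  qed
  have app: "\<zero>\<^bsub>?H\<^esub> z = \<zero>\<^bsub>V\<^esub>" "(\<phi> \<oplus>\<^bsub>?H\<^esub> \<psi>) z = \<phi> z \<oplus>\<^bsub>V\<^esub> \<psi> z" "(k \<odot>\<^bsub>?H\<^esub> \<phi>) z = scalar k \<odot>\<^bsub>V\<^esub> \<phi> z"
    if "z \<in> carrier (Z n)" for k \<phi> \<psi> z
    using that by (simp_all add: Hom_deg_def)
  note [simp] = add zero smult app cl
  show ?thesis
  proof (rule moduleI[OF R.is_cring abelian_groupI])
    show "\<exists>\<psi>\<in>carrier ?H. \<psi> \<oplus>\<^bsub>?H\<^esub> \<phi> = \<zero>\<^bsub>?H\<^esub>" if "\<phi> \<in> carrier ?H" for \<phi>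
      by (rule bexI[OF _ minus[OF that]], rule ext) (use that minus in \<open>auto simp: V.M.l_neg\<close>)
    show "\<phi> \<oplus>\<^bsub>?H\<^esub> \<psi> = \<psi> \<oplus>\<^bsub>?H\<^esub> \<phi>" if "\<phi> \<in> carrier ?H" "\<psi> \<in> carrier ?H" for \<phi> \<psi>
      by (rule ext) (use that in \<open>auto simp: V.M.a_comm\<close>)
    show "\<phi> \<oplus>\<^bsub>?H\<^esub> \<psi> \<oplus>\<^bsub>?H\<^esub> \<chi> = \<phi> \<oplus>\<^bsub>?H\<^esub> (\<psi> \<oplus>\<^bsub>?H\<^esub> \<chi>)"
      if "\<phi> \<in> carrier ?H" "\<psi> \<in> carrier ?H" "\<chi> \<in> carrier ?H" for \<phi> \<psi> \<chi>
      by (rule ext) (use that in \<open>auto simp: V.M.a_assoc\<close>)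
    show "\<zero>\<^bsub>?H\<^esub> \<oplus>\<^bsub>?H\<^esub> \<phi> = \<phi>" if "\<phi> \<in> carrier ?H" for \<phi>
      by (rule ext) (use that in auto)
    show "(k \<oplus>\<^bsub>K\<^esub> l) \<odot>\<^bsub>?H\<^esub> \<phi> = k \<odot>\<^bsub>?H\<^esub> \<phi> \<oplus>\<^bsub>?H\<^esub> l \<odot>\<^bsub>?H\<^esub> \<phi>"
      if "k \<in> carrier K" "l \<in> carrier K" "\<phi> \<in> carrier ?H" for k l \<phi>
      by (rule ext) (use that in \<open>auto simp: scalar_add V.smult_l_distr scalar_closed\<close>)
    show "k \<odot>\<^bsub>?H\<^esub> (\<phi> \<oplus>\<^bsub>?H\<^esub> \<psi>) = k \<odot>\<^bsub>?H\<^esub> \<phi> \<oplus>\<^bsub>?H\<^esub> k \<odot>\<^bsub>?H\<^esub> \<psi>"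
      if "k \<in> carrier K" "\<phi> \<in> carrier ?H" "\<psi> \<in> carrier ?H" for k \<phi> \<psi>
      by (rule ext) (use that in \<open>auto simp: V.smult_r_distr scalar_closed\<close>)
    show "(k \<otimes>\<^bsub>K\<^esub> l) \<odot>\<^bsub>?H\<^esub> \<phi> = k \<odot>\<^bsub>?H\<^esub> (l \<odot>\<^bsub>?H\<^esub> \<phi>)"
      if "k \<in> carrier K" "l \<in> carrier K" "\<phi> \<in> carrier ?H" for k l \<phi>
      by (rule ext) (use that in \<open>auto simp: scalar_mult V.smult_assoc scalar_closed\<close>)
    show "\<one>\<^bsub>K\<^esub> \<odot>\<^bsub>?H\<^esub> \<phi> = \<phi>" if "\<phi> \<in> carrier ?H" for \<phi>
      by (rule ext) (use that V.smult_one in auto)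
  qed simp_all
qed

theorem Hom_complex:
  assumes S: "unital_subalgebra K A S" and Z: "chain_complex (A\<lparr>carrier := S\<rparr>) Z d"
    and V: "left_module A V"
  shows "cochain_complex K (Hom_deg A S Z V) (Hom_diff Z d)"
proof (rule cochain_complex.intro)
  let ?R = "A\<lparr>carrier := S\<rparr>"
  interpret V: left_module A V by fact
  have sub: "subring S A" using S by (simp add: unital_subalgebra_def)
  have Zm: "left_module ?R (Z p)" and d': "lin_map ?R (Z p) (Z (p - 1)) (d p)"
    and dd': "z \<in> carrier (Z p) \<Longrightarrow> d (p - 1) (d p z) = \<zero>\<^bsub>Z (p - 2)\<^esub>" for p z
    using Z by (auto simp: chain_complex_def)
  have d: "lin_map ?R (Z (p + 1)) (Z p) (d (p + 1))" for p
    using d'[of "p + 1"] by simp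
  have dd: "z \<in> carrier (Z (p + 1 + 1)) \<Longrightarrow> d (p + 1) (d (p + 1 + 1) z) = \<zero>\<^bsub>Z p\<^esub>" for p z
    using dd'[of z "p + 1 + 1"] by (simp add: algebra_simps)
  show "module K (Hom_deg A S Z V n)" for n
    by (rule Hom_module[OF S Zm V])
  have dZ: "d (n + 1) z \<in> carrier (Z n)" if "z \<in> carrier (Z (n + 1))" for n z
    using lin_map_closed[OF d that] .
  show "lin_map K (Hom_deg A S Z V n) (Hom_deg A S Z V (n + 1)) (Hom_diff Z d n)" for n
    unfolding lin_map_def
  proof (intro conjI ballI funcsetI)
    fix \<phi> assume "\<phi> \<in> carrier (Hom_deg A S Z V n)"
    then have "lin_map ?R (Z n) V \<phi>" by (simp add: Hom_deg_def Lin_def)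
    from Lin_restrict[OF Zm lin_map_comp[OF d this]]
    show "Hom_diff Z d n \<phi> \<in> carrier (Hom_deg A S Z V (n + 1))"
      by (simp add: Hom_deg_def Hom_diff_def)
  qed (auto simp: Hom_diff_def Hom_deg_def dZ)
  show "Hom_diff Z d (n + 1) (Hom_diff Z d n \<phi>) = \<zero>\<^bsub>Hom_deg A S Z V (n + 1 + 1)\<^esub>"
    if "\<phi> \<in> carrier (Hom_deg A S Z V n)" for \<phi> n
  proof -
    interpret Zn: left_module ?R "Z n" by (rule Zm)
    have "lin_map ?R (Z n) V \<phi>" using that by (simp add: Hom_deg_def Lin_def)
    then have "\<phi> \<zero>\<^bsub>Z n\<^esub> = \<zero>\<^bsub>V\<^esub>"
      by (rule lin_map_zero[OF _ Zn.M.abelian_group_axioms V.M.abelian_group_axioms])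
    then show ?thesis
      using dd[of _ n] dZ[of _ "n + 1"] by (auto simp: Hom_diff_def Hom_deg_def)
  qed
qed

end


section \<open>The differential graded algebra of endomorphisms\<close>

locale algebra_complex = assoc_algebra K A
  for K :: "'k ring" and A :: "('k, 'a) module" +
  fixes Z :: "int \<Rightarrow> ('a, 'z) module" and d :: "int \<Rightarrow> 'z \<Rightarrow> 'z"
  assumes Z: "chain_complex A Z d"
begin

lemma Z_module: "left_module A (Z p)"
  using Z by (simp add: chain_complex_def)

lemma Z_group: "abelian_group (Z p)"
  using Z_module[of p] by (simp add: left_module_def)

lemma d_lin: "q = p - 1 \<Longrightarrow> lin_map A (Z p) (Z q) (d p)"
  using Z by (simp add: chain_complex_def)

lemma d_d: "z \<in> carrier (Z p) \<Longrightarrow> q = p - 1 \<Longrightarrow> d q (d p z) = \<zero>\<^bsub>Z (p - 2)\<^esub>"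
  using Z by (simp add: chain_complex_def)

lemma End_lin: "f \<in> carrier (End_deg A Z n) \<Longrightarrow> q = p - n \<Longrightarrow> lin_map A (Z p) (Z q) (f p)"
  by (simp add: End_deg_def Lin_def)

lemma End_memI:
  assumes "\<And>p. f p \<in> extensional (carrier (Z p))"
    "\<And>p. lin_map A (Z p) (Z (p - n)) (f p)"
  shows "f \<in> carrier (End_deg A Z n)"
  using assms by (simp add: End_deg_def Lin_def)

lemma End_restrictI:
  assumes "\<And>p. lin_map A (Z p) (Z (p - n)) (f p)"
  shows "(\<lambda>p. \<lambda>z\<in>carrier (Z p). f p z) \<in> carrier (End_deg A Z n)"
  using Lin_restrict[OF Z_module assms] by (simp add: End_deg_def)

lemma End_eqI:
  assumes "f \<in> carrier (End_deg A Z n)" "g \<in> carrier (End_deg A Z m)"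
    and "\<And>p z. z \<in> carrier (Z p) \<Longrightarrow> f p z = g p z"
  shows "f = g"
proof
  fix p
  have "f p \<in> extensional (carrier (Z p))" "g p \<in> extensional (carrier (Z p))"
    using assms(1,2) by (auto simp: End_deg_def Lin_def)
  then show "f p = g p"
    using assms(3) by (rule extensionalityI)
qed

lemma End_apply:
  assumes "z \<in> carrier (Z p)"
  shows "\<zero>\<^bsub>End_deg A Z n\<^esub> p z = \<zero>\<^bsub>Z (p - n)\<^esub>"
    "(f \<oplus>\<^bsub>End_deg A Z n\<^esub> g) p z = f p z \<oplus>\<^bsub>Z (p - n)\<^esub> g p z"
    "(k \<odot>\<^bsub>End_deg A Z n\<^esub> f) p z = scalar k \<odot>\<^bsub>Z (p - n)\<^esub> f p z"
  using assms by (simp_all add: End_deg_def)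

text \<open>In degree \<open>n\<close>, \<open>End\<^sub>A(Z)\<close> is the product over \<open>p\<close> of the modules
  \<open>Hom\<^sub>A(Z\<^sub>p, Z\<^bsub>p-n\<^esub>)\<close>.\<close>

theorem End_module: "module K (End_deg A Z n)"
proof -
  let ?E = "End_deg A Z n"
  let ?H = "\<lambda>p. Hom_deg A (carrier A) Z (Z (p - n)) p"
  have H: "module K (?H p)" for p
    by (rule Hom_module[OF unital_subalgebra_carrier _ Z_module]) (simp add: Z_module)
  have carrier: "f \<in> carrier ?E \<longleftrightarrow> (\<forall>p. f p \<in> carrier (?H p))" for f
    by (simp add: End_deg_def Hom_deg_def)
  have app: "\<zero>\<^bsub>?E\<^esub> = (\<lambda>p. \<zero>\<^bsub>?H p\<^esub>)" "f \<oplus>\<^bsub>?E\<^esub> g = (\<lambda>p. f p \<oplus>\<^bsub>?H p\<^esub> g p)" "k \<odot>\<^bsub>?E\<^esub> f = (\<lambda>p. k \<odot>\<^bsub>?H p\<^esub> f p)" for k f g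
    by (simp_all add: End_deg_def Hom_deg_def fun_eq_iff)
  interpret H: module K "?H p" for p by (rule H)
  show ?thesis
  proof (rule moduleI[OF R.is_cring abelian_groupI])
    show "\<exists>g\<in>carrier ?E. g \<oplus>\<^bsub>?E\<^esub> f = \<zero>\<^bsub>?E\<^esub>" if "f \<in> carrier ?E" for f
      by (rule bexI[of _ "\<lambda>p. \<ominus>\<^bsub>?H p\<^esub> f p"])
        (use that in \<open>auto simp: app carrier H.M.l_neg\<close>)
  qed (auto simp: app carrier fun_eq_iff H.M.a_ac H.smult_l_distr H.smult_r_distr H.smult_assoc1)
qed

text \<open>The indices \<open>p - n - 1\<close>, \<open>p - n\<close> and \<open>p - 1\<close> are variables here, because the same degree occurs below
  in forms like \<open>p - 1 - n\<close> or \<open>p - (n + 1)\<close>, and the group in which a value lives depends on it. The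
  lemmas on \<open>q = p - n\<close> below have this form for the same reason.\<close>

lemma End_diff_apply:
  assumes f: "f \<in> carrier (End_deg A Z n)" and z: "z \<in> carrier (Z p)" and q: "q = p - n - 1" "r = p - n" "s = p - 1"
  shows "End_diff Z d n f p z
    = d r (f p z) \<oplus>\<^bsub>Z q\<^esub> signed (Z q) (n + 1) (f s (d p z))"
proof -
  interpret abelian_group "Z q" by (rule Z_group)
  have "f s (d p z) \<in> carrier (Z q)"
    using z q by (auto intro!: lin_map_closed[OF End_lin[OF f]] lin_map_closed[OF d_lin])
  then show ?thesis using z unfolding q by (auto simp: End_diff_def signed_def a_minus_def)
qed

lemma End_diff_closed:
  assumes f: "f \<in> carrier (End_deg A Z n)"
  shows "End_diff Z d n f \<in> carrier (End_deg A Z (n + 1))"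
proof (rule End_memI)
  fix p
  let ?g = "\<lambda>z. d (p - n) (f p z) \<oplus>\<^bsub>Z (p - (n + 1))\<^esub> signed (Z (p - (n + 1))) (n + 1) (f (p - 1) (d p z))"
  show ext: "End_diff Z d n f p \<in> extensional (carrier (Z p))"
    by (simp add: End_diff_def)
  have "lin_map A (Z p) (Z (p - (n + 1))) ?g"
    by (intro lin_map_plus lin_map_signed_map Z_module lin_map_comp[OF End_lin[OF f] d_lin]
        lin_map_comp[OF d_lin End_lin[OF f]]) auto
  then have "restrict ?g (carrier (Z p)) \<in> Lin A (Z p) (Z (p - (n + 1)))"
    by (rule Lin_restrict[OF Z_module])
  moreover have "End_diff Z d n f p = restrict ?g (carrier (Z p))"
    by (rule extensionalityI[OF ext]) (auto simp: End_diff_apply[OF f] diff_diff_eq)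
  ultimately show "lin_map A (Z p) (Z (p - (n + 1))) (End_diff Z d n f p)"
    by (simp add: Lin_def)
qed

text \<open>On an element of degree \<open>n\<close>, applying the differential twice leaves \<open>d f d\<close> twice, with the
  opposite signs \<open>(-1)\<^bsup>n+1\<^esup>\<close> and \<open>(-1)\<^bsup>n+2\<^esup>\<close>; the other terms contain \<open>d d\<close>.\<close>

theorem End_complex: "cochain_complex K (End_deg A Z) (End_diff Z d)"
proof (rule cochain_complex.intro)
  show "module K (End_deg A Z n)" for n by (rule End_module)
  interpret E: module K "End_deg A Z i" for i by (rule End_module)
  show "lin_map K (End_deg A Z n) (End_deg A Z (n + 1)) (End_diff Z d n)" for n
    unfolding lin_map_def
  proof (intro conjI ballI funcsetI)
    fix f g assume f: "f \<in> carrier (End_deg A Z n)" and g: "g \<in> carrier (End_deg A Z n)"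
    show "End_diff Z d n (f \<oplus>\<^bsub>End_deg A Z n\<^esub> g)
      = End_diff Z d n f \<oplus>\<^bsub>End_deg A Z (n + 1)\<^esub> End_diff Z d n g"
    proof (rule End_eqI)
      fix p z assume z: "z \<in> carrier (Z p)"
      interpret Q: abelian_group "Z (p - n - 1)" by (rule Z_group)
      have dz: "d p z \<in> carrier (Z (p - 1))" using z by (intro lin_map_closed[OF d_lin]) auto
      have 1: "f p z \<in> carrier (Z (p - n))" "g p z \<in> carrier (Z (p - n))"
        using z by (auto intro: lin_map_closed[OF End_lin[OF f]] lin_map_closed[OF End_lin[OF g]])
      have 2: "f (p - 1) (d p z) \<in> carrier (Z (p - n - 1))" "g (p - 1) (d p z) \<in> carrier (Z (p - n - 1))"
        "d (p - n) (f p z) \<in> carrier (Z (p - n - 1))" "d (p - n) (g p z) \<in> carrier (Z (p - n - 1))"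
        using dz 1 by (auto intro!: lin_map_closed[OF End_lin[OF f]] lin_map_closed[OF End_lin[OF g]]
            lin_map_closed[OF d_lin])
      have "(f \<oplus>\<^bsub>End_deg A Z n\<^esub> g) (p - 1) (d p z) = f (p - 1) (d p z) \<oplus>\<^bsub>Z (p - n - 1)\<^esub> g (p - 1) (d p z)"
        using End_apply(2)[OF dz, where n = n and f = f and g = g] by (simp add: algebra_simps)
      moreover have "d (p - n) ((f \<oplus>\<^bsub>End_deg A Z n\<^esub> g) p z)
        = d (p - n) (f p z) \<oplus>\<^bsub>Z (p - n - 1)\<^esub> d (p - n) (g p z)"
        using lin_map_add[OF d_lin[OF refl, of "p - n"] 1] by (simp add: End_apply(2)[OF z])
      ultimately have "End_diff Z d n (f \<oplus>\<^bsub>End_deg A Z n\<^esub> g) p z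
        = End_diff Z d n f p z \<oplus>\<^bsub>Z (p - n - 1)\<^esub> End_diff Z d n g p z"
        using 2 f g by (simp add: End_diff_apply[OF _ z refl refl refl] Q.signed_add Q.a_ac)
      then show "End_diff Z d n (f \<oplus>\<^bsub>End_deg A Z n\<^esub> g) p z
        = (End_diff Z d n f \<oplus>\<^bsub>End_deg A Z (n + 1)\<^esub> End_diff Z d n g) p z"
        by (simp add: End_apply(2)[OF z] diff_diff_eq)
    qed (use f g in \<open>auto intro: End_diff_closed\<close>)
  next
    fix k f assume k: "k \<in> carrier K" and f: "f \<in> carrier (End_deg A Z n)"
    show "End_diff Z d n (k \<odot>\<^bsub>End_deg A Z n\<^esub> f) = k \<odot>\<^bsub>End_deg A Z (n + 1)\<^esub> End_diff Z d n f"
    proof (rule End_eqI)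
      fix p z assume z: "z \<in> carrier (Z p)"
      interpret Q: left_module A "Z (p - n - 1)" by (rule Z_module)
      note c = scalar_closed[OF k]
      have dz: "d p z \<in> carrier (Z (p - 1))" using z by (intro lin_map_closed[OF d_lin]) auto
      have 1: "f p z \<in> carrier (Z (p - n))"
        using z by (auto intro: lin_map_closed[OF End_lin[OF f]])
      have 2: "f (p - 1) (d p z) \<in> carrier (Z (p - n - 1))" "d (p - n) (f p z) \<in> carrier (Z (p - n - 1))"
        using dz 1 by (auto intro!: lin_map_closed[OF End_lin[OF f]] lin_map_closed[OF d_lin])
      have "(k \<odot>\<^bsub>End_deg A Z n\<^esub> f) (p - 1) (d p z) = scalar k \<odot>\<^bsub>Z (p - n - 1)\<^esub> f (p - 1) (d p z)"
        using End_apply(3)[OF dz, where n = n and f = f and k = k] by (simp add: algebra_simps)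
      moreover have "d (p - n) ((k \<odot>\<^bsub>End_deg A Z n\<^esub> f) p z) = scalar k \<odot>\<^bsub>Z (p - n - 1)\<^esub> d (p - n) (f p z)"
        using lin_map_smult[OF d_lin[OF refl, of "p - n"] c 1] by (simp add: End_apply(3)[OF z])
      moreover have "signed (Z (p - n - 1)) (n + 1) (scalar k \<odot>\<^bsub>Z (p - n - 1)\<^esub> f (p - 1) (d p z))
        = scalar k \<odot>\<^bsub>Z (p - n - 1)\<^esub> signed (Z (p - n - 1)) (n + 1) (f (p - 1) (d p z))"
        using c 2 by (simp add: signed_def Q.smult_minus_right)
      ultimately have "End_diff Z d n (k \<odot>\<^bsub>End_deg A Z n\<^esub> f) p z
        = scalar k \<odot>\<^bsub>Z (p - n - 1)\<^esub> End_diff Z d n f p z"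
        using 2 f c k by (simp add: End_diff_apply[OF _ z refl refl refl] Q.smult_r_distr)
      then show "End_diff Z d n (k \<odot>\<^bsub>End_deg A Z n\<^esub> f) p z
        = (k \<odot>\<^bsub>End_deg A Z (n + 1)\<^esub> End_diff Z d n f) p z"
        by (simp add: End_apply(3)[OF z] diff_diff_eq)
    qed (use f k in \<open>auto intro: End_diff_closed\<close>)
  qed (rule End_diff_closed)
  show "End_diff Z d (n + 1) (End_diff Z d n f) = \<zero>\<^bsub>End_deg A Z (n + 1 + 1)\<^esub>"
    if f: "f \<in> carrier (End_deg A Z n)" for f n
  proof (rule End_eqI)
    note Df = End_diff_closed[OF f]
    show "End_diff Z d (n + 1) (End_diff Z d n f) \<in> carrier (End_deg A Z (n + 1 + 1))"
      by (rule End_diff_closed[OF Df])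
    fix p z assume z: "z \<in> carrier (Z p)"
    let ?q = "p - n - 2"
    interpret Q1: abelian_group "Z (p - n - 1)" by (rule Z_group)
    interpret Q: abelian_group "Z ?q" by (rule Z_group)
    have dz: "d p z \<in> carrier (Z (p - 1))" using z by (intro lin_map_closed[OF d_lin]) auto
    have fz: "f p z \<in> carrier (Z (p - n))" using z by (intro lin_map_closed[OF End_lin[OF f]]) auto
    have fdz: "f (p - 1) (d p z) \<in> carrier (Z (p - n - 1))"
      using dz by (intro lin_map_closed[OF End_lin[OF f]]) auto
    have dfz: "d (p - n) (f p z) \<in> carrier (Z (p - n - 1))"
      using fz by (intro lin_map_closed[OF d_lin]) auto
    have dfdz: "d (p - n - 1) (f (p - 1) (d p z)) \<in> carrier (Z ?q)"
      using fdz by (intro lin_map_closed[OF d_lin]) auto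
    have d1: "lin_map A (Z (p - n - 1)) (Z ?q) (d (p - n - 1))" by (rule d_lin) simp
    have f0: "f (p - 2) \<zero>\<^bsub>Z (p - 2)\<^esub> = \<zero>\<^bsub>Z ?q\<^esub>"
      using lin_map_zero[OF End_lin[OF f, where p = "p - 2" and q = ?q] Z_group Z_group] by simp
    have "d (p - n - 1) (End_diff Z d n f p z)
      = signed (Z ?q) (n + 1) (d (p - n - 1) (f (p - 1) (d p z)))"
      unfolding End_diff_apply[OF f z refl refl refl]
      using lin_map_add[OF d1 dfz, of "signed (Z (p - n - 1)) (n + 1) (f (p - 1) (d p z))"] fdz
        lin_map_signed[OF d1 Z_group Z_group fdz] d_d[OF fz, of "p - n - 1"] dfdz
      by simp
    moreover have "End_diff Z d n f (p - 1) (d p z) = d (p - n - 1) (f (p - 1) (d p z))"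
      using End_diff_apply[OF f dz, of ?q "p - n - 1" "p - 2"] d_d[OF z, of "p - 1"] f0 dfdz by simp
    ultimately have "End_diff Z d (n + 1) (End_diff Z d n f) p z = \<zero>\<^bsub>Z ?q\<^esub>"
      using End_diff_apply[OF Df z, of ?q "p - n - 1" "p - 1"] Q.signed_succ_cancel[OF dfdz, of "n + 1"] by simp
    then show "End_diff Z d (n + 1) (End_diff Z d n f) p z = \<zero>\<^bsub>End_deg A Z (n + 1 + 1)\<^esub> p z"
      using End_apply(1)[OF z, where n = "n + 1 + 1"] by (simp add: algebra_simps)
  qed (rule E.M.zero_closed)
qed

lemma End_closed:
  "\<lbrakk>f \<in> carrier (End_deg A Z n); z \<in> carrier (Z p); q = p - n\<rbrakk> \<Longrightarrow> f p z \<in> carrier (Z q)"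
  using lin_map_closed[OF End_lin] by blast

lemma d_closed: "\<lbrakk>z \<in> carrier (Z p); q = p - 1\<rbrakk> \<Longrightarrow> d p z \<in> carrier (Z q)"
  using lin_map_closed[OF d_lin] by blast

lemma End_add_apply:
  "z \<in> carrier (Z p) \<Longrightarrow> q = p - n \<Longrightarrow> (f \<oplus>\<^bsub>End_deg A Z n\<^esub> g) p z = f p z \<oplus>\<^bsub>Z q\<^esub> g p z"
  using End_apply(2) by blast

lemma End_smult_apply:
  "z \<in> carrier (Z p) \<Longrightarrow> q = p - n \<Longrightarrow> (k \<odot>\<^bsub>End_deg A Z n\<^esub> f) p z = scalar k \<odot>\<^bsub>Z q\<^esub> f p z"
  using End_apply(3) by blast

lemma End_signed_apply:
  assumes f: "f \<in> carrier (End_deg A Z n)" and z: "z \<in> carrier (Z p)" and q: "q = p - n"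
  shows "signed (End_deg A Z n) e f p z = signed (Z q) e (f p z)"
proof -
  interpret E: module K "End_deg A Z n" by (rule End_module)
  interpret Q: abelian_group "Z q" by (rule Z_group)
  have "(\<ominus>\<^bsub>End_deg A Z n\<^esub> f) p z = \<ominus>\<^bsub>Z q\<^esub> f p z"
    by (rule additive_minus[OF E.M.abelian_group_axioms Q.abelian_group_axioms, of "\<lambda>f. f p z"])
      (use f z q in \<open>auto simp: End_add_apply intro: End_closed\<close>)
  then show ?thesis by (simp add: signed_def)
qed

lemma End_comp_closed:
  assumes "f \<in> carrier (End_deg A Z n)" "g \<in> carrier (End_deg A Z m)"
  shows "End_comp Z m f g \<in> carrier (End_deg A Z (n + m))"
  unfolding End_comp_def
  by (intro End_restrictI lin_map_comp[OF End_lin[OF assms(2)] End_lin[OF assms(1)]]) auto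

lemma End_id_closed: "End_id Z \<in> carrier (End_deg A Z 0)"
  unfolding End_id_def by (rule End_restrictI) (auto simp: lin_map_def)

lemma End_comp_apply: "z \<in> carrier (Z p) \<Longrightarrow> End_comp Z m f g p z = f (p - m) (g p z)"
  by (simp add: End_comp_def)

lemma End_comp_add_left:
  assumes "f \<in> carrier (End_deg A Z n)" "f' \<in> carrier (End_deg A Z n)" "g \<in> carrier (End_deg A Z m)"
  shows "End_comp Z m (f \<oplus>\<^bsub>End_deg A Z n\<^esub> f') g
    = End_comp Z m f g \<oplus>\<^bsub>End_deg A Z (n + m)\<^esub> End_comp Z m f' g"
proof -
  interpret E: module K "End_deg A Z i" for i by (rule End_module)
  show ?thesis
  proof (rule End_eqI)
    fix p z assume z: "z \<in> carrier (Z p)"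
    have "g p z \<in> carrier (Z (p - m))" using End_closed[OF assms(3) z] by simp
    then show "End_comp Z m (f \<oplus>\<^bsub>End_deg A Z n\<^esub> f') g p z
      = (End_comp Z m f g \<oplus>\<^bsub>End_deg A Z (n + m)\<^esub> End_comp Z m f' g) p z"
      using z by (simp add: End_comp_apply End_add_apply[where q = "p - m - n"])
  qed (use assms in \<open>auto intro!: End_comp_closed\<close>)
qed

lemma End_comp_add_right:
  assumes "f \<in> carrier (End_deg A Z n)" "g \<in> carrier (End_deg A Z m)" "g' \<in> carrier (End_deg A Z m)"
  shows "End_comp Z m f (g \<oplus>\<^bsub>End_deg A Z m\<^esub> g')
    = End_comp Z m f g \<oplus>\<^bsub>End_deg A Z (n + m)\<^esub> End_comp Z m f g'"
proof -
  interpret E: module K "End_deg A Z i" for i by (rule End_module)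
  show ?thesis
  proof (rule End_eqI)
    fix p z assume z: "z \<in> carrier (Z p)"
    have "g p z \<in> carrier (Z (p - m))" "g' p z \<in> carrier (Z (p - m))"
      using End_closed[OF _ z] assms by auto
    then show "End_comp Z m f (g \<oplus>\<^bsub>End_deg A Z m\<^esub> g') p z
      = (End_comp Z m f g \<oplus>\<^bsub>End_deg A Z (n + m)\<^esub> End_comp Z m f g') p z"
      using z lin_map_add[OF End_lin[OF assms(1)]]
      by (simp add: End_comp_apply End_add_apply[where q = "p - m"] End_add_apply[where q = "p - m - n"])
  qed (use assms in \<open>auto intro!: End_comp_closed\<close>)
qed

lemma End_comp_smult_left:
  assumes "k \<in> carrier K" "f \<in> carrier (End_deg A Z n)" "g \<in> carrier (End_deg A Z m)"
  shows "End_comp Z m (k \<odot>\<^bsub>End_deg A Z n\<^esub> f) g = k \<odot>\<^bsub>End_deg A Z (n + m)\<^esub> End_comp Z m f g"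
proof -
  interpret E: module K "End_deg A Z i" for i by (rule End_module)
  show ?thesis
  proof (rule End_eqI)
    fix p z assume z: "z \<in> carrier (Z p)"
    have "g p z \<in> carrier (Z (p - m))" using End_closed[OF assms(3) z] by simp
    then show "End_comp Z m (k \<odot>\<^bsub>End_deg A Z n\<^esub> f) g p z = (k \<odot>\<^bsub>End_deg A Z (n + m)\<^esub> End_comp Z m f g) p z"
      using z by (simp add: End_comp_apply End_smult_apply[where q = "p - m - n"])
  qed (use assms in \<open>auto intro!: End_comp_closed\<close>)
qed

lemma End_comp_smult_right:
  assumes "k \<in> carrier K" "f \<in> carrier (End_deg A Z n)" "g \<in> carrier (End_deg A Z m)"
  shows "End_comp Z m f (k \<odot>\<^bsub>End_deg A Z m\<^esub> g) = k \<odot>\<^bsub>End_deg A Z (n + m)\<^esub> End_comp Z m f g"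
proof -
  interpret E: module K "End_deg A Z i" for i by (rule End_module)
  show ?thesis
  proof (rule End_eqI)
    fix p z assume z: "z \<in> carrier (Z p)"
    have "g p z \<in> carrier (Z (p - m))" using End_closed[OF assms(3) z] by simp
    then show "End_comp Z m f (k \<odot>\<^bsub>End_deg A Z m\<^esub> g) p z = (k \<odot>\<^bsub>End_deg A Z (n + m)\<^esub> End_comp Z m f g) p z"
      using z lin_map_smult[OF End_lin[OF assms(2)] scalar_closed[OF assms(1)]]
      by (simp add: End_comp_apply End_smult_apply[where q = "p - m"] End_smult_apply[where q = "p - m - n"])
  qed (use assms in \<open>auto intro!: End_comp_closed\<close>)
qed

theorem End_graded_algebra: "graded_algebra K (End_deg A Z) (\<lambda>n m. End_comp Z m) (End_id Z)"
proof (rule graded_algebra.intro)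
  show "End_comp Z l (End_comp Z m f g) h = End_comp Z (m + l) f (End_comp Z l g h)"
    if "f \<in> carrier (End_deg A Z n)" "g \<in> carrier (End_deg A Z m)" "h \<in> carrier (End_deg A Z l)"
    for f g h n m l
  proof (rule End_eqI)
    show "End_comp Z l (End_comp Z m f g) h \<in> carrier (End_deg A Z (n + m + l))"
      "End_comp Z (m + l) f (End_comp Z l g h) \<in> carrier (End_deg A Z (n + (m + l)))"
      using that by (auto intro!: End_comp_closed)
    show "End_comp Z l (End_comp Z m f g) h p z = End_comp Z (m + l) f (End_comp Z l g h) p z"
      if z: "z \<in> carrier (Z p)" for p z
      using End_closed[OF \<open>h \<in> _\<close> z, of "p - l"] z by (simp add: End_comp_apply algebra_simps)
  qed
  show "End_comp Z n (End_id Z) f = f" if "f \<in> carrier (End_deg A Z n)" for f n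
  proof (rule End_eqI[OF _ that])
    show "End_comp Z n (End_id Z) f \<in> carrier (End_deg A Z (0 + n))"
      by (rule End_comp_closed[OF End_id_closed that])
    show "End_comp Z n (End_id Z) f p z = f p z" if z: "z \<in> carrier (Z p)" for p z
      using End_closed[OF \<open>f \<in> _\<close> z] z by (simp add: End_comp_apply End_id_def)
  qed
  show "End_comp Z 0 f (End_id Z) = f" if "f \<in> carrier (End_deg A Z n)" for f n
  proof (rule End_eqI[OF _ that])
    show "End_comp Z 0 f (End_id Z) \<in> carrier (End_deg A Z (n + 0))"
      by (rule End_comp_closed[OF that End_id_closed])
  qed (simp add: End_comp_apply End_id_def)
qed (auto intro: End_module End_comp_closed End_id_closed End_comp_add_left End_comp_add_right
    End_comp_smult_left End_comp_smult_right)

lemma End_id_cocycle: "End_id Z \<in> cocycles (End_deg A Z) (End_diff Z d) 0"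
proof -
  interpret E: module K "End_deg A Z i" for i by (rule End_module)
  have "End_diff Z d 0 (End_id Z) = \<zero>\<^bsub>End_deg A Z (0 + 1)\<^esub>"
  proof (rule End_eqI)
    show "End_diff Z d 0 (End_id Z) \<in> carrier (End_deg A Z (0 + 1))"
      by (rule End_diff_closed[OF End_id_closed])
    fix p z assume z: "z \<in> carrier (Z p)"
    interpret Q: abelian_group "Z (p - 1)" by (rule Z_group)
    show "End_diff Z d 0 (End_id Z) p z = \<zero>\<^bsub>End_deg A Z (0 + 1)\<^esub> p z"
      unfolding End_diff_apply[OF End_id_closed z refl refl refl]
      using d_closed[OF z] z by (simp add: End_id_def signed_def End_apply(1) Q.r_neg)
  qed (rule E.M.zero_closed)
  then show ?thesis using End_id_closed by (simp add: cocycles_def)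
qed

text \<open>The Leibniz rule: \<open>(d f) g\<close> contributes \<open>(-1)\<^bsup>n+1\<^esup> f d g\<close> and \<open>(-1)\<^sup>n f (d g)\<close> contributes
  \<open>(-1)\<^sup>n f d g\<close>. These cancel, and \<open>d f g + (-1)\<^bsup>n+m+1\<^esup> f g d\<close> remains.\<close>

theorem End_dg_algebra:
  "dg_pairing K (End_deg A Z) (End_diff Z d) (End_deg A Z) (End_diff Z d) (End_deg A Z) (End_diff Z d)
    (\<lambda>n m. End_comp Z m) (\<lambda>n m. 0) (\<lambda>n m. n)"
proof (intro dg_pairing.intro dg_pairing_axioms.intro End_complex)
  fix f g n m assume f: "f \<in> carrier (End_deg A Z n)" and g: "g \<in> carrier (End_deg A Z m)"
  interpret E: module K "End_deg A Z i" for i by (rule End_module)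
  let ?N = "n + m + 1"
  have Df_g: "End_comp Z m (End_diff Z d n f) g \<in> carrier (End_deg A Z ?N)"
    using End_comp_closed[OF End_diff_closed[OF f] g] by (simp add: algebra_simps)
  have f_Dg: "End_comp Z (m + 1) f (End_diff Z d m g) \<in> carrier (End_deg A Z ?N)"
    using End_comp_closed[OF f End_diff_closed[OF g]] by (simp add: algebra_simps)
  show "End_diff Z d (n + m) (End_comp Z m f g)
    = signed (End_deg A Z ?N) 0 (End_comp Z m (End_diff Z d n f) g)
      \<oplus>\<^bsub>End_deg A Z ?N\<^esub> signed (End_deg A Z ?N) n (End_comp Z (m + 1) f (End_diff Z d m g))"
  proof (rule End_eqI)
    show "End_diff Z d (n + m) (End_comp Z m f g) \<in> carrier (End_deg A Z ?N)"
      by (rule End_diff_closed[OF End_comp_closed[OF f g]])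
    show "signed (End_deg A Z ?N) 0 (End_comp Z m (End_diff Z d n f) g)
      \<oplus>\<^bsub>End_deg A Z ?N\<^esub> signed (End_deg A Z ?N) n (End_comp Z (m + 1) f (End_diff Z d m g))
      \<in> carrier (End_deg A Z ?N)"
      using Df_g f_Dg by simp
    fix p z assume z: "z \<in> carrier (Z p)"
    let ?q = "p - m - n - 1"
    interpret Q: abelian_group "Z ?q" by (rule Z_group)
    interpret P: abelian_group "Z (p - m - 1)" by (rule Z_group)
    have gz: "g p z \<in> carrier (Z (p - m))" using End_closed[OF g z] by simp
    have dz: "d p z \<in> carrier (Z (p - 1))" using d_closed[OF z] by simp
    have gdz: "g (p - 1) (d p z) \<in> carrier (Z (p - m - 1))" using End_closed[OF g dz, of "p - m - 1"] by simp
    have dgz: "d (p - m) (g p z) \<in> carrier (Z (p - m - 1))" using d_closed[OF gz] by simp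
    have fq: "lin_map A (Z (p - m - 1)) (Z ?q) (f (p - m - 1))" by (rule End_lin[OF f]) simp
    have dfgz: "d (p - m - n) (f (p - m) (g p z)) \<in> carrier (Z ?q)"
      using End_closed[OF f gz] by (intro d_closed) auto
    note fdgz = lin_map_closed[OF fq dgz] and fgdz = lin_map_closed[OF fq gdz]
    have "End_diff Z d (n + m) (End_comp Z m f g) p z
      = d (p - m - n) (f (p - m) (g p z)) \<oplus>\<^bsub>Z ?q\<^esub> signed (Z ?q) (n + m + 1) (f (p - m - 1) (g (p - 1) (d p z)))"
      using End_diff_apply[OF End_comp_closed[OF f g] z, of ?q "p - m - n" "p - 1"] z dz
      by (simp add: End_comp_apply diff_right_commute[of p 1 m])
    \<comment> \<open>Insert \<open>f d g\<close> with opposite signs, which splits the sum into the two products.\<close>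
    also have "\<dots> = (d (p - m - n) (f (p - m) (g p z)) \<oplus>\<^bsub>Z ?q\<^esub> signed (Z ?q) (n + 1) (f (p - m - 1) (d (p - m) (g p z))))
      \<oplus>\<^bsub>Z ?q\<^esub> (signed (Z ?q) n (f (p - m - 1) (d (p - m) (g p z)))
        \<oplus>\<^bsub>Z ?q\<^esub> signed (Z ?q) (n + m + 1) (f (p - m - 1) (g (p - 1) (d p z))))"
    proof -
      have "x \<oplus>\<^bsub>Z ?q\<^esub> v = (x \<oplus>\<^bsub>Z ?q\<^esub> y) \<oplus>\<^bsub>Z ?q\<^esub> (w \<oplus>\<^bsub>Z ?q\<^esub> v)"
        if "x \<in> carrier (Z ?q)" "y \<in> carrier (Z ?q)" "w \<in> carrier (Z ?q)" "v \<in> carrier (Z ?q)"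
          "y \<oplus>\<^bsub>Z ?q\<^esub> w = \<zero>\<^bsub>Z ?q\<^esub>" for x y w v
      proof -
        have "(x \<oplus>\<^bsub>Z ?q\<^esub> y) \<oplus>\<^bsub>Z ?q\<^esub> (w \<oplus>\<^bsub>Z ?q\<^esub> v) = x \<oplus>\<^bsub>Z ?q\<^esub> ((y \<oplus>\<^bsub>Z ?q\<^esub> w) \<oplus>\<^bsub>Z ?q\<^esub> v)"
          using that(1-4) by (simp add: Q.a_assoc)
        then show ?thesis using that by simp
      qed
      then show ?thesis
        using dfgz fdgz fgdz Q.signed_succ_cancel(1)[OF fdgz, of n] by (metis Q.signed_closed)
    qed
    also have "d (p - m - n) (f (p - m) (g p z)) \<oplus>\<^bsub>Z ?q\<^esub> signed (Z ?q) (n + 1) (f (p - m - 1) (d (p - m) (g p z)))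
      = End_comp Z m (End_diff Z d n f) g p z"
      using z gz by (simp add: End_comp_apply End_diff_apply[OF f gz, of ?q "p - m - n" "p - m - 1"])
    also have "signed (Z ?q) n (f (p - m - 1) (d (p - m) (g p z)))
        \<oplus>\<^bsub>Z ?q\<^esub> signed (Z ?q) (n + m + 1) (f (p - m - 1) (g (p - 1) (d p z)))
      = signed (Z ?q) n (End_comp Z (m + 1) f (End_diff Z d m g) p z)"
    proof -
      have "End_comp Z (m + 1) f (End_diff Z d m g) p z = f (p - m - 1) (End_diff Z d m g p z)"
        using z by (simp add: End_comp_apply diff_diff_eq)
      also have "\<dots> = f (p - m - 1) (d (p - m) (g p z))
          \<oplus>\<^bsub>Z ?q\<^esub> signed (Z ?q) (m + 1) (f (p - m - 1) (g (p - 1) (d p z)))"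
        using lin_map_add[OF fq dgz, of "signed (Z (p - m - 1)) (m + 1) (g (p - 1) (d p z))"] gdz
          lin_map_signed[OF fq Z_group Z_group gdz]
        by (simp add: End_diff_apply[OF g z, of "p - m - 1" "p - m" "p - 1"])
      finally show ?thesis
        using fdgz fgdz by (simp add: Q.signed_add add.assoc)
    qed
    finally show "End_diff Z d (n + m) (End_comp Z m f g) p z
      = (signed (End_deg A Z ?N) 0 (End_comp Z m (End_diff Z d n f) g)
        \<oplus>\<^bsub>End_deg A Z ?N\<^esub> signed (End_deg A Z ?N) n (End_comp Z (m + 1) f (End_diff Z d m g))) p z"
      using z f_Dg by (simp add: End_add_apply[where q = ?q] End_signed_apply[where q = ?q])
  qed
qed (auto intro: End_comp_closed End_comp_add_left End_comp_add_right)


section \<open>The right action on linear maps into a module\<close>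

context
  fixes V :: "('a, 'v) module"
  assumes V: "left_module A V"
begin

interpretation V: left_module A V by (rule V)

abbreviation Hom_Z where "Hom_Z \<equiv> Hom_deg A (carrier A) Z V"

lemma Hom_Z_complex: "cochain_complex K Hom_Z (Hom_diff Z d)"
  by (rule Hom_complex[OF unital_subalgebra_carrier _ V]) (simp add: Z)

interpretation H: cochain_complex K Hom_Z "Hom_diff Z d" by (rule Hom_Z_complex)

lemma Hom_lin: "\<phi> \<in> carrier (Hom_Z n) \<Longrightarrow> lin_map A (Z n) V \<phi>"
  by (simp add: Hom_deg_def Lin_def)

lemma Hom_eqI:
  assumes "\<phi> \<in> carrier (Hom_Z n)" "\<psi> \<in> carrier (Hom_Z n)" "\<And>z. z \<in> carrier (Z n) \<Longrightarrow> \<phi> z = \<psi> z"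
  shows "\<phi> = \<psi>"
  using assms Lin_eqI[of \<phi> A "Z n" V \<psi> V] by (simp add: Hom_deg_def)

lemma Hom_apply:
  assumes "z \<in> carrier (Z n)"
  shows "(\<phi> \<oplus>\<^bsub>Hom_Z n\<^esub> \<psi>) z = \<phi> z \<oplus>\<^bsub>V\<^esub> \<psi> z" "(k \<odot>\<^bsub>Hom_Z n\<^esub> \<phi>) z = scalar k \<odot>\<^bsub>V\<^esub> \<phi> z"
  using assms by (simp_all add: Hom_deg_def)

lemma Hom_signed_apply:
  assumes \<phi>: "\<phi> \<in> carrier (Hom_Z n)" and z: "z \<in> carrier (Z n)"
  shows "signed (Hom_Z n) e \<phi> z = signed V e (\<phi> z)"
proof -
  have "(\<ominus>\<^bsub>Hom_Z n\<^esub> \<phi>) z = \<ominus>\<^bsub>V\<^esub> \<phi> z"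
    by (rule additive_minus[OF H.abelian V.M.abelian_group_axioms, of "\<lambda>\<phi>. \<phi> z"])
      (use \<phi> z lin_map_closed[OF Hom_lin] in \<open>auto simp: Hom_apply\<close>)
  then show ?thesis by (simp add: signed_def)
qed

lemma Hom_comp_closed:
  assumes "\<phi> \<in> carrier (Hom_Z n)" "f \<in> carrier (End_deg A Z m)"
  shows "Hom_comp Z n m \<phi> f \<in> carrier (Hom_Z (n + m))"
proof -
  have "lin_map A (Z (n + m)) V (\<lambda>z. \<phi> (f (n + m) z))"
    by (rule lin_map_comp[OF End_lin[OF assms(2)] Hom_lin[OF assms(1)]]) simp
  then show ?thesis
    using Lin_restrict[OF Z_module] by (simp add: Hom_comp_def Hom_deg_def)
qed

lemma Hom_comp_apply: "z \<in> carrier (Z (n + m)) \<Longrightarrow> Hom_comp Z n m \<phi> f z = \<phi> (f (n + m) z)"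
  by (simp add: Hom_comp_def)

lemma Hom_comp_add_left:
  assumes "\<phi> \<in> carrier (Hom_Z n)" "\<phi>' \<in> carrier (Hom_Z n)" "f \<in> carrier (End_deg A Z m)"
  shows "Hom_comp Z n m (\<phi> \<oplus>\<^bsub>Hom_Z n\<^esub> \<phi>') f
    = Hom_comp Z n m \<phi> f \<oplus>\<^bsub>Hom_Z (n + m)\<^esub> Hom_comp Z n m \<phi>' f"
proof -
  interpret HM: module K "Hom_Z i" for i by (rule H.C_module)
  show ?thesis
    by (rule Hom_eqI[of _ "n + m"])
      (use assms in \<open>auto simp: Hom_comp_closed Hom_comp_apply Hom_apply End_closed[OF assms(3)]\<close>)
qed

lemma Hom_comp_add_right:
  assumes "\<phi> \<in> carrier (Hom_Z n)" "f \<in> carrier (End_deg A Z m)" "f' \<in> carrier (End_deg A Z m)"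
  shows "Hom_comp Z n m \<phi> (f \<oplus>\<^bsub>End_deg A Z m\<^esub> f')
    = Hom_comp Z n m \<phi> f \<oplus>\<^bsub>Hom_Z (n + m)\<^esub> Hom_comp Z n m \<phi> f'"
proof -
  interpret HM: module K "Hom_Z i" for i by (rule H.C_module)
  interpret E: module K "End_deg A Z i" for i by (rule End_module)
  show ?thesis
    by (rule Hom_eqI[of _ "n + m"])
      (use assms in \<open>auto simp: Hom_comp_closed Hom_comp_apply Hom_apply End_add_apply[where q = n]
        End_closed[OF assms(2)] End_closed[OF assms(3)] lin_map_add[OF Hom_lin[OF assms(1)]]\<close>)
qed

lemma Hom_comp_smult_left:
  assumes "k \<in> carrier K" "\<phi> \<in> carrier (Hom_Z n)" "f \<in> carrier (End_deg A Z m)"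
  shows "Hom_comp Z n m (k \<odot>\<^bsub>Hom_Z n\<^esub> \<phi>) f = k \<odot>\<^bsub>Hom_Z (n + m)\<^esub> Hom_comp Z n m \<phi> f"
proof -
  interpret HM: module K "Hom_Z i" for i by (rule H.C_module)
  show ?thesis
    by (rule Hom_eqI[of _ "n + m"])
      (use assms in \<open>auto simp: Hom_comp_closed Hom_comp_apply Hom_apply End_closed[OF assms(3)]\<close>)
qed

lemma Hom_comp_smult_right:
  assumes "k \<in> carrier K" "\<phi> \<in> carrier (Hom_Z n)" "f \<in> carrier (End_deg A Z m)"
  shows "Hom_comp Z n m \<phi> (k \<odot>\<^bsub>End_deg A Z m\<^esub> f) = k \<odot>\<^bsub>Hom_Z (n + m)\<^esub> Hom_comp Z n m \<phi> f"
proof -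
  interpret HM: module K "Hom_Z i" for i by (rule H.C_module)
  interpret E: module K "End_deg A Z i" for i by (rule End_module)
  show ?thesis
    by (rule Hom_eqI[of _ "n + m"])
      (use assms in \<open>auto simp: Hom_comp_closed Hom_comp_apply Hom_apply End_smult_apply[where q = n]
        End_closed[OF assms(3)] lin_map_smult[OF Hom_lin[OF assms(2)]] scalar_closed\<close>)
qed

theorem Hom_graded_right_module:
  "graded_right_module K (End_deg A Z) (\<lambda>n m. End_comp Z m) (End_id Z) Hom_Z (Hom_comp Z)"
proof (intro graded_right_module.intro[OF End_graded_algebra] graded_right_module_axioms.intro)
  show "Hom_comp Z (n + m) l (Hom_comp Z n m \<phi> f) g = Hom_comp Z n (m + l) \<phi> (End_comp Z l f g)"
    if "\<phi> \<in> carrier (Hom_Z n)" "f \<in> carrier (End_deg A Z m)" "g \<in> carrier (End_deg A Z l)"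
    for \<phi> f g n m l
  proof (rule Hom_eqI[of _ "n + m + l"])
    show "Hom_comp Z (n + m) l (Hom_comp Z n m \<phi> f) g \<in> carrier (Hom_Z (n + m + l))"
      using that by (intro Hom_comp_closed)
    show "Hom_comp Z n (m + l) \<phi> (End_comp Z l f g) \<in> carrier (Hom_Z (n + m + l))"
      using Hom_comp_closed[OF that(1) End_comp_closed[OF that(2,3)]] by (simp add: add.assoc)
    show "Hom_comp Z (n + m) l (Hom_comp Z n m \<phi> f) g z = Hom_comp Z n (m + l) \<phi> (End_comp Z l f g) z"
      if z: "z \<in> carrier (Z (n + m + l))" for z
      using End_closed[OF \<open>g \<in> _\<close> z, of "n + m"] z
        Hom_comp_apply[of z n "m + l" \<phi> "End_comp Z l f g"]
      by (simp add: Hom_comp_apply End_comp_apply flip: add.assoc)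
  qed
  show "Hom_comp Z n 0 \<phi> (End_id Z) = \<phi>" if "\<phi> \<in> carrier (Hom_Z n)" for \<phi> n
  proof (rule Hom_eqI[OF _ that])
    show "Hom_comp Z n 0 \<phi> (End_id Z) \<in> carrier (Hom_Z n)"
      using Hom_comp_closed[OF that End_id_closed] by simp
  qed (simp add: Hom_comp_def End_id_def)
qed (auto intro: H.C_module Hom_comp_closed Hom_comp_add_left Hom_comp_add_right
    Hom_comp_smult_left Hom_comp_smult_right)

text \<open>Here \<open>d \<phi> = \<phi> d\<close>, and \<open>\<phi> (d f) = \<phi> d f + (-1)\<^bsup>m+1\<^esup> \<phi> f d\<close>. Multiplying by
  \<open>(-1)\<^bsup>m+1\<^esup>\<close> and adding \<open>(-1)\<^sup>m (d \<phi>) f\<close> leaves \<open>\<phi> f d\<close>, the differential of \<open>\<phi> f\<close>.\<close>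

theorem Hom_dg_right_module:
  "dg_pairing K Hom_Z (Hom_diff Z d) (End_deg A Z) (End_diff Z d) Hom_Z (Hom_diff Z d)
    (Hom_comp Z) (\<lambda>n m. m) (\<lambda>n m. m + 1)"
proof (intro dg_pairing.intro dg_pairing_axioms.intro End_complex Hom_Z_complex)
  fix \<phi> f n m assume \<phi>: "\<phi> \<in> carrier (Hom_Z n)" and f: "f \<in> carrier (End_deg A Z m)"
  interpret HM: module K "Hom_Z i" for i by (rule H.C_module)
  let ?N = "n + m + 1"
  have D\<phi>_f: "Hom_comp Z (n + 1) m (Hom_diff Z d n \<phi>) f \<in> carrier (Hom_Z ?N)"
    using Hom_comp_closed[OF H.\<delta>_closed[OF \<phi>] f] by (simp add: algebra_simps)
  have \<phi>_Df: "Hom_comp Z n (m + 1) \<phi> (End_diff Z d m f) \<in> carrier (Hom_Z ?N)"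
    using Hom_comp_closed[OF \<phi> End_diff_closed[OF f]] by (simp add: algebra_simps)
  show "Hom_diff Z d (n + m) (Hom_comp Z n m \<phi> f)
    = signed (Hom_Z ?N) m (Hom_comp Z (n + 1) m (Hom_diff Z d n \<phi>) f)
      \<oplus>\<^bsub>Hom_Z ?N\<^esub> signed (Hom_Z ?N) (m + 1) (Hom_comp Z n (m + 1) \<phi> (End_diff Z d m f))"
  proof (rule Hom_eqI[of _ ?N])
    show "Hom_diff Z d (n + m) (Hom_comp Z n m \<phi> f) \<in> carrier (Hom_Z ?N)"
      by (rule H.\<delta>_closed[OF Hom_comp_closed[OF \<phi> f]])
    show "signed (Hom_Z ?N) m (Hom_comp Z (n + 1) m (Hom_diff Z d n \<phi>) f)
      \<oplus>\<^bsub>Hom_Z ?N\<^esub> signed (Hom_Z ?N) (m + 1) (Hom_comp Z n (m + 1) \<phi> (End_diff Z d m f))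
      \<in> carrier (Hom_Z ?N)"
      using D\<phi>_f \<phi>_Df by simp
    fix z assume z: "z \<in> carrier (Z ?N)"
    interpret Q: abelian_group "Z n" by (rule Z_group)
    have dz: "d ?N z \<in> carrier (Z (n + m))" using d_closed[OF z] by simp
    have fz: "f ?N z \<in> carrier (Z (n + 1))" using End_closed[OF f z] by simp
    have dfz: "d (n + 1) (f ?N z) \<in> carrier (Z n)" using d_closed[OF fz] by simp
    have fdz: "f (n + m) (d ?N z) \<in> carrier (Z n)" using End_closed[OF f dz] by simp
    note l = Hom_lin[OF \<phi>]
    note c = lin_map_closed[OF l dfz] lin_map_closed[OF l fdz]
    have 1: "Hom_diff Z d (n + m) (Hom_comp Z n m \<phi> f) z = \<phi> (f (n + m) (d ?N z))"
      using z dz by (simp add: Hom_diff_def Hom_comp_apply)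
    have "n + 1 + m = ?N" "n + (m + 1) = ?N" by simp_all
    then have 2: "Hom_comp Z (n + 1) m (Hom_diff Z d n \<phi>) f z = \<phi> (d (n + 1) (f ?N z))"
      and 3: "Hom_comp Z n (m + 1) \<phi> (End_diff Z d m f) z = \<phi> (End_diff Z d m f ?N z)"
      using z fz by (simp_all only: Hom_comp_apply) (simp add: Hom_diff_def)
    have 4: "\<phi> (End_diff Z d m f ?N z)
      = \<phi> (d (n + 1) (f ?N z)) \<oplus>\<^bsub>V\<^esub> signed V (m + 1) (\<phi> (f (n + m) (d ?N z)))"
      using lin_map_add[OF l dfz, of "signed (Z n) (m + 1) (f (n + m) (d ?N z))"] fdz
        lin_map_signed[OF l Z_group V.M.abelian_group_axioms fdz]
      by (simp add: End_diff_apply[OF f z, of n "n + 1" "n + m"])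
    have "\<phi> (f (n + m) (d ?N z)) = signed V m (\<phi> (d (n + 1) (f ?N z)))
      \<oplus>\<^bsub>V\<^esub> signed V (m + 1) (\<phi> (d (n + 1) (f ?N z)) \<oplus>\<^bsub>V\<^esub> signed V (m + 1) (\<phi> (f (n + m) (d ?N z))))"
      using c V.M.signed_succ_cancel(2)[OF c(1), of m]
      by (simp add: V.M.signed_add flip: V.M.a_assoc)
    then show "Hom_diff Z d (n + m) (Hom_comp Z n m \<phi> f) z
      = (signed (Hom_Z ?N) m (Hom_comp Z (n + 1) m (Hom_diff Z d n \<phi>) f)
        \<oplus>\<^bsub>Hom_Z ?N\<^esub> signed (Hom_Z ?N) (m + 1) (Hom_comp Z n (m + 1) \<phi> (End_diff Z d m f))) z"
      using D\<phi>_f \<phi>_Df z by (simp add: Hom_apply Hom_signed_apply 1 2 3 4)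
  qed
qed (auto intro: Hom_comp_closed Hom_comp_add_left Hom_comp_add_right)

end

end


section \<open>Transport along an isomorphism of complexes\<close>

text \<open>The axioms constrain an action only on the carriers, whereas an action given by unions over
  representatives may agree with another one only there.\<close>

lemma graded_right_module_cong:
  assumes "graded_right_module K G mul u H act"
    and eq: "\<And>n m c x. c \<in> carrier (H n) \<Longrightarrow> x \<in> carrier (G m) \<Longrightarrow> act' n m c x = act n m c x"
  shows "graded_right_module K G mul u H act'"
proof -
  interpret graded_right_module K G mul u H act by fact
  have "abelian_group (H n)" "abelian_group (G n)" for n
    using H_module[of n] G_module[of n] by (simp_all add: module_def)
  then interpret H: module K "H n" + G: module K "G n" for n
    using H_module G_module by auto
  show ?thesis
    by (intro graded_right_module.intro[OF graded_algebra_axioms] graded_right_module_axioms.intro)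
      (simp_all add: eq H_module act_closed act_add_left act_add_right act_smult_left act_smult_right
        act_act act_unit mul_closed unit_closed)
qed

text \<open>The differential graded action is known on \<open>Hom\<^sub>A(A \<otimes>\<^sub>B X, V)\<close> but cohomology is formed with
  \<open>Hom\<^sub>B(X, V)\<close>; conjugating by a cochain isomorphism moves all the structure across.\<close>

locale isomorphic_complexes =
  H: cochain_complex K H \<delta> + H': cochain_complex K H' \<delta>'
  for K :: "'k ring" and H :: "int \<Rightarrow> ('k, 'h) module" and \<delta>
    and H' :: "int \<Rightarrow> ('k, 'i) module" and \<delta>' +
  fixes r :: "int \<Rightarrow> 'h \<Rightarrow> 'i"
  assumes iso: "cochain_iso K H \<delta> H' \<delta>' r"
begin

abbreviation r_inv where "r_inv n \<equiv> inv_into (carrier (H n)) (r n)"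

lemma r_lin: "lin_map K (H n) (H' n) (r n)"
  and r_bij: "bij_betw (r n) (carrier (H n)) (carrier (H' n))"
  and r_\<delta>: "c \<in> carrier (H n) \<Longrightarrow> r (n + 1) (\<delta> n c) = \<delta>' n (r n c)"
  using iso by (auto simp: cochain_iso_def)

lemma r_closed: "c \<in> carrier (H n) \<Longrightarrow> r n c \<in> carrier (H' n)"
  by (rule lin_map_closed[OF r_lin])

lemma r_inv_r: "c \<in> carrier (H n) \<Longrightarrow> r_inv n (r n c) = c"
  by (rule bij_betw_inv_into_left[OF r_bij])

lemma r_r_inv: "c \<in> carrier (H' n) \<Longrightarrow> r n (r_inv n c) = c"
  by (rule bij_betw_inv_into_right[OF r_bij])

lemma r_inv_closed: "c \<in> carrier (H' n) \<Longrightarrow> r_inv n c \<in> carrier (H n)"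
  using bij_betwE[OF bij_betw_inv_into[OF r_bij]] by blast

lemma r_inv_eqI: "\<lbrakk>c \<in> carrier (H n); r n c = c'\<rbrakk> \<Longrightarrow> r_inv n c' = c"
  using r_inv_r by blast

lemma r_inv_add:
  assumes "c \<in> carrier (H' n)" "c' \<in> carrier (H' n)"
  shows "r_inv n (c \<oplus>\<^bsub>H' n\<^esub> c') = r_inv n c \<oplus>\<^bsub>H n\<^esub> r_inv n c'"
proof -
  interpret H: module K "H n" by (rule H.C_module)
  show ?thesis using assms
    by (intro r_inv_eqI) (auto simp: lin_map_add[OF r_lin] r_inv_closed r_r_inv)
qed

lemma r_inv_smult:
  assumes "k \<in> carrier K" "c \<in> carrier (H' n)"
  shows "r_inv n (k \<odot>\<^bsub>H' n\<^esub> c) = k \<odot>\<^bsub>H n\<^esub> r_inv n c"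
proof -
  interpret H: module K "H n" by (rule H.C_module)
  show ?thesis using assms
    by (intro r_inv_eqI) (auto simp: lin_map_smult[OF r_lin] r_inv_closed r_r_inv)
qed

lemma r_inv_\<delta>: "c \<in> carrier (H' n) \<Longrightarrow> r_inv (n + 1) (\<delta>' n c) = \<delta> n (r_inv n c)"
  by (intro r_inv_eqI) (auto simp: H.\<delta>_closed r_inv_closed r_\<delta> r_r_inv)

theorem transport_graded_right_module:
  assumes "graded_right_module K G mul u H act"
  shows "graded_right_module K G mul u H' (\<lambda>n m c x. r (n + m) (act n m (r_inv n c) x))"
proof -
  interpret graded_right_module K G mul u H act by fact
  show ?thesis
    by (intro graded_right_module.intro[OF graded_algebra_axioms] graded_right_module_axioms.intro)
      (simp_all add: H'.C_module r_closed r_inv_closed r_inv_add r_inv_smult r_inv_r r_r_inv act_closed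
        act_add_left act_add_right act_smult_left act_smult_right act_unit
        lin_map_add[OF r_lin] lin_map_smult[OF r_lin] act_act add.assoc)
qed

theorem transport_dg_pairing:
  assumes "dg_pairing K H \<delta> G \<delta>G H \<delta> act s t"
  shows "dg_pairing K H' \<delta>' G \<delta>G H' \<delta>' (\<lambda>n m c x. r (n + m) (act n m (r_inv n c) x)) s t"
proof -
  interpret P: dg_pairing K H \<delta> G \<delta>G H \<delta> act s t by fact
  show ?thesis
  proof (intro dg_pairing.intro dg_pairing_axioms.intro H'.cochain_complex_axioms P.D.cochain_complex_axioms)
    fix c x n m assume c: "c \<in> carrier (H' n)" and x: "x \<in> carrier (G m)"
    interpret N: abelian_group "H (n + m + 1)" by (rule H.abelian)
    have i: "n + 1 + m = n + m + 1" "n + (m + 1) = n + m + 1" by simp_all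
    have 1: "act (n + 1) m (\<delta> n (r_inv n c)) x \<in> carrier (H (n + m + 1))"
      using P.mul_closed[OF H.\<delta>_closed[OF r_inv_closed[OF c]] x] by (simp only: i)
    have 2: "act n (m + 1) (r_inv n c) (\<delta>G m x) \<in> carrier (H (n + m + 1))"
      using P.mul_closed[OF r_inv_closed[OF c] P.D.\<delta>_closed[OF x]] by (simp only: i)
    show "\<delta>' (n + m) (r (n + m) (act n m (r_inv n c) x))
      = signed (H' (n + m + 1)) (s n m) (r (n + 1 + m) (act (n + 1) m (r_inv (n + 1) (\<delta>' n c)) x))
        \<oplus>\<^bsub>H' (n + m + 1)\<^esub> signed (H' (n + m + 1)) (t n m) (r (n + (m + 1)) (act n (m + 1) (r_inv n c) (\<delta>G m x)))"
      using 1 2 unfolding i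
      by (simp add: P.mul_closed r_inv_closed c x r_inv_\<delta> P.leibniz lin_map_add[OF r_lin]
          lin_map_signed[OF r_lin H.abelian H'.abelian] flip: r_\<delta>)
  qed (simp_all add: r_closed r_inv_closed P.mul_closed r_inv_add P.mul_add_left P.mul_add_right
      lin_map_add[OF r_lin])
qed

end


section \<open>The action of the Hecke algebra\<close>

text \<open>Compatibility with the differentials is \<open>(id \<otimes> d)(1 \<otimes> x) = 1 \<otimes> d x\<close>.\<close>

theorem restriction_cochain_iso:
  assumes A: "assoc_algebra K A" and B: "unital_subalgebra K A B"
    and X: "chain_complex (A\<lparr>carrier := B\<rparr>) X d" and V: "left_module A V"
  shows "cochain_iso K (ind_Hom A B X V) (ind_Hom_diff A B X d)
           (Hom_deg A B X V) (Hom_diff X d) (restr A B X)"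
proof -
  interpret assoc_algebra K A by fact
  interpret V: left_module A V by fact
  have sub: "subring B A" using B by (simp add: unital_subalgebra_def)
  have Xm: "left_module (A\<lparr>carrier := B\<rparr>) (X p)" for p using X by (simp add: chain_complex_def)
  have I: "induction_data A B (X p)" for p
    by (rule induction_data.intro[OF ring_axioms sub Xm])
  have dlin: "lin_map (A\<lparr>carrier := B\<rparr>) (X (n + 1)) (X n) (d (n + 1))" for n
    using X by (auto simp: chain_complex_def dest: spec[of _ "n + 1"])
  have D: "induction_map A B (X (n + 1)) (X n) (d (n + 1))" for n
    using I dlin by (simp add: induction_map_def induction_map_axioms_def)
  note pure = induction_data.pure_closed[OF I one_closed]
  have bij: "bij_betw (restr A B X n) (carrier (ind_Hom A B X V n)) (carrier (Hom_deg A B X V n))" for n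
    using restriction_bij[OF ring_axioms sub Xm V, of n]
    by (simp add: Hom_deg_def restr_def[abs_def])
  show ?thesis
    unfolding cochain_iso_def lin_map_def
  proof (intro allI conjI ballI)
    show "restr A B X n \<in> carrier (ind_Hom A B X V n) \<rightarrow> carrier (Hom_deg A B X V n)" for n
      using bij_betwE[OF bij] by blast
    fix n \<phi> assume "\<phi> \<in> carrier (ind_Hom A B X V n)"
    show "restr A B X (n + 1) (ind_Hom_diff A B X d n \<phi>) = Hom_diff X d n (restr A B X n \<phi>)"
      using induction_map.induced_map_pure[OF D one_closed] pure lin_map_closed[OF dlin]
      by (auto simp: restr_def Hom_diff_def)
  qed (use bij pure in \<open>auto simp: restr_def Hom_deg_def\<close>)
qed

text \<open>Since restriction is bijective, lifting the members of \<open>S\<close> to \<open>Hom\<^sub>A(A \<otimes>\<^sub>B X, V)\<close> is the same as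
  applying the inverse of the restriction, so the action of the Hecke algebra is the product on
  cohomology induced by the transported action.\<close>

lemma hecke_act_eq_induced_product:
  assumes bij: "bij_betw (restr A B X n) (carrier (ind_Hom A B X V n)) (carrier (Hom_deg A B X V n))"
    and S: "S \<subseteq> carrier (Hom_deg A B X V n)"
  shows "hecke_act A B X d V n m S T = induced_product (Hom_deg A B X V) (Hom_diff X d)
    (\<lambda>n m \<psi> f. restr A B X (n + m) (Hom_comp (induced_complex A B X) n m
      (inv_into (carrier (ind_Hom A B X V n)) (restr A B X n) \<psi>) f)) n m S T"
proof -
  let ?i = "inv_into (carrier (ind_Hom A B X V n)) (restr A B X n)"
  have "{\<phi> \<in> carrier (ind_Hom A B X V n). restr A B X n \<phi> \<in> S} = ?i ` S"
  proof safe
    fix \<phi> assume \<phi>: "\<phi> \<in> carrier (ind_Hom A B X V n)" "restr A B X n \<phi> \<in> S"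
    show "\<phi> \<in> ?i ` S"
      by (rule image_eqI[where x = "restr A B X n \<phi>"]) (simp_all add: \<phi> bij_betw_inv_into_left[OF bij])
  next
    fix \<psi> assume "\<psi> \<in> S"
    then show "?i \<psi> \<in> carrier (ind_Hom A B X V n)" "restr A B X n (?i \<psi>) \<in> S"
      using S bij_betwE[OF bij_betw_inv_into[OF bij]] bij_betw_inv_into_right[OF bij, of \<psi>] by auto
  qed
  then show ?thesis by (simp add: hecke_act_def induced_product_def)
qed

theorem theorem5:
  fixes K :: "'k ring"
    and A :: "('k, 'a) module"
    and B :: "'a set"
    and \<epsilon> :: "'a \<Rightarrow> 'k"
    and X :: "int \<Rightarrow> ('a, 'x) module"
    and d :: "int \<Rightarrow> 'x \<Rightarrow> 'x"
    and \<pi> :: "'x \<Rightarrow> 'k"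
    and V :: "('a, 'v) module"
  assumes "assoc_algebra K A"
    and "unital_subalgebra K A B"
    and "augmentation K A B \<epsilon>"
    and "projective_resolution (A\<lparr>carrier := B\<rparr>) (augmentation_module K \<epsilon>) X d \<pi>"
    and "left_module A V"
  shows "cochain_iso K (ind_Hom A B X V) (ind_Hom_diff A B X d)
           (Hom_deg A B X V) (Hom_diff X d) (restr A B X)
         \<and> (\<forall>n m.
           \<forall>\<phi>\<in>cocycles (ind_Hom A B X V) (ind_Hom_diff A B X d) n.
           \<forall>f\<in>cocycles (hecke_cochains A B X) (hecke_diff A B X d) m.
             hecke_act A B X d V n m
               (ext_class A B X d V n (restr A B X n \<phi>)) (hecke_class A B X d m f)
             = ext_class A B X d V (n + m)
                 (restr A B X (n + m) (Hom_comp (induced_complex A B X) n m \<phi> f)))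
         \<and> graded_right_module K
             (hecke A B X d) (hecke_mult A B X d) (hecke_one A B X d)
             (ext_module A B X d V) (hecke_act A B X d V)"
proof -
  interpret assoc_algebra K A by fact
  have X: "chain_complex (A\<lparr>carrier := B\<rparr>) X d"
    using assms(4) by (simp add: projective_resolution_def)
  have sub: "subring B A" using assms(2) by (simp add: unital_subalgebra_def)
  let ?Z = "induced_complex A B X" and ?D = "induced_diff A B X d"
  let ?G = "hecke_cochains A B X" and ?\<delta>G = "hecke_diff A B X d"
  let ?H = "Hom_deg A B X V" and ?\<delta>H = "Hom_diff X d" and ?r = "restr A B X"
  define act where "act = (\<lambda>n m \<psi> f. ?r (n + m) (Hom_comp ?Z n m
      (inv_into (carrier (ind_Hom A B X V n)) (?r n) \<psi>) f))"
  interpret Z: algebra_complex K A ?Z ?D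
    by (intro algebra_complex.intro algebra_complex_axioms.intro assms(1)
        induced_chain_complex[OF ring_axioms sub X])
  note iso = restriction_cochain_iso[OF assms(1,2) X assms(5)]
  note complexes = Z.Hom_Z_complex[OF assms(5)] Hom_complex[OF assms(2) X assms(5)]
  have bij: "bij_betw (?r n) (carrier (ind_Hom A B X V n)) (carrier (?H n))" for n
    using iso by (simp add: cochain_iso_def)
  interpret R: isomorphic_complexes K "ind_Hom A B X V" "ind_Hom_diff A B X d" ?H ?\<delta>H ?r
    by (intro isomorphic_complexes.intro isomorphic_complexes_axioms.intro complexes iso)
  have grm: "graded_right_module K ?G (\<lambda>n m. End_comp ?Z m) (End_id ?Z) ?H act"
    unfolding act_def
    by (rule R.transport_graded_right_module[OF Z.Hom_graded_right_module[OF assms(5)]])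
  have dg: "dg_pairing K ?H ?\<delta>H ?G ?\<delta>G ?H ?\<delta>H act (\<lambda>n m. m) (\<lambda>n m. m + 1)"
    unfolding act_def
    by (rule R.transport_dg_pairing[OF Z.Hom_dg_right_module[OF assms(5)]])
  interpret P: dg_pairing K ?H ?\<delta>H ?G ?\<delta>G ?H ?\<delta>H act "\<lambda>n m. m" "\<lambda>n m. m + 1" by (rule dg)
  have act_eq: "hecke_act A B X d V n m S T = induced_product ?H ?\<delta>H act n m S T"
    if "S \<subseteq> carrier (?H n)" for n m S T
    unfolding act_def by (rule hecke_act_eq_induced_product[OF bij that])
  have sub_carrier: "S \<subseteq> carrier (?H n)" if "S \<in> carrier (ext_module A B X d V n)" for S n
    using that R.H'.class_subset_cocycles R.H'.cocycle_closed by (blast elim: R.H'.cohomology_cases)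
  have mult_eq: "hecke_mult A B X d = induced_product ?G ?\<delta>G (\<lambda>n m. End_comp ?Z m)"
    by (intro ext) (simp add: hecke_mult_def induced_product_def)
  have "graded_right_module K (hecke A B X d) (hecke_mult A B X d) (hecke_one A B X d)
      (ext_module A B X d V) (induced_product ?H ?\<delta>H act)"
    unfolding mult_eq hecke_one_def
    by (rule graded_right_module_cohomology[OF grm Z.End_dg_algebra Z.End_id_cocycle dg])
  then have "graded_right_module K (hecke A B X d) (hecke_mult A B X d) (hecke_one A B X d)
      (ext_module A B X d V) (hecke_act A B X d V)"
    by (rule graded_right_module_cong) (simp add: act_eq sub_carrier)
  moreover have "hecke_act A B X d V n m (ext_class A B X d V n (?r n \<phi>)) (hecke_class A B X d m f)
      = ext_class A B X d V (n + m) (?r (n + m) (Hom_comp ?Z n m \<phi> f))"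
    if \<phi>: "\<phi> \<in> cocycles (ind_Hom A B X V) (ind_Hom_diff A B X d) n" and f: "f \<in> cocycles ?G ?\<delta>G m" for n m \<phi> f
  proof -
    note \<phi>c = R.H.cocycle_closed[OF \<phi>]
    have lin: "lin_map K (ind_Hom A B X V n) (?H n) (?r n)" for n
      using iso by (simp add: cochain_iso_def)
    have "?\<delta>H n (?r n \<phi>) = ?r (n + 1) (ind_Hom_diff A B X d n \<phi>)"
      using iso \<phi>c by (simp add: cochain_iso_def)
    also have "\<dots> = \<zero>\<^bsub>?H (n + 1)\<^esub>"
      using lin_map_zero[OF lin R.H.abelian R.H'.abelian] R.H.cocycle_\<delta>[OF \<phi>] by simp
    finally have r\<phi>: "?r n \<phi> \<in> cocycles ?H ?\<delta>H n"
      using lin_map_closed[OF lin \<phi>c] by (simp add: cocycles_def)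
    have "hecke_act A B X d V n m (ext_class A B X d V n (?r n \<phi>)) (hecke_class A B X d m f)
      = ext_class A B X d V (n + m) (act n m (?r n \<phi>) f)"
      using P.induced_product_class[OF r\<phi> f] act_eq[OF sub_carrier[OF R.H'.class_in_cohomology[OF r\<phi>]]] by simp
    also have "act n m (?r n \<phi>) f = ?r (n + m) (Hom_comp ?Z n m \<phi> f)"
      using bij_betw_inv_into_left[OF bij \<phi>c] by (simp add: act_def)
    finally show ?thesis .
  qed
  ultimately show ?thesis using iso by blast
qed

end
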